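(* (i) Suppose that $a_n\ge 0$ for every $n\ge 1$. Then $f(s):=\sum_{n=1}^\infty a_nn^{-s}$ is in $\mathrm{BMOA}$ if and only if $$S^2:=\sup_{x\ge e}\ \sum_{k=1}^\infty\Big(\sum_{x^k\le n<x^{k+1}}a_n\Big)^2<\infty,$$ and we have $S\asymp\|f\|_{\mathrm{BMOA}}$. (ii) If $\sum_{n=1}^\infty|a_n|n^{-s}$ is in $\mathrm{BMOA}$, then $\sum_{n=1}^\infty a_nn^{-s}$ is in $\mathrm{BMOA}$.
   Context: In (ii), $(a_n)_{n\ge1}$ are complex numbers. $\mathrm{BMOA}$ is the space of analytic functions $f$ in the right half-plane $\{\operatorname{Re}s>0\}$ satisfying $$\sup_{\sigma>0}\int_{-\infty}^\infty\frac{|f(\sigma+it)|^2}{1+\sigma^2+t^2}\,dt<\infty$$ and $$\|f\|_{\mathrm{BMO}}:=\sup_{I\subset\mathbb{R}}\frac1{|I|}\int_I\Big|f(it)-\frac1{|I|}\int_If(i\tau)\,d\tau\Big|\,dt<\infty,$$ where the supremum is over all finite intervals $I$ and $f(it):=\lim_{\sigma\to0^+}f(\sigma+it)$, which exists for almost every real $t$ by the first condition. Here $\|f\|_{\mathrm{BMOA}}$ denotes this norm $\|f\|_{\mathrm{BMO}}$. A Dirichlet series is said to be in $\mathrm{BMOA}$ if it converges in some half-plane $\operatorname{Re}s>\sigma_0$ and its sum extends to an analytic function on $\operatorname{Re}s>0$ belonging to $\mathrm{BMOA}$. $A\asymp B$ means that $A\le CB$ and $B\le CA$ for some constant $C>0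$.
   Formalization: The comparison S ≍ ‖f‖_BMOA is false as printed: f(s)=2^{-s} has S=0 but positive norm, since the blocks contain only n≥3. It is proved as S + a_2 ≍ ‖f‖_BMOA with an absolute constant; the equivalence and (ii) are as printed. *)

theory Defs
  imports "HOL-Complex_Analysis.Complex_Analysis"
begin

abbreviation right_half_plane :: "complex set" where
  "right_half_plane \<equiv> {s. Re s > 0}"

text \<open>Where the horizontal limit does not exist (a null set for the functions of interest),
  \<^const>\<open>Lim\<close> has one fixed unspecified value, so boundary functions stay Borel measurable.\<close>

definition boundary_value :: "(complex \<Rightarrow> complex) \<Rightarrow> real \<Rightarrow> complex" where
  "boundary_value f t = Lim (at_right 0) (\<lambda>\<sigma>. f (Complex \<sigma> t))"

definition interval_mean :: "(real \<Rightarrow> complex) \<Rightarrow> real \<Rightarrow> real \<Rightarrow> complex" where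
  "interval_mean g a b = (LBINT \<tau>:{a..b}. g \<tau>) / complex_of_real (b - a)"

definition BMO_enorm :: "(real \<Rightarrow> complex) \<Rightarrow> ennreal" where
  "BMO_enorm g = (SUP (a, b) \<in> {(a, b). a < b}.
     (\<integral>\<^sup>+ t\<in>{a..b}. ennreal (cmod (g t - interval_mean g a b)) \<partial>lborel) / ennreal (b - a))"

definition BMOA :: "(complex \<Rightarrow> complex) set" where
  "BMOA = {f. f holomorphic_on right_half_plane \<and>
     (SUP \<sigma> \<in> {0<..}. \<integral>\<^sup>+ t. ennreal ((cmod (f (Complex \<sigma> t)))\<^sup>2 / (1 + \<sigma>\<^sup>2 + t\<^sup>2)) \<partial>lborel)
       < (\<infinity>::ennreal) \<and>
     BMO_enorm (boundary_value f) < \<infinity>}"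

definition BMOA_norm :: "(complex \<Rightarrow> complex) \<Rightarrow> real" where
  "BMOA_norm f = enn2real (BMO_enorm (boundary_value f))"

text \<open>\<open>f\<close> is an analytic continuation to the right half-plane of the Dirichlet series with
  coefficients \<open>a 1, a 2, \<dots>\<close>. Only the values of \<open>f\<close> on the right half-plane matter for
  \<^const>\<open>BMOA\<close> and \<^const>\<open>BMOA_norm\<close>, and these are determined by \<open>a\<close>.\<close>

definition dirichlet_extension :: "(nat \<Rightarrow> complex) \<Rightarrow> (complex \<Rightarrow> complex) \<Rightarrow> bool" where
  "dirichlet_extension a f \<longleftrightarrow> f holomorphic_on right_half_plane \<and>
     (\<exists>\<sigma>\<^sub>0::real. \<forall>s. Re s > \<sigma>\<^sub>0 \<longrightarrow>
        (\<lambda>n. a (Suc n) * of_nat (Suc n) powr (- s)) sums f s)"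

definition dirichlet_in_BMOA :: "(nat \<Rightarrow> complex) \<Rightarrow> bool" where
  "dirichlet_in_BMOA a \<longleftrightarrow> (\<exists>f. dirichlet_extension a f \<and> f \<in> BMOA)"

text \<open>The quantity \<open>S\<^sup>2\<close>. Since \<open>x \<ge> e\<close> and the exponents start at 1, the coefficients \<open>a 1\<close> and
  \<open>a 2\<close> do not enter it. Constants have norm zero, so \<open>a 1\<close> is irrelevant to the norm, but \<open>a 2\<close>
  is not: the series \<open>2\<^bsup>-s\<^esup>\<close> has \<open>S = 0\<close> and positive norm. Hence a two-sided norm estimate
  has to involve \<open>S + a 2\<close> instead of \<open>S\<close>.\<close>

definition block_sup :: "(nat \<Rightarrow> real) \<Rightarrow> ennreal" where
  "block_sup a = (SUP x \<in> {exp (1::real)..}.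
     \<Sum>k. ennreal ((\<Sum>n | x ^ Suc k \<le> real n \<and> real n < x ^ Suc (Suc k). a n)\<^sup>2))"

definition block_S :: "(nat \<Rightarrow> real) \<Rightarrow> real" where
  "block_S a = sqrt (enn2real (block_sup a))"

end

theory Submission
  imports Defs "HOL-Real_Asymp.Real_Asymp"
begin

text \<open>Every estimate rests on the kernel \<open>exp (-\<bar>t\<bar> / T)\<close>, whose Fourier transform \<open>2T / (1 + T\<^sup>2 x\<^sup>2)\<close> is
  positive, decreasing in \<open>\<bar>x\<bar>\<close> and summable over blocks of length \<open>1 / T\<close>.

  Sufficiency: Schur's test bounds the weighted \<open>L\<^sup>2\<close> norm of \<open>\<Sum> a\<^sub>n n\<^bsup>-it\<^esup>\<close> by the square sum of the block
  masses \<open>\<Sum> \<bar>a\<^sub>n\<bar>\<close>. On an interval of length \<open>T\<close> this controls the frequencies \<open>ln n \<ge> 1 / T\<close>, while the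
  lower ones vary by at most \<open>T \<Sum> \<bar>a\<^sub>n\<bar> ln n\<close>, which a dyadic decomposition bounds by the first blocks.
  Only \<open>\<bar>a\<^sub>n\<bar>\<close> matters, whence (ii). The limit \<open>f(it)\<close> exists almost everywhere because
  \<open>f(\<sigma> + it)\<close> differs from the average of the \<open>L\<^sup>2\<close> boundary function over \<open>[t, t + \<sigma>]\<close> by an error that is
  square summable over the dyadic \<open>\<sigma>\<close>, the averages converge by Lebesgue's theorem, and
  \<open>\<integral> \<sigma> \<bar>f'(\<sigma> + it)\<bar>\<^sup>2 d\<sigma>\<close> over \<open>(0, 1)\<close> is finite almost everywhere.

  Necessity: for \<open>a\<^sub>n \<ge> 0\<close> the series converges for \<open>\<sigma> > 0\<close> by Landau's theorem. Convolving the boundary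
  function with a narrow kernel does not increase its oscillation, keeps the coefficients
  nonnegative and makes them summable, so that it is continuous; then a Calderon--Zygmund argument turns the
  \<open>L\<^sup>1\<close> oscillation into an \<open>L\<^sup>2\<close> oscillation. Since the Fourier transform of the kernel is positive
  and decreasing, all terms in the expansion of the weighted variance are nonnegative, and those with both
  frequencies in one block sum to a multiple of the square of its mass.\<close>

section \<open>The exponential kernel\<close>

text \<open>The obstacle in the necessity part is circular: the boundary function can be expanded in
  its frequencies only once some block condition is known, and that is what the norm should yield.
  The square integral in the definition of \<open>BMOA\<close> breaks the circle. Inside the
  half-plane the series converges absolutely, so the lower energy bound on vertical lines gives the
  block condition at \<open>x = e\<close>, with a constant that does not enter the norm estimate.
  This makes the boundary function available, and only then does its mean oscillation control all
  scales. The partial sums run along a subsequence chosen from the tails of the block squares, so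
  that their differences are summable almost everywhere. A scale \<open>x = exp L\<close> is treated
  through intervals of length \<open>L >= 1\<close> for the frequencies \<open>ln n\<close>. The
  necessity estimate holds for every kernel width \<open>T > 0\<close>, also for blocks shorter than
  1, and this freedom recovers \<open>a 2\<close>, which lies in none of the blocks of the
  theorem.\<close>

lemma borel_measurable_cis [measurable (raw)]:
  "f \<in> borel_measurable M \<Longrightarrow> (\<lambda>x. cis (f x)) \<in> borel_measurable M"
  by (rule borel_measurable_continuous_on[of cis]) (auto intro!: continuous_intros)

lemma exp_integral_half_line:
  fixes z :: complex
  assumes "Re z > 0"
  shows "has_bochner_integral lborel (\<lambda>t::real. indicator {0..} t *\<^sub>R exp (- z * of_real t)) (1 / z)"
proof -
  have nn: "(\<integral>\<^sup>+t. ennreal (exp (- Re z * t)) * indicator {0..} t \<partial>lborel) = ennreal (0 - (- exp (- Re z * 0) / Re z))"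
  proof (rule nn_integral_FTC_atLeast)
    show "((\<lambda>t. - exp (- Re z * t) / Re z) \<longlongrightarrow> 0) at_top"
      using assms by real_asymp
  qed (use assms in \<open>auto intro!: derivative_eq_intros simp: field_simps\<close>)
  have int: "integrable lborel (\<lambda>t::real. indicator {0..} t *\<^sub>R exp (- z * of_real t))"
  proof (rule integrableI_bounded)
    have "(\<integral>\<^sup>+t. ennreal (norm (indicator {0..} t *\<^sub>R exp (- z * complex_of_real t))) \<partial>lborel)
        = (\<integral>\<^sup>+t. ennreal (exp (- Re z * t)) * indicator {0..} t \<partial>lborel)"
      by (intro nn_integral_cong) (auto simp: indicator_def)
    also have "\<dots> < \<infinity>" unfolding nn by simp
    finally show "(\<integral>\<^sup>+t. ennreal (norm (indicator {0..} t *\<^sub>R exp (- z * complex_of_real t))) \<partial>lborel) < \<infinity>" .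
  qed simp
  have z: "z \<noteq> 0" using assms by (metis less_irrefl zero_complex.sel(1))
  have "(LBINT t=ereal 0..\<infinity>. exp (- z * of_real t)) = 0 - (- exp (- z * of_real 0) / z)"
  proof (rule interval_integral_FTC_integrable[where F = "\<lambda>t. - exp (- z * of_real t) / z"])
    show "((\<lambda>t. - exp (- z * complex_of_real t) / z) has_vector_derivative exp (- z * complex_of_real t)) (at t)" for t
      using z by (auto intro!: derivative_eq_intros has_vector_derivative_real_field simp: field_simps)
    show "set_integrable lborel (einterval (ereal 0) \<infinity>) (\<lambda>t. exp (- z * complex_of_real t))"
      by (rule set_integrable_subset[of _ "{0..}"]) (use int in \<open>auto simp: set_integrable_def einterval_def\<close>)
    show "(((\<lambda>t. - exp (- z * complex_of_real t) / z) \<circ> real_of_ereal) \<longlongrightarrow> - exp (- z * of_real 0) / z) (at_right (ereal 0))"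
      unfolding ereal_tendsto_simps using z by (auto intro!: tendsto_eq_intros)
    have "((\<lambda>t. - exp (- z * complex_of_real t) / z) \<longlongrightarrow> 0) at_top"
    proof (rule tendsto_norm_zero_cancel)
      have "((\<lambda>t. exp (- Re z * t) / norm z) \<longlongrightarrow> 0) at_top" using assms z by real_asymp
      then show "((\<lambda>t. norm (- exp (- z * complex_of_real t) / z)) \<longlongrightarrow> 0) at_top"
        by (simp add: norm_divide)
    qed
    then show "(((\<lambda>t. - exp (- z * complex_of_real t) / z) \<circ> real_of_ereal) \<longlongrightarrow> 0) (at_left \<infinity>)"
      unfolding ereal_tendsto_simps .
  qed auto
  also have "(LBINT t=ereal 0..\<infinity>. exp (- z * of_real t)) = (LBINT t:{0..}. exp (- z * of_real t))"
    unfolding interval_lebesgue_integral_0_infty[unfolded zero_ereal_def]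
    unfolding set_lebesgue_integral_def
    by (intro integral_cong_AE eventually_mono[OF AE_lborel_singleton[of 0]]) (auto simp: indicator_def)
  finally show ?thesis
    using int by (simp add: has_bochner_integral_iff set_lebesgue_integral_def)
qed

text \<open>With \<open>z = 1 / T - \<i> * x\<close> the two half-lines contribute
  \<open>1 / z\<close> and \<open>1 / cnj z\<close>, whose sum is
  \<open>2 * Re z / (norm z)\<^sup>2\<close>. The indicators overlap at 0, hence the equality almost
  everywhere.\<close>

lemma exp_kernel_fourier:
  fixes x T :: real
  assumes T: "T > 0"
  shows "has_bochner_integral lborel (\<lambda>t::real. exp (- \<bar>t\<bar> / T) *\<^sub>R cis (x * t)) (of_real (2 * T / (1 + T\<^sup>2 * x\<^sup>2)))"
proof -
  define z where "z = Complex (1 / T) (- x)"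
  have z: "Re z > 0" "Re (cnj z) > 0" using T by (auto simp: z_def)
  have 1: "has_bochner_integral lborel (\<lambda>t::real. indicator {0..} t *\<^sub>R exp (- z * of_real t)) (1 / z)"
    by (rule exp_integral_half_line) fact
  have "has_bochner_integral lborel (\<lambda>t::real. indicator {0..} (0 + (-1) * t) *\<^sub>R exp (- cnj z * of_real (0 + (-1) * t))) ((1 / cnj z) /\<^sub>R \<bar>-1\<bar>)"
    by (rule lborel_has_bochner_integral_real_affine_iff[THEN iffD1]) (use exp_integral_half_line[OF z(2)] in auto)
  then have 2: "has_bochner_integral lborel (\<lambda>t::real. indicator {..0} t *\<^sub>R exp (cnj z * of_real t)) (1 / cnj z)"
    by (rule has_bochner_integral_cong[THEN iffD1, rotated -1]) (auto simp: indicator_def)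
  have "has_bochner_integral lborel (\<lambda>t::real. exp (- \<bar>t\<bar> / T) *\<^sub>R cis (x * t)) (1 / z + 1 / cnj z)"
  proof (rule has_bochner_integralI_AE)
    show "has_bochner_integral lborel (\<lambda>t::real. indicator {0..} t *\<^sub>R exp (- z * of_real t) + indicator {..0} t *\<^sub>R exp (cnj z * of_real t)) (1 / z + 1 / cnj z)"
      by (rule has_bochner_integral_add[OF 1 2])
    show "AE t in lborel. indicator {0..} t *\<^sub>R exp (- z * of_real t) + indicator {..0} t *\<^sub>R exp (cnj z * of_real t)
        = exp (- \<bar>t\<bar> / T) *\<^sub>R cis (x * t)"
      by (rule eventually_mono[OF AE_lborel_singleton[of 0]])
         (auto simp: indicator_def z_def exp_eq_polar scaleR_conv_of_real algebra_simps)
  qed auto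
  moreover have "1 / z + 1 / cnj z = of_real (2 * T / (1 + T\<^sup>2 * x\<^sup>2))"
  proof -
    have "z \<noteq> 0" using z by auto
    then have "1 / z + 1 / cnj z = (z + cnj z) / (z * cnj z)" by (simp add: field_simps)
    also have "\<dots> = of_real (2 * Re z / (norm z)\<^sup>2)"
      by (simp only: complex_add_cnj complex_norm_square of_real_divide)
    also have "2 * Re z / (norm z)\<^sup>2 = 2 * T / (1 + T\<^sup>2 * x\<^sup>2)"
    proof -
      have "(norm z)\<^sup>2 = (1 + T\<^sup>2 * x\<^sup>2) / T\<^sup>2" "Re z = 1 / T"
        using T by (simp_all add: z_def cmod_power2 power_divide field_simps)
      then show ?thesis using T by (simp add: power2_eq_square)
    qed
    finally show ?thesis .
  qed
  ultimately show ?thesis by simp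
qed

text \<open>Expanding the square leaves the frequencies \<open>l n - l m\<close>, each integrated by
  the transform of the kernel. That transform is real and even, so only
  \<open>Re (\<alpha> m * cnj (\<alpha> n))\<close> survives and the sign of the difference does not
  matter.\<close>

lemma trig_sum_energy:
  fixes \<alpha> :: "nat \<Rightarrow> complex" and l :: "nat \<Rightarrow> real"
  assumes F: "finite F" and T: "T > 0"
  shows "has_bochner_integral lborel (\<lambda>t. exp (- \<bar>t\<bar> / T) * (norm (\<Sum>n\<in>F. \<alpha> n * cis (- l n * t)))\<^sup>2)
    (\<Sum>m\<in>F. \<Sum>n\<in>F. Re (\<alpha> m * cnj (\<alpha> n)) * (2 * T / (1 + T\<^sup>2 * (l m - l n)\<^sup>2)))"
proof -
  have "has_bochner_integral lborel
      (\<lambda>t. \<Sum>m\<in>F. \<Sum>n\<in>F. Re (\<alpha> m * cnj (\<alpha> n) * (exp (- \<bar>t\<bar> / T) *\<^sub>R cis ((l n - l m) * t))))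
      (\<Sum>m\<in>F. \<Sum>n\<in>F. Re (\<alpha> m * cnj (\<alpha> n) * of_real (2 * T / (1 + T\<^sup>2 * (l n - l m)\<^sup>2))))"
    by (intro has_bochner_integral_sum has_bochner_integral_bounded_linear[OF bounded_linear_Re]
        has_bochner_integral_mult_right exp_kernel_fourier T)
  moreover have "(\<Sum>m\<in>F. \<Sum>n\<in>F. Re (\<alpha> m * cnj (\<alpha> n) * (exp (- \<bar>t\<bar> / T) *\<^sub>R cis ((l n - l m) * t))))
     = exp (- \<bar>t\<bar> / T) * (norm (\<Sum>n\<in>F. \<alpha> n * cis (- l n * t)))\<^sup>2" for t
  proof -
    have "of_real ((norm (\<Sum>n\<in>F. \<alpha> n * cis (- l n * t)))\<^sup>2)
        = (\<Sum>n\<in>F. \<alpha> n * cis (- l n * t)) * cnj (\<Sum>n\<in>F. \<alpha> n * cis (- l n * t))"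
      by (rule complex_norm_square)
    also have "\<dots> = (\<Sum>m\<in>F. \<Sum>n\<in>F. \<alpha> m * cnj (\<alpha> n) * cis ((l n - l m) * t))"
      unfolding cnj_sum sum_product
      by (intro sum.cong refl) (simp add: cis_mult[symmetric] cis_cnj algebra_simps diff_conv_add_uminus del: add_uminus_conv_diff)
    finally have "(norm (\<Sum>n\<in>F. \<alpha> n * cis (- l n * t)))\<^sup>2
        = Re (\<Sum>m\<in>F. \<Sum>n\<in>F. \<alpha> m * cnj (\<alpha> n) * cis ((l n - l m) * t))"
      by (metis Re_complex_of_real)
    then show ?thesis
      by (simp add: Re_sum sum_distrib_left scaleR_conv_of_real algebra_simps)
  qed
  moreover have "Re (\<alpha> m * cnj (\<alpha> n) * of_real (2 * T / (1 + T\<^sup>2 * (l n - l m)\<^sup>2)))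
      = Re (\<alpha> m * cnj (\<alpha> n)) * (2 * T / (1 + T\<^sup>2 * (l m - l n)\<^sup>2))" for m n
  proof -
    have "Re (w * of_real r) = Re w * r" for w r by simp
    then show ?thesis by (metis power2_commute)
  qed
  ultimately show ?thesis by (simp only:)
qed

section \<open>Schur's test on block masses\<close>

lemma summable_inverse_one_plus_square: "summable (\<lambda>d::nat. 1 / (1 + (real d)\<^sup>2))"
proof (rule summable_comparison_test_ev)
  show "summable (\<lambda>d::nat. inverse ((real d)\<^sup>2))" by (rule inverse_power_summable) simp
  show "\<forall>\<^sub>F d in sequentially. norm (1 / (1 + (real d)\<^sup>2)) \<le> inverse ((real d)\<^sup>2)"
    using eventually_gt_at_top[of 0] by eventually_elim (simp add: field_simps add_pos_nonneg)
qed

definition schur_bound :: real where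
  "schur_bound = (\<Sum>d::nat. 1 / (1 + (real d)\<^sup>2))"

text \<open>On either side of the diagonal the distances to \<open>j\<close> are distinct, so each
  half of the row is part of the series defining \<open>schur_bound\<close>.\<close>

lemma schur_row_bound:
  assumes "finite I"
  shows "(\<Sum>k\<in>I. 1 / (1 + (real j - real k)\<^sup>2)) \<le> 2 * schur_bound"
proof -
  have part: "(\<Sum>k\<in>I'. 1 / (1 + (real j - real k)\<^sup>2)) \<le> schur_bound"
    if "I' \<subseteq> I" "inj_on h I'" "\<And>k. k \<in> I' \<Longrightarrow> (real (h k))\<^sup>2 = (real j - real k)\<^sup>2" for I' and h :: "nat \<Rightarrow> nat"
  proof -
    have fin: "finite I'" using that assms finite_subset by blast
    have "(\<Sum>k\<in>I'. 1 / (1 + (real j - real k)\<^sup>2)) = (\<Sum>d\<in>h ` I'. 1 / (1 + (real d)\<^sup>2))"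
      by (subst sum.reindex) (use that in auto)
    also have "\<dots> \<le> schur_bound" unfolding schur_bound_def
      by (rule sum_le_suminf) (use fin summable_inverse_one_plus_square in \<open>auto simp: add_nonneg_nonneg\<close>)
    finally show ?thesis .
  qed
  have "(\<Sum>k\<in>I. 1 / (1 + (real j - real k)\<^sup>2))
      = (\<Sum>k\<in>{k\<in>I. k \<le> j}. 1 / (1 + (real j - real k)\<^sup>2)) + (\<Sum>k\<in>{k\<in>I. \<not> k \<le> j}. 1 / (1 + (real j - real k)\<^sup>2))"
    by (subst sum.union_disjoint[symmetric]) (use assms in \<open>auto intro!: sum.cong\<close>)
  also have "\<dots> \<le> schur_bound + schur_bound"
    by (intro add_mono part[of _ "\<lambda>k. j - k"] part[of _ "\<lambda>k. k - j"])
       (auto simp: inj_on_def of_nat_diff power2_commute)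
  finally show ?thesis by simp
qed

lemma schur_bound_nonneg: "schur_bound \<ge> 0"
  unfolding schur_bound_def by (intro suminf_nonneg summable_inverse_one_plus_square) (simp add: add_nonneg_nonneg)

lemma sum_weighted_group:
  fixes x :: "nat \<Rightarrow> real" and w :: "nat \<Rightarrow> real"
  assumes "finite F"
  shows "(\<Sum>n\<in>F. x n * w (fl n)) = (\<Sum>k\<in>fl ` F. (\<Sum>n\<in>{n\<in>F. fl n = k}. x n) * w k)"
proof -
  have "(\<Sum>k\<in>fl ` F. \<Sum>n\<in>{n\<in>F. fl n = k}. x n * w (fl n)) = (\<Sum>n\<in>F. x n * w (fl n))"
    by (rule sum.group) (use assms in auto)
  then show ?thesis by (simp add: sum_distrib_right)
qed

text \<open>Grouping by the block index \<open>fl\<close> turns the double sum into a quadratic form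
  in the block sums. The arithmetic-geometric inequality and the symmetry of the matrix reduce it to
  row sums. Majorants \<open>b\<close> replace the block sums themselves so that one
  \<open>b\<close> can serve a whole sequence of finite sets.\<close>

lemma schur_test:
  fixes x b :: "nat \<Rightarrow> real"
  assumes F: "finite F" and x: "\<And>n. n \<in> F \<Longrightarrow> x n \<ge> 0"
    and b: "\<And>k. (\<Sum>n\<in>{n\<in>F. fl n = k}. x n) \<le> b k" and sb: "summable (\<lambda>k. (b k)\<^sup>2)"
  shows "(\<Sum>m\<in>F. \<Sum>n\<in>F. x m * x n * (1 / (1 + (real (fl m) - real (fl n))\<^sup>2))) \<le> 2 * schur_bound * (\<Sum>k. (b k)\<^sup>2)"
proof -
  define w where "w = (\<lambda>j k::nat. 1 / (1 + (real j - real k)\<^sup>2))"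
  define B where "B = (\<lambda>k. \<Sum>n\<in>{n\<in>F. fl n = k}. x n)"
  define J where "J = fl ` F"
  have finJ: "finite J" using F by (simp add: J_def)
  have w0: "w j k \<ge> 0" and wsym: "w j k = w k j" for j k by (auto simp: w_def add_nonneg_nonneg power2_commute)
  have B0: "B k \<ge> 0" for k using x by (auto simp: B_def intro: sum_nonneg)
  have Bb: "B k \<le> b k" for k using b by (simp add: B_def)
  have row: "(\<Sum>k\<in>J. w j k) \<le> 2 * schur_bound" for j
    unfolding w_def by (rule schur_row_bound[OF finJ])
  have "(\<Sum>m\<in>F. \<Sum>n\<in>F. x m * x n * (1 / (1 + (real (fl m) - real (fl n))\<^sup>2)))
      = (\<Sum>m\<in>F. x m * (\<Sum>n\<in>F. x n * w (fl m) (fl n)))"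
    by (simp add: sum_distrib_left w_def mult.assoc)
  also have "\<dots> = (\<Sum>m\<in>F. x m * (\<Sum>k\<in>J. B k * w (fl m) k))"
    using sum_weighted_group[OF F, of x "w (fl m)" fl for m] by (simp add: B_def J_def)
  also have "\<dots> = (\<Sum>j\<in>J. B j * (\<Sum>k\<in>J. B k * w j k))"
    unfolding B_def J_def by (rule sum_weighted_group[OF F])
  also have "\<dots> = (\<Sum>j\<in>J. \<Sum>k\<in>J. B j * B k * w j k)" by (simp add: sum_distrib_left mult.assoc)
  also have "\<dots> \<le> (\<Sum>j\<in>J. \<Sum>k\<in>J. ((b j)\<^sup>2 * w j k + (b k)\<^sup>2 * w k j) / 2)"
  proof (intro sum_mono)
    fix j k
    have "B j * B k \<le> b j * b k" using B0 Bb by (intro mult_mono) (auto intro: order_trans)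
    also have "\<dots> \<le> ((b j)\<^sup>2 + (b k)\<^sup>2) / 2"
      using sum_squares_bound[of "b j" "b k"] by simp
    finally have "B j * B k * w j k \<le> ((b j)\<^sup>2 + (b k)\<^sup>2) / 2 * w j k" using w0 by (rule mult_right_mono)
    then show "B j * B k * w j k \<le> ((b j)\<^sup>2 * w j k + (b k)\<^sup>2 * w k j) / 2"
      using wsym[of j k] by (simp add: algebra_simps)
  qed
  also have "\<dots> = (\<Sum>j\<in>J. \<Sum>k\<in>J. (b j)\<^sup>2 * w j k)"
    unfolding sum_divide_distrib[symmetric] sum.distrib using sum.swap[of "\<lambda>j k. (b k)\<^sup>2 * w k j" J J] by simp
  also have "\<dots> = (\<Sum>j\<in>J. (b j)\<^sup>2 * (\<Sum>k\<in>J. w j k))" by (simp add: sum_distrib_left)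
  also have "\<dots> \<le> (\<Sum>j\<in>J. (b j)\<^sup>2 * (2 * schur_bound))"
    by (intro sum_mono mult_left_mono row) auto
  also have "\<dots> = 2 * schur_bound * (\<Sum>j\<in>J. (b j)\<^sup>2)" by (simp add: sum_distrib_left mult_ac)
  also have "\<dots> \<le> 2 * schur_bound * (\<Sum>k. (b k)\<^sup>2)"
    using schur_bound_nonneg by (intro mult_left_mono sum_le_suminf sb finJ) auto
  finally show ?thesis .
qed

text \<open>Block indices at distance \<open>d\<close> give
  \<open>d - 1 <= \<bar>x - y\<bar> / L <= T * \<bar>x - y\<bar>\<close>, where
  \<open>T * L >= 1\<close> enters. The factor 4 absorbs the lost unit of distance.\<close>

lemma kernel_block_bound:
  fixes x y L T :: real
  assumes "x \<ge> 0" "y \<ge> 0" "L > 0" "T * L \<ge> 1" "T > 0"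
  shows "1 / (1 + T\<^sup>2 * (x - y)\<^sup>2) \<le> 4 * (1 / (1 + (real (nat \<lfloor>x / L\<rfloor>) - real (nat \<lfloor>y / L\<rfloor>))\<^sup>2))"
proof -
  define j k where "j = \<lfloor>x / L\<rfloor>" and "k = \<lfloor>y / L\<rfloor>"
  have jk: "real (nat \<lfloor>x / L\<rfloor>) = of_int j" "real (nat \<lfloor>y / L\<rfloor>) = of_int k"
    using assms by (auto simp: j_def k_def)
  define d where "d = \<bar>j - k\<bar>"
  have "of_int d - 1 \<le> \<bar>x / L - y / L\<bar>" unfolding d_def j_def k_def by linarith
  also have "\<dots> = \<bar>x - y\<bar> / L" using assms by (simp add: diff_divide_distrib[symmetric])
  also have "\<dots> \<le> T * \<bar>x - y\<bar>"
    using mult_right_mono[OF assms(4), of "\<bar>x - y\<bar>"] assms(3) by (simp add: divide_simps mult_ac)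
  finally have 1: "of_int d - 1 \<le> T * \<bar>x - y\<bar>" .
  have "1 + (of_int d)\<^sup>2 \<le> 4 * (1 + T\<^sup>2 * (x - y)\<^sup>2)"
  proof (cases "d \<ge> 1")
    case True
    then have "(of_int d - 1)\<^sup>2 \<le> (T * \<bar>x - y\<bar>)\<^sup>2" using 1 by (intro power_mono) auto
    then have "(of_int d - 1)\<^sup>2 \<le> T\<^sup>2 * (x - y)\<^sup>2" by (simp add: power_mult_distrib)
    moreover have "1 + (of_int d)\<^sup>2 \<le> 4 * (1 + (of_int d - 1)\<^sup>2 :: real)"
    proof -
      \<comment> \<open>The expression is three times the right side minus the left side of the
        claim.\<close>
      have "0 \<le> (3 * of_int d - 4)\<^sup>2 + (5::real)" by simp
      then show ?thesis by (simp add: power2_eq_square algebra_simps)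
    qed
    moreover have "4 * (1 + (of_int d - 1)\<^sup>2) \<le> 4 * (1 + T\<^sup>2 * (x - y)\<^sup>2)"
      using calculation(1) by (intro mult_left_mono add_left_mono) auto
    ultimately show ?thesis by (blast intro: order_trans)
  next
    case False
    then have "d = 0" by (simp add: d_def)
    then show ?thesis by simp
  qed
  moreover have "(of_int d)\<^sup>2 = (of_int j - of_int k :: real)\<^sup>2"
    by (simp add: d_def)
  ultimately show ?thesis unfolding jk
    by (simp add: divide_simps add_pos_nonneg) (simp add: algebra_simps add_pos_nonneg)?
qed

text \<open>\<open>16 = 2 * 4 * 2\<close>: the kernel transform, \<open>kernel_block_bound\<close>
  and \<open>schur_test\<close>.\<close>

definition energy_const :: real where
  "energy_const = 16 * schur_bound"

text \<open>Moving the centre of the kernel to \<open>c\<close> multiplies the coefficients by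
  unimodular numbers, and the bound depends only on their moduli; it is therefore uniform in
  \<open>c\<close>.\<close>

lemma trig_sum_energy_le:
  fixes \<alpha> :: "nat \<Rightarrow> complex" and l b :: "nat \<Rightarrow> real"
  assumes F: "finite F" and T: "T > 0" and L: "L > 0" "T * L \<ge> 1" and l: "\<And>n. n \<in> F \<Longrightarrow> l n \<ge> 0"
    and b: "\<And>k. (\<Sum>n\<in>{n\<in>F. nat \<lfloor>l n / L\<rfloor> = k}. norm (\<alpha> n)) \<le> b k" and sb: "summable (\<lambda>k. (b k)\<^sup>2)"
  shows "(\<integral>\<^sup>+t. ennreal (exp (- \<bar>t - c\<bar> / T) * (norm (\<Sum>n\<in>F. \<alpha> n * cis (- l n * t)))\<^sup>2) \<partial>lborel)
    \<le> ennreal (energy_const * T * (\<Sum>k. (b k)\<^sup>2))"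
proof -
  define \<beta> where "\<beta> = (\<lambda>n. \<alpha> n * cis (- l n * c))"
  have nb: "norm (\<beta> n) = norm (\<alpha> n)" for n by (simp add: \<beta>_def norm_mult)
  have "(\<integral>\<^sup>+t. ennreal (exp (- \<bar>t - c\<bar> / T) * (norm (\<Sum>n\<in>F. \<alpha> n * cis (- l n * t)))\<^sup>2) \<partial>lborel)
     = (\<integral>\<^sup>+t. ennreal (exp (- \<bar>t\<bar> / T) * (norm (\<Sum>n\<in>F. \<beta> n * cis (- l n * t)))\<^sup>2) \<partial>lborel)"
    by (subst nn_integral_real_affine[where c = 1 and t = c])
       (auto simp: \<beta>_def mult.assoc cis_mult algebra_simps intro!: nn_integral_cong)
  also have "\<dots> = ennreal (\<Sum>m\<in>F. \<Sum>n\<in>F. Re (\<beta> m * cnj (\<beta> n)) * (2 * T / (1 + T\<^sup>2 * (l m - l n)\<^sup>2)))"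
    using trig_sum_energy[OF F T, of \<beta> l] by (subst nn_integral_eq_integral) (auto simp: has_bochner_integral_iff)
  also have "\<dots> \<le> ennreal (\<Sum>m\<in>F. \<Sum>n\<in>F. norm (\<alpha> m) * norm (\<alpha> n) *
      (8 * T * (1 / (1 + (real (nat \<lfloor>l m / L\<rfloor>) - real (nat \<lfloor>l n / L\<rfloor>))\<^sup>2))))"
  proof (intro ennreal_leI sum_mono mult_mono)
    fix m n assume mn: "m \<in> F" "n \<in> F"
    show "Re (\<beta> m * cnj (\<beta> n)) \<le> norm (\<alpha> m) * norm (\<alpha> n)"
      using complex_Re_le_cmod[of "\<beta> m * cnj (\<beta> n)"] by (simp add: norm_mult nb)
    have "2 * T * (1 / (1 + T\<^sup>2 * (l m - l n)\<^sup>2)) \<le> 2 * T * (4 * (1 / (1 + (real (nat \<lfloor>l m / L\<rfloor>) - real (nat \<lfloor>l n / L\<rfloor>))\<^sup>2)))"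
      using T by (intro mult_left_mono kernel_block_bound L l mn) auto
    then show "2 * T / (1 + T\<^sup>2 * (l m - l n)\<^sup>2) \<le> 8 * T * (1 / (1 + (real (nat \<lfloor>l m / L\<rfloor>) - real (nat \<lfloor>l n / L\<rfloor>))\<^sup>2))"
      by simp
  qed (use T in \<open>auto intro!: divide_nonneg_pos add_pos_nonneg\<close>)
  also have "\<dots> = ennreal (8 * T * (\<Sum>m\<in>F. \<Sum>n\<in>F. norm (\<alpha> m) * norm (\<alpha> n) *
      (1 / (1 + (real (nat \<lfloor>l m / L\<rfloor>) - real (nat \<lfloor>l n / L\<rfloor>))\<^sup>2))))"
    by (simp add: sum_distrib_left mult_ac)
  also have "\<dots> \<le> ennreal (8 * T * (2 * schur_bound * (\<Sum>k. (b k)\<^sup>2)))"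
    using T by (intro ennreal_leI mult_left_mono schur_test[where x="\<lambda>n. norm (\<alpha> n)"] F b sb) auto
  finally show ?thesis by (simp add: energy_const_def mult_ac)
qed

text \<open>One majorant \<open>b\<close> for all \<open>F j\<close> lets Fatou's lemma carry the
  finite bound to an almost everywhere limit. The upper square-integral estimates below for infinite
  series are instances.\<close>

lemma trig_limit_energy_le:
  fixes \<alpha> :: "nat \<Rightarrow> nat \<Rightarrow> complex" and l b :: "nat \<Rightarrow> real" and h :: "real \<Rightarrow> complex"
  assumes F: "\<And>j. finite (F j)" and T: "T > 0" and L: "L > 0" "T * L \<ge> 1" and l: "\<And>n. l n \<ge> 0"
    and b: "\<And>j k. (\<Sum>n\<in>{n\<in>F j. nat \<lfloor>l n / L\<rfloor> = k}. norm (\<alpha> j n)) \<le> b k" and sb: "summable (\<lambda>k. (b k)\<^sup>2)"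
    and lim: "AE t in lborel. (\<lambda>j. \<Sum>n\<in>F j. \<alpha> j n * cis (- l n * t)) \<longlonglongrightarrow> h t"
  shows "(\<integral>\<^sup>+t. ennreal (exp (- \<bar>t - c\<bar> / T) * (norm (h t))\<^sup>2) \<partial>lborel)
    \<le> ennreal (energy_const * T * (\<Sum>k. (b k)\<^sup>2))"
proof -
  define H where "H = (\<lambda>j t. ennreal (exp (- \<bar>t - c\<bar> / T) * (norm (\<Sum>n\<in>F j. \<alpha> j n * cis (- l n * t)))\<^sup>2))"
  have "(\<integral>\<^sup>+t. ennreal (exp (- \<bar>t - c\<bar> / T) * (norm (h t))\<^sup>2) \<partial>lborel) = (\<integral>\<^sup>+t. liminf (\<lambda>j. H j t) \<partial>lborel)"
  proof (rule nn_integral_cong_AE, use lim in eventually_elim)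
    case (elim t)
    then have "(\<lambda>j. H j t) \<longlonglongrightarrow> ennreal (exp (- \<bar>t - c\<bar> / T) * (norm (h t))\<^sup>2)"
      unfolding H_def by (intro tendsto_intros)
    then show ?case by (simp add: lim_imp_Liminf)
  qed
  also have "\<dots> \<le> liminf (\<lambda>j. \<integral>\<^sup>+t. H j t \<partial>lborel)"
    by (rule nn_integral_liminf) (simp add: H_def)
  also have "\<dots> \<le> ennreal (energy_const * T * (\<Sum>k. (b k)\<^sup>2))"
  proof (rule order_trans[OF Liminf_mono Liminf_const[THEN eq_refl]])
    show "\<forall>\<^sub>F j in sequentially. (\<integral>\<^sup>+t. H j t \<partial>lborel) \<le> ennreal (energy_const * T * (\<Sum>k. (b k)\<^sup>2))"
      unfolding H_def by (intro always_eventually allI trig_sum_energy_le[where L = L] F T L l b sb)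
  qed auto
  finally show ?thesis .
qed

text \<open>Completing the square in the constant \<open>c\<close> leaves the coefficients \<open>K (x - y) - K x * K y / K 0\<close>, all of
  them nonnegative.\<close>

lemma trig_sum_energy_ge:
  fixes \<alpha> l :: "nat \<Rightarrow> real" and c :: complex
  assumes F: "finite F" and T: "T > 0" and l: "\<And>n. n \<in> F \<Longrightarrow> l n > 0" and \<alpha>: "\<And>n. n \<in> F \<Longrightarrow> \<alpha> n \<ge> 0"
  shows "(\<Sum>k\<in>(\<lambda>n. nat \<lfloor>l n * T\<rfloor>) ` F - {0}. (\<Sum>n\<in>{n\<in>F. nat \<lfloor>l n * T\<rfloor> = k}. \<alpha> n)\<^sup>2)
    \<le> 2 / T * (LINT t|lborel. exp (- \<bar>t\<bar> / T) * (norm (c + (\<Sum>n\<in>F. \<alpha> n * cis (- l n * t))))\<^sup>2)"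
proof -
  define K where "K = (\<lambda>x. 2 * T / (1 + T\<^sup>2 * x\<^sup>2))"
  define fl where "fl = (\<lambda>n. nat \<lfloor>l n * T\<rfloor>)"
  \<comment> \<open>The constant \<open>c\<close> becomes the coefficient of index 0 at frequency 0;
    the given terms move to successor indices.\<close>
  define F' where "F' = insert 0 (Suc ` F)"
  define \<beta> where "\<beta> = case_nat c (\<lambda>n. of_real (\<alpha> n))"
  define l' where "l' = case_nat 0 l"
  have K0: "K x > 0" for x using T by (auto simp: K_def intro!: divide_pos_pos add_pos_nonneg)
  have K00: "K 0 = 2 * T" and Keven: "K (- x) = K x" for x by (simp_all add: K_def)
  have sumF': "(\<Sum>n\<in>F'. g n) = g 0 + (\<Sum>n\<in>F. g (Suc n))" for g :: "nat \<Rightarrow> 'b::comm_monoid_add"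
    unfolding F'_def using F by (subst sum.insert) (auto simp: sum.reindex)
  define A where "A = (\<Sum>n\<in>F. \<alpha> n * K (l n))"
  define E where "E = (\<Sum>m\<in>F. \<Sum>n\<in>F. \<alpha> m * \<alpha> n * K (l m - l n))"
  have "(LINT t|lborel. exp (- \<bar>t\<bar> / T) * (norm (\<Sum>n\<in>F'. \<beta> n * cis (- l' n * t)))\<^sup>2)
      = (\<Sum>m\<in>F'. \<Sum>n\<in>F'. Re (\<beta> m * cnj (\<beta> n)) * K (l' m - l' n))"
    unfolding K_def by (rule has_bochner_integral_integral_eq[OF trig_sum_energy]) (use F T in \<open>auto simp: F'_def\<close>)
  also have "(\<lambda>t. \<Sum>n\<in>F'. \<beta> n * cis (- l' n * t)) = (\<lambda>t. c + (\<Sum>n\<in>F. \<alpha> n * cis (- l n * t)))"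
    by (simp add: sumF' \<beta>_def l'_def)
  also have "(\<Sum>m\<in>F'. \<Sum>n\<in>F'. Re (\<beta> m * cnj (\<beta> n)) * K (l' m - l' n))
     = (norm c)\<^sup>2 * (2 * T) + 2 * Re c * A + E"
    unfolding sumF' sum.distrib
    by (simp add: \<beta>_def l'_def A_def E_def sum_distrib_left cmod_power2 mult_ac Keven K00)
       (simp add: power2_eq_square algebra_simps)
  finally have eq: "(LINT t|lborel. exp (- \<bar>t\<bar> / T) * (norm (c + (\<Sum>n\<in>F. \<alpha> n * cis (- l n * t))))\<^sup>2)
     = (norm c)\<^sup>2 * (2 * T) + 2 * Re c * A + E" .
  \<comment> \<open>The imaginary part of \<open>c\<close> only adds energy; minimising over
    \<open>Re c\<close> leaves \<open>E - A\<^sup>2 / (2 * T)\<close>.\<close>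
  have "(Re c)\<^sup>2 \<le> (norm c)\<^sup>2" by (simp add: cmod_power2)
  then have "(Re c)\<^sup>2 * (2 * T) \<le> (norm c)\<^sup>2 * (2 * T)" using T by (intro mult_right_mono) auto
  moreover have "0 \<le> (Re c * (2 * T) + A)\<^sup>2 / (2 * T)" using T by simp
  then have "0 \<le> (Re c)\<^sup>2 * (2 * T) + 2 * Re c * A + A\<^sup>2 / (2 * T)"
    using T by (simp add: power2_eq_square field_simps)
  ultimately have "E - A\<^sup>2 / (2 * T) \<le> (LINT t|lborel. exp (- \<bar>t\<bar> / T) * (norm (c + (\<Sum>n\<in>F. \<alpha> n * cis (- l n * t))))\<^sup>2)"
    unfolding eq by linarith
  moreover have "E - A\<^sup>2 / (2 * T) = (\<Sum>m\<in>F. \<Sum>n\<in>F. \<alpha> m * \<alpha> n * (K (l m - l n) - K (l m) * K (l n) / (2 * T)))"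
    unfolding E_def A_def power2_eq_square sum_product sum_divide_distrib sum_subtractf[symmetric]
    by (intro sum.cong refl) (simp add: algebra_simps)
  moreover have "(\<Sum>m\<in>F. \<Sum>n\<in>F. \<alpha> m * \<alpha> n * (T / 2 * of_bool (fl m \<noteq> 0 \<and> fl m = fl n)))
     \<le> (\<Sum>m\<in>F. \<Sum>n\<in>F. \<alpha> m * \<alpha> n * (K (l m - l n) - K (l m) * K (l n) / (2 * T)))"
  proof (intro sum_mono mult_left_mono)
    fix m n assume mn: "m \<in> F" "n \<in> F"
    define X Y where "X = T * l m" and "Y = T * l n"
    have XY: "X > 0" "Y > 0" using l mn T by (auto simp: X_def Y_def)
    have D: "K (l m - l n) - K (l m) * K (l n) / (2 * T) = 2 * T * (1 / (1 + (X - Y)\<^sup>2) - 1 / ((1 + X\<^sup>2) * (1 + Y\<^sup>2)))"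
    proof -
      have "K (l m) = 2 * T / (1 + X\<^sup>2)" "K (l n) = 2 * T / (1 + Y\<^sup>2)" "K (l m - l n) = 2 * T / (1 + (X - Y)\<^sup>2)"
        by (simp_all add: K_def X_def Y_def power_mult_distrib right_diff_distrib[symmetric])
      moreover have "2 * T / r - 2 * T / p * (2 * T / q) / (2 * T) = 2 * T * (1 / r - 1 / (p * q))" for p q r
        using T by (simp add: algebra_simps)
      ultimately show ?thesis by (simp only:)
    qed
    \<comment> \<open>In a common block of index at least 1, \<open>X\<close> and \<open>Y\<close>
      are at least 1 and at distance at most 1, so the difference of the fractions is at least
      \<open>1 / 2 - 1 / 4\<close>. In block 0 both could be small and the fractions would nearly
      cancel: low frequencies resemble the constant \<open>c\<close>.\<close>
    show "T / 2 * of_bool (fl m \<noteq> 0 \<and> fl m = fl n) \<le> K (l m - l n) - K (l m) * K (l n) / (2 * T)"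
    proof (cases "fl m \<noteq> 0 \<and> fl m = fl n")
      case True
      then have "nat \<lfloor>X\<rfloor> \<noteq> 0" "nat \<lfloor>X\<rfloor> = nat \<lfloor>Y\<rfloor>" by (auto simp: fl_def X_def Y_def mult.commute)
      moreover have "\<lfloor>X\<rfloor> \<ge> 0" "\<lfloor>Y\<rfloor> \<ge> 0" using XY by auto
      ultimately have "\<lfloor>X\<rfloor> \<ge> 1" "\<lfloor>X\<rfloor> = \<lfloor>Y\<rfloor>" by linarith+
      then have ge: "X \<ge> 1" "Y \<ge> 1" "\<bar>X - Y\<bar> \<le> 1" by linarith+
      have "(X - Y)\<^sup>2 \<le> 1" using ge(3) by (simp add: abs_square_le_1)
      then have "1 / (1 + (X - Y)\<^sup>2) \<ge> 1 / 2" by (intro divide_left_mono) (auto intro: add_pos_nonneg)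
      moreover have "2 \<le> 1 + X\<^sup>2" "2 \<le> 1 + Y\<^sup>2" using ge by (auto simp: one_le_power)
      then have "2 * 2 \<le> (1 + X\<^sup>2) * (1 + Y\<^sup>2)" by (intro mult_mono) auto
      then have "1 / ((1 + X\<^sup>2) * (1 + Y\<^sup>2)) \<le> 1 / 4" by (intro divide_left_mono) auto
      ultimately have "2 * T * (1 / 4) \<le> 2 * T * (1 / (1 + (X - Y)\<^sup>2) - 1 / ((1 + X\<^sup>2) * (1 + Y\<^sup>2)))"
        using T by (intro mult_left_mono) auto
      then show ?thesis unfolding D using True by simp
    next
      case False
      have "(X - Y)\<^sup>2 \<le> X\<^sup>2 + Y\<^sup>2" using XY by (simp add: power2_diff)
      also have "\<dots> \<le> X\<^sup>2 + Y\<^sup>2 + X\<^sup>2 * Y\<^sup>2" by simp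
      finally have "1 + (X - Y)\<^sup>2 \<le> (1 + X\<^sup>2) * (1 + Y\<^sup>2)" by (simp add: algebra_simps)
      then have "1 / ((1 + X\<^sup>2) * (1 + Y\<^sup>2)) \<le> 1 / (1 + (X - Y)\<^sup>2)"
        by (intro divide_left_mono) (auto intro!: add_pos_nonneg mult_pos_pos)
      then have "0 \<le> 2 * T * (1 / (1 + (X - Y)\<^sup>2) - 1 / ((1 + X\<^sup>2) * (1 + Y\<^sup>2)))"
        using T by (intro mult_nonneg_nonneg) auto
      moreover have "of_bool (fl m \<noteq> 0 \<and> fl m = fl n) = (0::real)" using False by (simp only: of_bool_eq)
      ultimately show ?thesis unfolding D by (simp only: mult_zero_right)
    qed
  qed (use \<alpha> in auto)
  moreover have "(\<Sum>m\<in>F. \<Sum>n\<in>F. \<alpha> m * \<alpha> n * (T / 2 * of_bool (fl m \<noteq> 0 \<and> fl m = fl n)))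
     = T / 2 * (\<Sum>k\<in>fl ` F - {0}. (\<Sum>n\<in>{n\<in>F. fl n = k}. \<alpha> n)\<^sup>2)"
  proof -
    define B where "B = (\<lambda>k. \<Sum>n\<in>{n\<in>F. fl n = k}. \<alpha> n)"
    have "(\<Sum>m\<in>F. \<Sum>n\<in>F. \<alpha> m * \<alpha> n * (T / 2 * of_bool (fl m \<noteq> 0 \<and> fl m = fl n)))
      = (\<Sum>m\<in>F. \<alpha> m * (T / 2 * of_bool (fl m \<noteq> 0) * B (fl m)))"
    proof (intro sum.cong refl)
      fix m assume "m \<in> F"
      have B: "(\<Sum>n\<in>F. \<alpha> n * of_bool (fl m = fl n)) = B (fl m)"
        unfolding B_def sum.inter_filter[OF F] by (intro sum.cong) auto
      show "(\<Sum>n\<in>F. \<alpha> m * \<alpha> n * (T / 2 * of_bool (fl m \<noteq> 0 \<and> fl m = fl n)))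
          = \<alpha> m * (T / 2 * of_bool (fl m \<noteq> 0) * B (fl m))"
        unfolding of_bool_conj sum_distrib_left by (simp add: sum_distrib_left flip: B)
          (intro impI disjI2 sum.cong, auto)
    qed
    also have "\<dots> = (\<Sum>k\<in>fl ` F. B k * (T / 2 * of_bool (k \<noteq> 0) * B k))"
      unfolding B_def by (rule sum_weighted_group[OF F])
    also have "\<dots> = (\<Sum>k\<in>fl ` F - {0}. B k * (T / 2 * of_bool (k \<noteq> 0) * B k))"
      by (rule sum.mono_neutral_right) (use F in auto)
    also have "\<dots> = (\<Sum>k\<in>fl ` F - {0}. T / 2 * (B k)\<^sup>2)"
      by (intro sum.cong) (auto simp: power2_eq_square)
    finally show ?thesis by (simp add: sum_distrib_left B_def)
  qed
  ultimately have "T / 2 * (\<Sum>k\<in>fl ` F - {0}. (\<Sum>n\<in>{n\<in>F. fl n = k}. \<alpha> n)\<^sup>2)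
    \<le> (LINT t|lborel. exp (- \<bar>t\<bar> / T) * (norm (c + (\<Sum>n\<in>F. \<alpha> n * cis (- l n * t))))\<^sup>2)" by linarith
  then show ?thesis using T by (simp add: fl_def field_simps)
qed

section \<open>Partial sums along a lacunary sequence\<close>

text \<open>Coefficient sequences are indexed from 0: the index \<open>n\<close> belongs to \<open>(n + 1)\<^bsup>-s\<^esup>\<close>.\<close>

definition freq :: "nat \<Rightarrow> real" where
  "freq n = ln (real (Suc n))"

lemma freq_nonneg [simp]: "freq n \<ge> 0"
  by (simp add: freq_def)

lemma freq_0 [simp]: "freq 0 = 0"
  by (simp add: freq_def)

lemma freq_pos: "n \<noteq> 0 \<Longrightarrow> freq n > 0"
  by (simp add: freq_def)

lemma finite_freq_less [simp]: "finite {n. freq n < x}"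
proof (rule finite_subset)
  show "{n. freq n < x} \<subseteq> {..<nat \<lceil>exp x\<rceil>}"
  proof
    fix n assume "n \<in> {n. freq n < x}"
    then have "exp (freq n) < exp x" by simp
    then have "real (Suc n) < exp x" by (simp add: freq_def)
    then show "n \<in> {..<nat \<lceil>exp x\<rceil>}" by (auto simp: zless_nat_eq_int_zless) linarith
  qed
qed simp

lemma finite_freq_block [simp]: "L > 0 \<Longrightarrow> finite {n. nat \<lfloor>freq n / L\<rfloor> = k}"
proof (rule finite_subset)
  assume "L > 0"
  show "{n. nat \<lfloor>freq n / L\<rfloor> = k} \<subseteq> {n. freq n < L * (real k + 1)}"
  proof
    fix n assume "n \<in> {n. nat \<lfloor>freq n / L\<rfloor> = k}"
    then have "freq n / L < real k + 1" by (auto simp: of_nat_nat \<open>L > 0\<close> less_imp_le)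
    then show "n \<in> {n. freq n < L * (real k + 1)}" using \<open>L > 0\<close> by (simp add: field_simps)
  qed
qed simp

text \<open>With \<open>x = exp L\<close> this is the inner sum of the theorem over
  \<open>x^k <= n + 1 < x^(k+1)\<close>, taken with moduli and with \<open>k = 0\<close> included;
  \<open>L >= 1\<close> corresponds to \<open>x >= e\<close>.\<close>

definition block_mass :: "(nat \<Rightarrow> complex) \<Rightarrow> real \<Rightarrow> nat \<Rightarrow> real" where
  "block_mass c L k = (\<Sum>n | nat \<lfloor>freq n / L\<rfloor> = k. norm (c n))"

lemma block_mass_nonneg [simp]: "block_mass c L k \<ge> 0"
  by (simp add: block_mass_def sum_nonneg)

text \<open>The block condition at the single scale \<open>x = e\<close>. It suffices for
  convergence and boundary values; the norm estimate needs all scales, see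
  \<open>block_bound\<close>.\<close>

abbreviation square_summable :: "(nat \<Rightarrow> complex) \<Rightarrow> bool" where
  "square_summable c \<equiv> summable (\<lambda>k. (block_mass c 1 k)\<^sup>2)"

text \<open>Cutting at integer frequencies removes whole blocks of length 1, so differences of
  partial sums are controlled by the block masses beyond the cut.\<close>

definition partial_sum :: "(nat \<Rightarrow> complex) \<Rightarrow> nat \<Rightarrow> real \<Rightarrow> complex" where
  "partial_sum c N t = (\<Sum>n | freq n < real N. c n * cis (- freq n * t))"

lemma partial_sum_measurable [measurable]: "partial_sum c N \<in> borel_measurable borel"
  unfolding partial_sum_def[abs_def] by measurable

lemma norm_partial_sum_le: "norm (partial_sum c N t) \<le> (\<Sum>n | freq n < real N. norm (c n))"
  unfolding partial_sum_def by (rule order_trans[OF norm_sum]) (simp add: norm_mult)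

lemma partial_sum_diff:
  assumes "N \<le> M"
  shows "partial_sum c M t - partial_sum c N t = (\<Sum>n | freq n < real M \<and> \<not> freq n < real N. c n * cis (- freq n * t))"
proof -
  have "{n. freq n < real M \<and> \<not> freq n < real N} = {n. freq n < real M} - {n. freq n < real N}" by auto
  moreover have "{n. freq n < real N} \<subseteq> {n. freq n < real M}" using assms by (auto intro: less_le_trans)
  ultimately show ?thesis unfolding partial_sum_def by (simp add: sum_diff)
qed

lemma sum_block_subset_le:
  assumes "L > 0" "\<And>n. n \<in> F \<Longrightarrow> norm (\<alpha> n) \<le> norm (c n)"
  shows "(\<Sum>n\<in>{n\<in>F. nat \<lfloor>freq n / L\<rfloor> = k}. norm (\<alpha> n)) \<le> block_mass c L k"
proof -
  have "(\<Sum>n\<in>{n\<in>F. nat \<lfloor>freq n / L\<rfloor> = k}. norm (\<alpha> n)) \<le> (\<Sum>n\<in>{n\<in>F. nat \<lfloor>freq n / L\<rfloor> = k}. norm (c n))"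
    using assms by (intro sum_mono) auto
  also have "\<dots> \<le> block_mass c L k" unfolding block_mass_def
    by (rule sum_mono2) (use assms in auto)
  finally show ?thesis .
qed

lemma sum_high_block_le:
  "(\<Sum>n\<in>{n\<in>{n. freq n < real M \<and> \<not> freq n < real N}. nat \<lfloor>freq n / 1\<rfloor> = k}. norm (c n))
    \<le> (if k < N then 0 else block_mass c 1 k)"
proof (cases "k < N")
  case True
  have "{n\<in>{n. freq n < real M \<and> \<not> freq n < real N}. nat \<lfloor>freq n / 1\<rfloor> = k} = {}"
  proof -
    have False if "\<not> freq n < real N" "nat \<lfloor>freq n\<rfloor> = k" for n
      using that True by (auto simp: not_less nat_less_iff) linarith
    then show ?thesis by auto
  qed
  then show ?thesis using True by (simp only: sum.empty if_True order_refl)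
next
  case False
  then show ?thesis using sum_block_subset_le[of 1 _ c c k] by (simp only: if_False zero_less_one order_refl)
qed

section \<open>Exponentially dominated weights and lacunary limits\<close>

lemma integrable_exp_kernel:
  "T > 0 \<Longrightarrow> has_bochner_integral lborel (\<lambda>t::real. exp (- \<bar>t - x\<bar> / T)) (2 * T)"
proof -
  assume T: "T > 0"
  have "has_bochner_integral lborel (\<lambda>t::real. Re (exp (- \<bar>t\<bar> / T) *\<^sub>R cis (0 * t))) (Re (of_real (2 * T / (1 + T\<^sup>2 * 0\<^sup>2))))"
    by (intro has_bochner_integral_bounded_linear[OF bounded_linear_Re] exp_kernel_fourier T)
  then have "has_bochner_integral lborel (\<lambda>t::real. exp (- \<bar>t\<bar> / T)) (2 * T)" by simp
  then have "has_bochner_integral lborel (\<lambda>t::real. exp (- \<bar>- x + 1 * t\<bar> / T)) (2 * T /\<^sub>R \<bar>1\<bar>)"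
    by (subst (asm) lborel_has_bochner_integral_real_affine_iff[of 1 _ _ "- x"]) auto
  then show ?thesis by simp
qed

text \<open>The class contains the indicators of bounded intervals and the normalised kernels of
  width \<open>r <= 1\<close>, the weights used for averages and for convolutions.\<close>

definition exp_dominated :: "(real \<Rightarrow> real) \<Rightarrow> real \<Rightarrow> real \<Rightarrow> bool" where
  "exp_dominated w D x \<longleftrightarrow> w \<in> borel_measurable borel \<and> (\<forall>t. 0 \<le> w t \<and> w t \<le> D * exp (- \<bar>t - x\<bar>))"

lemma exp_dominatedD:
  assumes "exp_dominated w D x"
  shows "w \<in> borel_measurable borel" "0 \<le> w t" "w t \<le> D * exp (- \<bar>t - x\<bar>)" "0 \<le> D"
proof -
  show w: "w \<in> borel_measurable borel" "0 \<le> w t" "w t \<le> D * exp (- \<bar>t - x\<bar>)" for t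
    using assms by (auto simp: exp_dominated_def)
  show "0 \<le> D" using order_trans[OF w(2,3)[of x]] by simp
qed

text \<open>Two modes of convergence are combined: almost everywhere, for Fatou's lemma, and against
  weights, for interval averages and convolutions. Neither yields the other by itself.\<close>

definition lacunary_limit :: "(nat \<Rightarrow> complex) \<Rightarrow> (nat \<Rightarrow> nat) \<Rightarrow> (real \<Rightarrow> complex) \<Rightarrow> bool" where
  "lacunary_limit c N g \<longleftrightarrow> strict_mono N \<and> g \<in> borel_measurable borel \<and>
    (AE t in lborel. (\<lambda>j. partial_sum c (N j) t) \<longlonglongrightarrow> g t) \<and>
    (\<forall>w D x. exp_dominated w D x \<longrightarrow> integrable lborel (\<lambda>t. w t *\<^sub>R g t) \<and>
      (\<lambda>j. LINT t|lborel. w t *\<^sub>R partial_sum c (N j) t) \<longlonglongrightarrow> (LINT t|lborel. w t *\<^sub>R g t))"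

lemma lacunary_limitD:
  assumes "lacunary_limit c N g"
  shows "strict_mono N" "g \<in> borel_measurable borel" "AE t in lborel. (\<lambda>j. partial_sum c (N j) t) \<longlonglongrightarrow> g t"
    "exp_dominated w D x \<Longrightarrow> integrable lborel (\<lambda>t. w t *\<^sub>R g t)"
    "exp_dominated w D x \<Longrightarrow> (\<lambda>j. LINT t|lborel. w t *\<^sub>R partial_sum c (N j) t) \<longlonglongrightarrow> (LINT t|lborel. w t *\<^sub>R g t)"
  using assms by (auto simp: lacunary_limit_def)

lemma integrable_weighted_bounded:
  fixes h :: "real \<Rightarrow> complex"
  assumes w: "exp_dominated w D x" and [measurable]: "h \<in> borel_measurable borel" and h: "\<And>t. norm (h t) \<le> B"
  shows "integrable lborel (\<lambda>t. w t *\<^sub>R h t)"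
proof (rule Bochner_Integration.integrable_bound)
  note [measurable] = exp_dominatedD(1)[OF w]
  show "integrable lborel (\<lambda>t. D * B * exp (- \<bar>t - x\<bar> / 1))"
    using integrable_exp_kernel[of 1 x] by (auto simp: has_bochner_integral_iff)
  have "\<bar>w t\<bar> * norm (h t) \<le> (D * exp (- \<bar>t - x\<bar>)) * B" for t
    using exp_dominatedD(2-4)[OF w] h by (intro mult_mono) auto
  then show "AE t in lborel. norm (w t *\<^sub>R h t) \<le> norm (D * B * exp (- \<bar>t - x\<bar> / 1))"
    by (auto intro!: AE_I2 order_trans[OF _ abs_ge_self] simp: mult_ac)
  show "(\<lambda>t. w t *\<^sub>R h t) \<in> borel_measurable lborel" by measurable
qed

text \<open>The elementary \<open>norm h <= \<delta> + (norm h)\<^sup>2 / \<delta>\<close> stands in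
  for the Cauchy-Schwarz inequality. The choice of \<open>\<delta>\<close> is left open:
  \<open>(1 / 4) ^ j\<close> for tails of the series, the block bound \<open>M\<close> for
  oscillations.\<close>

lemma weighted_L1_le_L2:
  fixes w :: "real \<Rightarrow> real" and h :: "real \<Rightarrow> complex"
  assumes [measurable]: "w \<in> borel_measurable borel" "h \<in> borel_measurable borel"
    and w: "\<And>t. 0 \<le> w t" "\<And>t. w t \<le> D * exp (- \<bar>t - x\<bar> / T)" and T: "T > 0"
    and h: "(\<integral>\<^sup>+t. ennreal (exp (- \<bar>t - x\<bar> / T) * (norm (h t))\<^sup>2) \<partial>lborel) \<le> ennreal E" and E: "E \<ge> 0" and \<delta>: "\<delta> > 0"
  shows "(\<integral>\<^sup>+t. ennreal (w t * norm (h t)) \<partial>lborel) \<le> ennreal (D * (\<delta> * (2 * T) + E / \<delta>))"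
proof -
  have D: "D \<ge> 0" using order_trans[OF w(1) w(2)[of x]] by simp
  have "(\<integral>\<^sup>+t. ennreal (w t * norm (h t)) \<partial>lborel)
      \<le> (\<integral>\<^sup>+t. (ennreal (D * \<delta>) * ennreal (exp (- \<bar>t - x\<bar> / T)) + ennreal (D / \<delta>) * ennreal (exp (- \<bar>t - x\<bar> / T) * (norm (h t))\<^sup>2)) \<partial>lborel)"
  proof (intro nn_integral_mono)
    fix t
    have "norm (h t) \<le> \<delta> + (norm (h t))\<^sup>2 / \<delta>"
    proof (cases "norm (h t) \<le> \<delta>")
      case True then show ?thesis using \<delta> by (simp add: add_increasing2)
    next
      case False
      then have "\<delta> * norm (h t) \<le> norm (h t) * norm (h t)" by (intro mult_right_mono) auto
      then have "norm (h t) \<le> (norm (h t))\<^sup>2 / \<delta>" using \<delta> by (simp add: power2_eq_square field_simps)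
      then show ?thesis using \<delta> by simp
    qed
    then have "w t * norm (h t) \<le> (D * exp (- \<bar>t - x\<bar> / T)) * (\<delta> + (norm (h t))\<^sup>2 / \<delta>)"
      using w D by (intro mult_mono) auto
    also have "\<dots> = D * \<delta> * exp (- \<bar>t - x\<bar> / T) + D / \<delta> * (exp (- \<bar>t - x\<bar> / T) * (norm (h t))\<^sup>2)"
      by (simp add: algebra_simps)
    finally show "ennreal (w t * norm (h t)) \<le> ennreal (D * \<delta>) * ennreal (exp (- \<bar>t - x\<bar> / T))
        + ennreal (D / \<delta>) * ennreal (exp (- \<bar>t - x\<bar> / T) * (norm (h t))\<^sup>2)"
      using D \<delta> by (simp add: ennreal_mult[symmetric] ennreal_plus[symmetric] del: ennreal_plus)
  qed
  also have "\<dots> = ennreal (D * \<delta>) * (\<integral>\<^sup>+t. ennreal (exp (- \<bar>t - x\<bar> / T)) \<partial>lborel)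
      + ennreal (D / \<delta>) * (\<integral>\<^sup>+t. ennreal (exp (- \<bar>t - x\<bar> / T) * (norm (h t))\<^sup>2) \<partial>lborel)"
    by (simp add: nn_integral_add nn_integral_cmult)
  also have "(\<integral>\<^sup>+t. ennreal (exp (- \<bar>t - x\<bar> / T)) \<partial>lborel) = ennreal (2 * T)"
    using integrable_exp_kernel[OF T, of x] by (subst nn_integral_eq_integral) (auto simp: has_bochner_integral_iff)
  also have "ennreal (D * \<delta>) * ennreal (2 * T) + ennreal (D / \<delta>) * (\<integral>\<^sup>+t. ennreal (exp (- \<bar>t - x\<bar> / T) * (norm (h t))\<^sup>2) \<partial>lborel)
     \<le> ennreal (D * \<delta>) * ennreal (2 * T) + ennreal (D / \<delta>) * ennreal E"
    using h by (intro add_left_mono mult_left_mono) auto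
  also have "\<dots> = ennreal (D * (\<delta> * (2 * T) + E / \<delta>))"
    using D \<delta> E T by (simp add: ennreal_mult[symmetric] ennreal_plus[symmetric] algebra_simps del: ennreal_plus)
  finally show ?thesis .
qed

lemma energy_const_nonneg: "energy_const \<ge> 0"
  using schur_bound_nonneg by (simp add: energy_const_def)

text \<open>The weights \<open>4 ^ j\<close> force the increments below \<open>(1 / 2) ^ j\<close>
  eventually.\<close>

lemma weighted_square_summable_imp_convergent:
  fixes u :: "nat \<Rightarrow> complex"
  assumes "summable (\<lambda>j. 4 ^ j * (norm (u (Suc j) - u j))\<^sup>2)"
  shows "convergent u"
proof -
  have "summable (\<lambda>j. u (Suc j) - u j)"
  proof (rule summable_comparison_test_ev)
    show "summable (\<lambda>j. (1 / 2 :: real) ^ j)" by simp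
    have "(\<lambda>j. 4 ^ j * (norm (u (Suc j) - u j))\<^sup>2) \<longlonglongrightarrow> 0" using assms by (rule summable_LIMSEQ_zero)
    then have "\<forall>\<^sub>F j in sequentially. 4 ^ j * (norm (u (Suc j) - u j))\<^sup>2 < 1" by (rule order_tendstoD) simp
    then show "\<forall>\<^sub>F j in sequentially. norm (u (Suc j) - u j) \<le> (1 / 2) ^ j"
    proof eventually_elim
      case (elim j)
      have "(4::real) ^ j = (2 ^ j)\<^sup>2" by (simp add: power2_eq_square flip: power_mult_distrib)
      then have "(2 ^ j * norm (u (Suc j) - u j))\<^sup>2 \<le> 1\<^sup>2" using elim by (simp add: power_mult_distrib)
      then have "2 ^ j * norm (u (Suc j) - u j) \<le> 1" by (rule power2_le_imp_le) simp
      then show ?case by (simp add: field_simps)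
    qed
  qed
  then have "convergent (\<lambda>n. u n - u 0)"
    unfolding summable_iff_convergent sum_lessThan_telescope .
  then have "convergent (\<lambda>n. (u n - u 0) + u 0)" by (intro convergent_add convergent_const)
  then show ?thesis by simp
qed

lemma lacunary_partial_sums_converge:
  fixes c :: "nat \<Rightarrow> complex"
  assumes sq: "square_summable c"
  obtains N :: "nat \<Rightarrow> nat" and g :: "real \<Rightarrow> complex"
  where "lacunary_limit c N g"
proof -
  define b where "b = (\<lambda>N k. if k < N then 0 else block_mass c 1 k)"
  have sb: "summable (\<lambda>k. (b N k)\<^sup>2)" for N
    by (rule summable_comparison_test[OF _ sq]) (auto simp: b_def)
  define tail where "tail = (\<lambda>N. \<Sum>k. (b N k)\<^sup>2)"
  have tail0: "tail N \<ge> 0" for N unfolding tail_def by (intro suminf_nonneg sb) auto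
  have tail_eq: "tail N = (\<Sum>k. (block_mass c 1 (k + N))\<^sup>2)" for N
    unfolding tail_def by (subst suminf_split_initial_segment[OF sb, of N N]) (simp add: b_def)
  \<comment> \<open>The rate \<open>16 ^ j\<close> serves twice: multiplied by \<open>4 ^ j\<close>
    the energies of the differences are still summable, and division by
    \<open>\<delta> = (1 / 4) ^ j\<close> still leaves a weighted integral of order
    \<open>(1 / 4) ^ j\<close>.\<close>
  have ex: "\<exists>n. \<forall>M\<ge>n. tail M \<le> 1 / 16 ^ j" for j
    using suminf_exist_split[of "1 / 16 ^ j" "\<lambda>k. (block_mass c 1 k)\<^sup>2"] sq
    by (force simp: tail_eq add.commute)
  then obtain n0 where n0: "\<And>j M. M \<ge> n0 j \<Longrightarrow> tail M \<le> 1 / 16 ^ j" by metis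
  have p16: "(16::real) ^ j = 4 ^ j * 4 ^ j" for j by (simp flip: power_mult_distrib)
  \<comment> \<open>Summing the \<open>n0 i\<close> keeps \<open>N j >= n0 j\<close>; the extra
    \<open>j\<close> makes \<open>N\<close> strictly increasing.\<close>
  define N where "N = (\<lambda>j. j + (\<Sum>i\<le>j. n0 i))"
  have sm: "strict_mono N" by (rule strict_monoI_Suc) (simp add: N_def)
  have NS: "N j \<le> N (Suc j)" for j by (simp add: N_def)
  have tN: "tail (N j) \<le> 1 / 16 ^ j" for j
    by (rule n0) (auto simp: N_def intro: trans_le_add2 member_le_sum)
  define P where "P = (\<lambda>j. partial_sum c (N j))"
  have [measurable]: "P j \<in> borel_measurable borel" for j by (simp add: P_def)
  have diff: "(\<integral>\<^sup>+t. ennreal (exp (- \<bar>t\<bar>) * (norm (P (Suc j) t - P j t))\<^sup>2) \<partial>lborel) \<le> ennreal (energy_const * tail (N j))" for j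
  proof -
    have "(\<integral>\<^sup>+t. ennreal (exp (- \<bar>t - 0\<bar> / 1) * (norm (\<Sum>n | freq n < real (N (Suc j)) \<and> \<not> freq n < real (N j). c n * cis (- freq n * t)))\<^sup>2) \<partial>lborel)
        \<le> ennreal (energy_const * 1 * (\<Sum>k. (b (N j) k)\<^sup>2))"
      by (rule trig_sum_energy_le[where L = 1]) (use sb sum_high_block_le in \<open>auto simp: b_def\<close>)
    then show ?thesis using partial_sum_diff[OF NS] by (simp add: P_def tail_def)
  qed
  have "(\<integral>\<^sup>+t. (\<Sum>j. ennreal (4 ^ j * (exp (- \<bar>t\<bar>) * (norm (P (Suc j) t - P j t))\<^sup>2))) \<partial>lborel)
      = (\<Sum>j. ennreal (4 ^ j) * (\<integral>\<^sup>+t. ennreal (exp (- \<bar>t\<bar>) * (norm (P (Suc j) t - P j t))\<^sup>2) \<partial>lborel))"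
    by (subst nn_integral_suminf) (auto simp: ennreal_mult nn_integral_cmult)
  also have "\<dots> \<le> (\<Sum>j. ennreal (energy_const * (1 / 4) ^ j))"
  proof (intro suminf_le allI)
    fix j
    have "ennreal (4 ^ j) * (\<integral>\<^sup>+t. ennreal (exp (- \<bar>t\<bar>) * (norm (P (Suc j) t - P j t))\<^sup>2) \<partial>lborel)
        \<le> ennreal (4 ^ j) * ennreal (energy_const * (1 / 16 ^ j))"
      using energy_const_nonneg tN
      by (intro mult_left_mono order_trans[OF diff] ennreal_leI) auto
    also have "\<dots> = ennreal (energy_const * (1 / 4) ^ j)"
      using energy_const_nonneg by (simp add: ennreal_mult[symmetric] p16 power_one_over)
    finally show "ennreal (4 ^ j) * (\<integral>\<^sup>+t. ennreal (exp (- \<bar>t\<bar>) * (norm (P (Suc j) t - P j t))\<^sup>2) \<partial>lborel)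
      \<le> ennreal (energy_const * (1 / 4) ^ j)" .
  qed auto
  also have "\<dots> < \<infinity>"
    using energy_const_nonneg by (subst suminf_ennreal2) (auto intro!: summable_mult)
  finally have "AE t in lborel. (\<Sum>j. ennreal (4 ^ j * (exp (- \<bar>t\<bar>) * (norm (P (Suc j) t - P j t))\<^sup>2))) \<noteq> \<infinity>"
    by (intro nn_integral_PInf_AE) auto
  then have conv: "AE t in lborel. convergent (\<lambda>j. P j t)"
  proof eventually_elim
    case (elim t)
    then have "summable (\<lambda>j. 4 ^ j * (exp (- \<bar>t\<bar>) * (norm (P (Suc j) t - P j t))\<^sup>2))"
      by (intro summable_suminf_not_top) (auto simp: top_ennreal.rep_eq)
    then have "summable (\<lambda>j. exp \<bar>t\<bar> * (4 ^ j * (exp (- \<bar>t\<bar>) * (norm (P (Suc j) t - P j t))\<^sup>2)))"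
      by (rule summable_mult)
    then have "summable (\<lambda>j. 4 ^ j * (norm (P (Suc j) t - P j t))\<^sup>2)"
      by (simp add: exp_minus field_simps)
    then show ?case by (rule weighted_square_summable_imp_convergent)
  qed
  define g where "g = (\<lambda>t. lim (\<lambda>j. P j t))"
  have [measurable]: "g \<in> borel_measurable borel"
    unfolding g_def by (rule borel_measurable_lim_metric) simp
  have lim: "AE t in lborel. (\<lambda>j. P j t) \<longlonglongrightarrow> g t"
    using conv by eventually_elim (simp add: g_def convergent_LIMSEQ_iff)
  have en: "(\<integral>\<^sup>+t. ennreal (exp (- \<bar>t - x\<bar> / 1) * (norm (g t - P j t))\<^sup>2) \<partial>lborel) \<le> ennreal (energy_const * 1 * tail (N j))" for j x
    unfolding tail_def
  proof (rule trig_limit_energy_le[where L = 1 and F = "\<lambda>i. {n. freq n < real (N (i + j)) \<and> \<not> freq n < real (N j)}"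
      and \<alpha> = "\<lambda>i. c" and l = freq])
    show "AE t in lborel. (\<lambda>i. \<Sum>n | freq n < real (N (i + j)) \<and> \<not> freq n < real (N j). c n * cis (- freq n * t)) \<longlonglongrightarrow> g t - P j t"
      using lim
    proof eventually_elim
      case (elim t)
      have "(\<lambda>i. P (i + j) t - P j t) \<longlonglongrightarrow> g t - P j t"
        by (rule tendsto_diff[OF LIMSEQ_ignore_initial_segment[OF elim] tendsto_const])
      moreover have "N j \<le> N (i + j)" for i using sm by (simp add: strict_mono_less_eq)
      ultimately show ?case using partial_sum_diff by (simp add: P_def)
    qed
  qed (use sb sum_high_block_le in \<open>auto simp: b_def\<close>)
  have L1: "(\<integral>\<^sup>+t. ennreal (w t * norm (g t - P j t)) \<partial>lborel) \<le> ennreal (D * (2 + energy_const) * (1 / 4) ^ j)"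
    if w: "exp_dominated w D x" for w D x j
  proof -
    have "(\<integral>\<^sup>+t. ennreal (w t * norm (g t - P j t)) \<partial>lborel)
       \<le> ennreal (D * ((1 / 4) ^ j * (2 * 1) + energy_const * 1 * tail (N j) / (1 / 4) ^ j))"
      by (rule weighted_L1_le_L2[OF exp_dominatedD(1)[OF w] _ exp_dominatedD(2)[OF w] _ _ en[of x]])
         (use exp_dominatedD(3)[OF w] energy_const_nonneg tail0 in auto)
    also have "\<dots> \<le> ennreal (D * ((1 / 4) ^ j * (2 * 1) + energy_const * 1 * (1 / 16 ^ j) / (1 / 4) ^ j))"
      using exp_dominatedD(4)[OF w] tN energy_const_nonneg
      by (intro ennreal_leI mult_left_mono add_left_mono divide_right_mono) auto
    also have "energy_const * 1 * (1 / 16 ^ j) / (1 / 4) ^ j = energy_const * (1 / 4) ^ j"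
      by (simp add: p16 power_one_over)
    finally show ?thesis by (simp add: algebra_simps)
  qed
  have Pint: "integrable lborel (\<lambda>t. w t *\<^sub>R P j t)" if w: "exp_dominated w D x" for w D x j
    by (rule integrable_weighted_bounded[OF w]) (auto simp: P_def intro: norm_partial_sum_le)
  have dint: "integrable lborel (\<lambda>t. w t *\<^sub>R (g t - P j t))" if w: "exp_dominated w D x" for w D x j
    by (rule integrableI_bounded) (use exp_dominatedD(1,2)[OF w] le_less_trans[OF L1[OF w]] in auto)
  have gint: "integrable lborel (\<lambda>t. w t *\<^sub>R g t)" if w: "exp_dominated w D x" for w D x
    using Bochner_Integration.integrable_add[OF dint[OF w, of 0] Pint[OF w, of 0]] by (simp add: scaleR_diff_right)
  have glim: "(\<lambda>j. LINT t|lborel. w t *\<^sub>R P j t) \<longlonglongrightarrow> (LINT t|lborel. w t *\<^sub>R g t)" if w: "exp_dominated w D x" for w D x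
  proof (rule LIM_zero_cancel, rule Lim_null_comparison[OF always_eventually], rule allI)
    let ?d = "\<lambda>j. norm ((LINT t|lborel. w t *\<^sub>R P j t) - (LINT t|lborel. w t *\<^sub>R g t))"
    show "(\<lambda>j. D * (2 + energy_const) * (1 / 4) ^ j) \<longlonglongrightarrow> 0"
      by (intro tendsto_mult_right_zero LIMSEQ_power_zero) simp
    fix j
    have "?d j = norm (LINT t|lborel. w t *\<^sub>R (g t - P j t))"
      unfolding scaleR_diff_right using Pint[OF w, of j] gint[OF w] by (simp add: norm_minus_commute)
    then have "ennreal (?d j) \<le> (\<integral>\<^sup>+t. ennreal (norm (w t *\<^sub>R (g t - P j t))) \<partial>lborel)"
      using integral_norm_bound_ennreal[OF dint[OF w, of j]] by simp
    also have "\<dots> \<le> ennreal (D * (2 + energy_const) * (1 / 4) ^ j)"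
      using L1[OF w, of j] exp_dominatedD(2)[OF w] by simp
    finally show "?d j \<le> D * (2 + energy_const) * (1 / 4) ^ j"
      using exp_dominatedD(4)[OF w] energy_const_nonneg by (subst (asm) ennreal_le_iff) auto
  qed
  show ?thesis
    by (rule that[of N g]) (use sm lim gint glim in \<open>auto simp: lacunary_limit_def P_def\<close>)
qed

section \<open>Boundary values\<close>

definition dirichlet_sum :: "(nat \<Rightarrow> complex) \<Rightarrow> complex \<Rightarrow> complex" where
  "dirichlet_sum c s = (\<Sum>n. c n * exp (- (of_real (freq n) * s)))"

lemma powr_eq_exp_freq: "(of_nat (Suc n) :: complex) powr (- s) = exp (- (of_real (freq n) * s))"
proof -
  have "Ln (of_nat (Suc n) :: complex) = of_real (freq n)"
    unfolding freq_def by (rule Ln_of_nat) simp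
  then show ?thesis by (simp add: powr_def mult.commute del: of_nat_Suc)
qed

lemma exp_freq_Complex: "exp (- (of_real (freq n) * Complex \<sigma> t)) = of_real (exp (- freq n * \<sigma>)) * cis (- freq n * t)"
  by (simp add: exp_eq_polar)

lemma norm_exp_freq: "norm (exp (- (of_real (freq n) * s))) = exp (- freq n * Re s)"
  by simp

lemma freq_less_eq_lessThan: "{n. freq n < x} = {..<nat \<lceil>exp x\<rceil> - 1}"
proof -
  have "freq n < x \<longleftrightarrow> n < nat \<lceil>exp x\<rceil> - 1" for n
  proof -
    have "freq n < x \<longleftrightarrow> exp (freq n) < exp x" by simp
    also have "\<dots> \<longleftrightarrow> real (Suc n) < exp x" by (simp add: freq_def)
    also have "\<dots> \<longleftrightarrow> int (Suc n) < \<lceil>exp x\<rceil>" by (simp add: less_ceiling_iff)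
    also have "\<dots> \<longleftrightarrow> n < nat \<lceil>exp x\<rceil> - 1" by linarith
    finally show ?thesis .
  qed
  then show ?thesis by auto
qed

lemma sums_imp_freq_sums:
  fixes f :: "nat \<Rightarrow> 'a::real_normed_vector"
  assumes "f sums s" and "strict_mono N"
  shows "(\<lambda>j. \<Sum>n | freq n < real (N j). f n) \<longlonglongrightarrow> s"
proof -
  have "filterlim (\<lambda>j. nat \<lceil>exp (real j)\<rceil> - 1) at_top sequentially"
  proof (rule filterlim_at_top_mono[OF filterlim_ident], rule always_eventually, rule allI)
    fix j :: nat
    have "1 + real j \<le> exp (real j)" by (rule exp_ge_add_one_self)
    then show "j \<le> nat \<lceil>exp (real j)\<rceil> - 1" by linarith
  qed
  then have "filterlim (\<lambda>j. nat \<lceil>exp (real (N j))\<rceil> - 1) at_top sequentially"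
    using filterlim_compose filterlim_subseq[OF assms(2)] by blast
  then show ?thesis unfolding freq_less_eq_lessThan
    using assms(1) unfolding sums_def by (rule filterlim_compose[rotated])
qed

lemma block_mass_bounded:
  assumes sq: "square_summable c"
  obtains B where "\<And>k. block_mass c 1 k \<le> B"
proof -
  have "block_mass c 1 k \<le> 1 + (\<Sum>k. (block_mass c 1 k)\<^sup>2)" for k
  proof -
    have "(block_mass c 1 k)\<^sup>2 \<le> (\<Sum>k. (block_mass c 1 k)\<^sup>2)"
      using sum_le_suminf[OF sq, of "{k}"] by simp
    moreover have "block_mass c 1 k \<le> 1 + (block_mass c 1 k)\<^sup>2"
      using zero_le_power2[of "block_mass c 1 k - 1 / 2"] by (simp add: power2_eq_square algebra_simps)
    ultimately show ?thesis by linarith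
  qed
  then show ?thesis by (rule that)
qed

text \<open>Square summability enters through bounded block masses: grouped by blocks, the series is
  at most their bound times the sum of \<open>V\<close>. It is used for the damping
  \<open>exp (- k * \<sigma>)\<close> and for the smoothing weights
  \<open>1 / (1 + r\<^sup>2 * k\<^sup>2)\<close>.\<close>

lemma summable_weighted_blocks:
  assumes sq: "square_summable c" and V: "summable V" "\<And>k. 0 \<le> V k"
    and v: "\<And>n. 0 \<le> v n" "\<And>n. v n \<le> V (nat \<lfloor>freq n\<rfloor>)"
  shows "summable (\<lambda>n. norm (c n) * v n)"
proof -
  obtain B where B: "\<And>k. block_mass c 1 k \<le> B" using block_mass_bounded[OF sq] by metis
  show ?thesis
  proof (rule summableI_nonneg_bounded)
    fix N
    define fl where "fl = (\<lambda>n. nat \<lfloor>freq n\<rfloor>)"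
    have "(\<Sum>n<N. norm (c n) * v n) \<le> (\<Sum>n<N. norm (c n) * V (fl n))"
      using v by (intro sum_mono mult_left_mono) (auto simp: fl_def)
    also have "\<dots> = (\<Sum>k\<in>fl ` {..<N}. (\<Sum>n\<in>{n\<in>{..<N}. fl n = k}. norm (c n)) * V k)"
      by (rule sum_weighted_group) simp
    also have "\<dots> \<le> (\<Sum>k\<in>fl ` {..<N}. B * V k)"
    proof (intro sum_mono mult_right_mono V)
      fix k
      show "(\<Sum>n\<in>{n\<in>{..<N}. fl n = k}. norm (c n)) \<le> B"
        using sum_block_subset_le[of 1 "{..<N}" c c k] B[of k] by (simp add: fl_def)
    qed
    also have "\<dots> = B * (\<Sum>k\<in>fl ` {..<N}. V k)" by (simp add: sum_distrib_left)
    also have "\<dots> \<le> B * (\<Sum>k. V k)"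
      using V order_trans[OF block_mass_nonneg B] by (intro mult_left_mono sum_le_suminf) auto
    finally show "(\<Sum>n<N. norm (c n) * v n) \<le> B * (\<Sum>k. V k)" .
  qed (use v in auto)
qed

lemma summable_exp_neg: "\<sigma> > 0 \<Longrightarrow> summable (\<lambda>k. exp (- real k * \<sigma>))"
  using summable_geometric[of "exp (- \<sigma>)"] by (simp add: exp_of_nat_mult[symmetric])

lemma floor_freq_le: "real (nat \<lfloor>freq n\<rfloor>) \<le> freq n"
  by (simp add: of_nat_nat)

lemma freq_less_floor: "freq n < real (nat \<lfloor>freq n\<rfloor>) + 1"
  by (simp add: of_nat_nat)

lemma summable_norm_dirichlet:
  assumes sq: "square_summable c" and "\<sigma> > 0"
  shows "summable (\<lambda>n. norm (c n) * exp (- freq n * \<sigma>))"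
proof (rule summable_weighted_blocks[OF sq summable_exp_neg[OF assms(2)]])
  show "exp (- freq n * \<sigma>) \<le> exp (- real (nat \<lfloor>freq n\<rfloor>) * \<sigma>)" for n
    using floor_freq_le[of n] assms(2) by simp
qed auto

text \<open>The hypothesis is absolute convergence in the half-plane instead of a block condition,
  because Landau's theorem supplies it at a stage where no block condition is known.\<close>

lemma dirichlet_sum_has_derivative:
  assumes abs: "\<And>\<sigma>. \<sigma> > 0 \<Longrightarrow> summable (\<lambda>n. norm (c n) * exp (- freq n * \<sigma>))" and s: "Re s > 0"
  shows "(\<lambda>n. c n * exp (- (of_real (freq n) * s))) sums dirichlet_sum c s"
    and "(dirichlet_sum c has_field_derivative deriv (dirichlet_sum c) s) (at s)"
    and "(\<lambda>n. - of_real (freq n) * c n * exp (- (of_real (freq n) * s))) sums deriv (dirichlet_sum c) s"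
proof -
  define S where "S = {z. Re z > Re s / 2}"
  have "open S" unfolding S_def by (rule open_halfspace_Re_gt)
  have sS: "s \<in> S" using s by (simp add: S_def)
  obtain g g' where g: "\<forall>x\<in>S. ((\<lambda>n. c n * exp (- (of_real (freq n) * x))) sums g x) \<and>
      ((\<lambda>n. - of_real (freq n) * c n * exp (- (of_real (freq n) * x))) sums g' x) \<and> (g has_field_derivative g' x) (at x)"
  proof (rule series_and_derivative_comparison[OF \<open>open S\<close>, of "\<lambda>n. norm (c n) * exp (- freq n * (Re s / 2))"
        "\<lambda>n x. c n * exp (- (of_real (freq n) * x))" "\<lambda>n x. - of_real (freq n) * c n * exp (- (of_real (freq n) * x))"])
    show "summable (\<lambda>n. norm (c n) * exp (- freq n * (Re s / 2)))" using s by (intro abs) auto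
    show "((\<lambda>x. c n * exp (- (of_real (freq n) * x))) has_field_derivative
       - of_real (freq n) * c n * exp (- (of_real (freq n) * x))) (at x)" for n x
      by (auto intro!: derivative_eq_intros)
    show "\<forall>\<^sub>F n in sequentially. \<forall>x\<in>S. norm (c n * exp (- (of_real (freq n) * x))) \<le> norm (c n) * exp (- freq n * (Re s / 2))"
    proof (intro always_eventually allI ballI)
      fix n x assume "x \<in> S"
      then have "freq n * (Re s / 2) \<le> freq n * Re x" by (intro mult_left_mono) (auto simp: S_def)
      then show "norm (c n * exp (- (of_real (freq n) * x))) \<le> norm (c n) * exp (- freq n * (Re s / 2))"
        unfolding norm_mult norm_exp_freq by (intro mult_left_mono) auto
    qed
  qed blast
  have eq: "dirichlet_sum c x = g x" if "x \<in> S" for x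
    using g that unfolding dirichlet_sum_def by (simp add: sums_iff)
  have d: "(dirichlet_sum c has_field_derivative g' s) (at s)"
    by (rule has_field_derivative_transform_within_open[of g]) (use g sS \<open>open S\<close> eq in auto)
  then have "deriv (dirichlet_sum c) s = g' s" by (rule DERIV_imp_deriv)
  with d g sS eq show "(\<lambda>n. c n * exp (- (of_real (freq n) * s))) sums dirichlet_sum c s"
    and "(dirichlet_sum c has_field_derivative deriv (dirichlet_sum c) s) (at s)"
    and "(\<lambda>n. - of_real (freq n) * c n * exp (- (of_real (freq n) * s))) sums deriv (dirichlet_sum c) s"
    by auto
qed

lemma dirichlet_sum_holomorphic:
  assumes "\<And>\<sigma>. \<sigma> > 0 \<Longrightarrow> summable (\<lambda>n. norm (c n) * exp (- freq n * \<sigma>))"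
  shows "dirichlet_sum c holomorphic_on right_half_plane"
  unfolding holomorphic_on_def field_differentiable_def
  using dirichlet_sum_has_derivative(2)[OF assms] DERIV_subset by blast

lemma deriv_dirichlet_sum_holomorphic:
  "square_summable c \<Longrightarrow> deriv (dirichlet_sum c) holomorphic_on right_half_plane"
  by (intro holomorphic_deriv dirichlet_sum_holomorphic summable_norm_dirichlet open_halfspace_Re_gt)

section \<open>Horizontal values against interval averages\<close>

lemma continuous_on_Complex:
  assumes F: "F holomorphic_on right_half_plane"
    and "continuous_on S x" "continuous_on S y" "\<And>s. s \<in> S \<Longrightarrow> x s > 0"
  shows "continuous_on S (\<lambda>s. F (Complex (x s) (y s)))"
proof (rule continuous_on_compose2[OF holomorphic_on_imp_continuous_on[OF F]])
  show "continuous_on S (\<lambda>s. Complex (x s) (y s))" unfolding Complex_eq by (intro continuous_intros assms)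
qed (use assms in auto)

text \<open>The multiplier by which averaging over \<open>[t, t + \<sigma>]\<close> acts on
  frequency \<open>l\<close>, at \<open>u = l * \<sigma>\<close>: the integral of
  \<open>exp (- \<i> * u * s)\<close> over \<open>s\<close> in \<open>[0, 1]\<close>.\<close>

definition cis_mean :: "real \<Rightarrow> complex" where
  "cis_mean u = (if u = 0 then 1 else (1 - cis (- u)) / (\<i> * of_real u))"

lemma cis_integral:
  assumes "\<sigma> > 0"
  shows "(LINT \<tau>|lborel. indicator {t..t + \<sigma>} \<tau> *\<^sub>R cis (- l * \<tau>)) = of_real \<sigma> * cis_mean (l * \<sigma>) * cis (- l * t)"
proof (cases "l = 0")
  case True
  then show ?thesis using assms by (simp add: cis_mean_def scaleR_conv_of_real)
next
  case False
  have "(LINT \<tau>|lborel. indicator {t..t + \<sigma>} \<tau> *\<^sub>R cis (- l * \<tau>))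
      = (\<i> / of_real l) * cis (- l * (t + \<sigma>)) - (\<i> / of_real l) * cis (- l * t)"
  proof (rule integral_FTC_Icc)
    fix x
    have "((\<lambda>z. (\<i> / of_real l) * exp (- (\<i> * of_real l) * z)) has_field_derivative
       exp (- (\<i> * of_real l) * of_real x)) (at (of_real x))"
      using False by (auto intro!: derivative_eq_intros)
    then have "((\<lambda>x. (\<i> / of_real l) * exp (- (\<i> * of_real l) * of_real x)) has_vector_derivative
       exp (- (\<i> * of_real l) * of_real x)) (at x within {t..t + \<sigma>})"
      by (rule has_vector_derivative_real_field)
    then show "((\<lambda>x. (\<i> / of_real l) * cis (- l * x)) has_vector_derivative cis (- l * x)) (at x within {t..t + \<sigma>})"
      by (simp add: cis_conv_exp mult.assoc)
  qed (use assms in \<open>auto intro!: continuous_intros\<close>)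
  also have "cis (- l * (t + \<sigma>)) = cis (- l * t) * cis (- (l * \<sigma>))"
    by (simp add: cis_mult algebra_simps)
  also have "(\<i> / of_real l) * (cis (- l * t) * cis (- (l * \<sigma>))) - (\<i> / of_real l) * cis (- l * t)
      = of_real \<sigma> * ((1 - cis (- (l * \<sigma>))) / (\<i> * of_real (l * \<sigma>))) * cis (- l * t)"
  proof -
    have "(\<i> / L) * (A * B) - (\<i> / L) * A = S * ((1 - B) / (\<i> * (L * S))) * A"
      if "L \<noteq> 0" "S \<noteq> 0" for A B L S :: complex
    proof -
      have "S * ((1 - B) / (\<i> * (L * S))) * A = (1 - B) / (\<i> * L) * A" using that by simp
      also have "1 / \<i> = - \<i>" by (simp add: divide_inverse)
      then have "(1 - B) / (\<i> * L) * A = - \<i> * (1 - B) / L * A"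
        by (metis divide_divide_eq_left mult.commute mult.left_neutral times_divide_eq_left)
      finally show ?thesis using that by (simp add: field_simps)
    qed
    from this[of "of_real l" "of_real \<sigma>"] show ?thesis using False assms by simp
  qed
  finally show ?thesis using False assms by (simp add: cis_mean_def)
qed

text \<open>The damping \<open>exp (- u)\<close> and the averaging multiplier both equal 1 at
  \<open>u = 0\<close> and are both of order \<open>1 / u\<close> for large \<open>u\<close>, so
  their difference is small at either end. This makes it square summable over dyadic scales.\<close>

lemma norm_exp_minus_cis_mean_le:
  assumes "u \<ge> 0"
  shows "norm (of_real (exp (- u)) - cis_mean u) \<le> 2 * u"
    and "u > 0 \<Longrightarrow> norm (of_real (exp (- u)) - cis_mean u) \<le> 3 / u"
proof -
  have "norm (of_real (exp (- u)) - 1 :: complex) = 1 - exp (- u)"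
  proof -
    have "of_real (exp (- u)) - 1 = (of_real (exp (- u) - 1) :: complex)" by simp
    then show ?thesis using assms by (simp only: norm_of_real) simp
  qed
  moreover have "1 - exp (- u) \<le> u" using exp_ge_add_one_self[of "- u"] by linarith
  moreover have "norm (1 - cis_mean u) \<le> u"
  proof (cases "u = 0")
    case False
    have "norm (exp (\<i> * of_real (- u)) - (\<Sum>i\<le>1. (\<i> * of_real (- u)) ^ i / fact i)) \<le> exp \<bar>Re (\<i> * of_real (- u))\<bar> * norm (\<i> * of_real (- u)) ^ Suc 1 / fact 1"
      by (rule Taylor_exp)
    then have 1: "norm (cis (- u) - 1 + \<i> * of_real u) \<le> u * u"
      by (simp add: cis_conv_exp norm_mult algebra_simps)
    have "1 - cis_mean u = (cis (- u) - 1 + \<i> * of_real u) / (\<i> * of_real u)"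
      using False by (simp add: cis_mean_def field_simps)
    then have "norm (1 - cis_mean u) = norm (cis (- u) - 1 + \<i> * of_real u) / u"
      using assms by (simp add: norm_divide norm_mult)
    also have "\<dots> \<le> u * u / u" using 1 assms by (intro divide_right_mono)
    finally show ?thesis using False by simp
  qed (simp add: cis_mean_def)
  moreover have "norm (of_real (exp (- u)) - cis_mean u) \<le> norm (of_real (exp (- u)) - 1 :: complex) + norm (1 - cis_mean u)"
    by (metis norm_triangle_ineq diff_add_cancel add_diff_eq)
  ultimately show "norm (of_real (exp (- u)) - cis_mean u) \<le> 2 * u" by linarith
  assume u: "u > 0"
  have "norm (cis_mean u) = norm (1 - cis (- u)) / u" using u by (simp add: cis_mean_def norm_divide norm_mult)
  also have "\<dots> \<le> 2 / u"
    using u norm_triangle_ineq4[of 1 "cis (- u)"] by (intro divide_right_mono) auto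
  finally have "norm (cis_mean u) \<le> 2 / u" .
  moreover have "norm (of_real (exp (- u)) :: complex) \<le> 1 / u"
  proof -
    have "u \<le> exp u" using exp_ge_add_one_self[of u] by linarith
    then have "exp (- u) \<le> 1 / u" using u by (simp add: exp_minus field_simps)
    then show ?thesis by (simp only: norm_of_real abs_exp_cancel)
  qed
  ultimately show "norm (of_real (exp (- u)) - cis_mean u) \<le> 3 / u"
    using norm_triangle_ineq4[of "of_real (exp (- u))" "cis_mean u"] by simp
qed

text \<open>A majorant of the squared multiplier for which the sum over dyadic scales telescopes.\<close>

definition dyadic_weight :: "real \<Rightarrow> real" where
  "dyadic_weight v = 120 * (v\<^sup>2 / (1 + v\<^sup>2) - (v / 2)\<^sup>2 / (1 + (v / 2)\<^sup>2))"

lemma dyadic_weight_eq: "dyadic_weight v = 360 * v\<^sup>2 / ((1 + v\<^sup>2) * (4 + v\<^sup>2))"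
proof -
  have "1 + v\<^sup>2 \<noteq> 0" "4 + v\<^sup>2 \<noteq> 0" by (smt (verit) zero_le_power2)+
  then show ?thesis unfolding dyadic_weight_def power_divide
    by (simp add: divide_simps) (simp add: algebra_simps)
qed

lemma dyadic_weight_nonneg: "dyadic_weight v \<ge> 0"
  unfolding dyadic_weight_eq by (intro divide_nonneg_pos mult_pos_pos) (auto intro: add_pos_nonneg)

lemma sum_dyadic_weight_le: "(\<Sum>j<J. dyadic_weight (v * (1 / 2) ^ j)) \<le> 120"
proof -
  define \<phi> where "\<phi> = (\<lambda>j. - (v * (1 / 2) ^ j)\<^sup>2 / (1 + (v * (1 / 2) ^ j)\<^sup>2))"
  have "(\<Sum>j<J. dyadic_weight (v * (1 / 2) ^ j)) = (\<Sum>j<J. 120 * (\<phi> (Suc j) - \<phi> j))"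
    by (simp add: dyadic_weight_def \<phi>_def)
  also have "\<dots> = 120 * (\<phi> J - \<phi> 0)"
    unfolding sum_distrib_left[symmetric] by (simp add: sum_lessThan_telescope)
  finally have "(\<Sum>j<J. dyadic_weight (v * (1 / 2) ^ j)) = 120 * (\<phi> J - \<phi> 0)" .
  moreover have "\<phi> J \<le> 0" by (simp add: \<phi>_def divide_nonpos_pos add_pos_nonneg)
  moreover have "- \<phi> 0 \<le> 1" by (simp add: \<phi>_def divide_le_eq_1 add_pos_nonneg)
  ultimately show ?thesis by simp
qed

text \<open>The majorant depends on \<open>l\<close> only through its unit block, as a bound by
  block masses requires. The 360 in \<open>dyadic_weight_eq\<close> is \<open>36 * 10\<close>: for
  \<open>v > 1\<close> the multiplier is at most \<open>6 / v\<close>, while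
  \<open>(1 + v\<^sup>2) * (4 + v\<^sup>2)\<close> is at most \<open>10 * v^4\<close>.\<close>

lemma multiplier_le_dyadic_weight:
  assumes l: "l \<ge> 0" and \<sigma>: "0 < \<sigma>" "\<sigma> \<le> 1"
  shows "norm (of_real (exp (- (l * \<sigma>))) - cis_mean (l * \<sigma>)) \<le> sqrt (dyadic_weight ((real (nat \<lfloor>l\<rfloor>) + 1) * \<sigma>))"
proof (rule real_le_rsqrt)
  define v where "v = (real (nat \<lfloor>l\<rfloor>) + 1) * \<sigma>"
  define m where "m = norm (of_real (exp (- (l * \<sigma>))) - cis_mean (l * \<sigma>))"
  have m0: "m \<ge> 0" by (simp add: m_def)
  have v0: "v > 0" using \<sigma> by (simp add: v_def)
  have lv: "l * \<sigma> \<le> v" unfolding v_def using \<sigma> l by (intro mult_right_mono) (auto simp: of_nat_nat intro: less_imp_le)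
  have m1: "m \<le> 2 * v"
    using norm_exp_minus_cis_mean_le(1)[of "l * \<sigma>"] l \<sigma> lv unfolding m_def by simp
  show "m\<^sup>2 \<le> dyadic_weight v"
  proof (cases "v \<le> 1")
    case True
    have "m\<^sup>2 \<le> (2 * v)\<^sup>2" using m0 m1 by (intro power_mono)
    also have "\<dots> \<le> 360 * v\<^sup>2 / (2 * 5)" by simp
    also have "\<dots> \<le> dyadic_weight v" unfolding dyadic_weight_eq
      using True v0 by (intro divide_left_mono mult_mono mult_pos_pos) (auto simp: power_le_one intro: add_pos_nonneg)
    finally show ?thesis .
  next
    case False
    then have "l \<ge> 1"
    proof (rule_tac ccontr)
      assume "\<not> l \<ge> 1" then have "\<lfloor>l\<rfloor> = 0" using l by linarith
      then show False using False \<sigma> by (simp add: v_def)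
    qed
    then have "real (nat \<lfloor>l\<rfloor>) + 1 \<le> 2 * l" by (simp add: of_nat_nat) linarith
    then have "v \<le> 2 * l * \<sigma>" unfolding v_def using \<sigma> by (intro mult_right_mono) auto
    moreover have "m \<le> 3 / (l * \<sigma>)"
      unfolding m_def by (rule norm_exp_minus_cis_mean_le(2)) (use \<open>l \<ge> 1\<close> \<sigma> in auto)
    moreover have "3 / (l * \<sigma>) \<le> 6 / v"
      using calculation(1) v0 \<open>l \<ge> 1\<close> \<sigma> by (simp add: field_simps)
    ultimately have "m \<le> 6 / v" by linarith
    then have "m\<^sup>2 \<le> (6 / v)\<^sup>2" using m0 by (intro power_mono)
    also have "\<dots> = 360 * v\<^sup>2 / (10 * (v\<^sup>2 * v\<^sup>2))" using v0 by (simp add: power_divide field_simps power2_eq_square)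
    also have "\<dots> \<le> dyadic_weight v" unfolding dyadic_weight_eq
    proof (intro divide_left_mono mult_pos_pos)
      have v1: "1 \<le> v\<^sup>2" using False by (simp add: one_le_power)
      have "(1 + v\<^sup>2) * (4 + v\<^sup>2) \<le> (2 * v\<^sup>2) * (5 * v\<^sup>2)" using v1 by (intro mult_mono) auto
      then show "(1 + v\<^sup>2) * (4 + v\<^sup>2) \<le> 10 * (v\<^sup>2 * v\<^sup>2)" by simp
    qed (use v0 in \<open>auto intro: add_pos_nonneg\<close>)
    finally show ?thesis .
  qed
qed

lemma indicator_le_exp_kernel:
  fixes a b d t x T :: real
  assumes "\<And>t. t \<in> {a..b} \<Longrightarrow> \<bar>t - x\<bar> \<le> d" "T > 0"
  shows "indicator {a..b} t \<le> exp (d / T) * exp (- \<bar>t - x\<bar> / T)"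
proof (cases "t \<in> {a..b}")
  case True
  then have "\<bar>t - x\<bar> / T \<le> d / T" using assms(1)[OF True] assms(2) by (intro divide_right_mono) auto
  then show ?thesis using True by (simp add: exp_add[symmetric])
qed simp

lemma indicator_exp_dominated: "exp_dominated (indicator {a..b}) (exp (max \<bar>a\<bar> \<bar>b\<bar>)) 0"
  unfolding exp_dominated_def
proof (intro conjI allI)
  fix t :: real
  have "\<bar>s - 0\<bar> \<le> max \<bar>a\<bar> \<bar>b\<bar>" if "s \<in> {a..b}" for s using that by (simp add: le_max_iff_disj) linarith
  from indicator_le_exp_kernel[OF this, where T = 1 and t = t]
  show "indicator {a..b} t \<le> exp (max \<bar>a\<bar> \<bar>b\<bar>) * exp (- \<bar>t - 0\<bar>)" by simp
qed auto

lemma lebesgue_differentiation_dyadic: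
  fixes g :: "real \<Rightarrow> complex"
  assumes gint: "\<And>a b. integrable lborel (\<lambda>t. indicator {a..b} t *\<^sub>R g t)"
  shows "AE t in lborel. (\<lambda>j. 2 ^ j *\<^sub>R (LINT \<tau>|lborel. indicator {t..t + (1 / 2) ^ j} \<tau> *\<^sub>R g \<tau>)) \<longlonglongrightarrow> g t"
proof -
  have si: "set_integrable lborel {a..b} g" for a b using gint by (simp add: set_integrable_def)
  have "g integrable_on cbox a b" for a b
    using set_borel_integral_eq_integral(1)[OF si] by simp
  then obtain Z where Z: "negligible Z" and lim: "\<And>x e. \<lbrakk>x \<notin> Z; 0 < e\<rbrakk> \<Longrightarrow>
      \<exists>d>0. \<forall>h. 0 < h \<and> h < d \<longrightarrow> norm (integral (cbox x (x + h *\<^sub>R One)) g /\<^sub>R h ^ DIM(real) - g x) < e"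
    using integrable_ccontinuous_explicit by blast
  have "AE t in lebesgue. t \<notin> Z" using Z by (intro AE_not_in) (simp add: negligible_iff_null_sets)
  then have "AE t in lborel. t \<notin> Z" by (simp add: AE_completion_iff)
  then show ?thesis
  proof eventually_elim
    case (elim t)
    show ?case
    proof (rule tendstoI)
      fix e :: real assume "e > 0"
      then obtain d where d: "d > 0" "\<And>h. 0 < h \<Longrightarrow> h < d \<Longrightarrow> norm (integral {t..t + h} g /\<^sub>R h - g t) < e"
        using lim[OF elim, of e] by auto
      have "(\<lambda>j. (1 / 2 :: real) ^ j) \<longlonglongrightarrow> 0" by (rule LIMSEQ_power_zero) simp
      then have "\<forall>\<^sub>F j in sequentially. (1 / 2 :: real) ^ j < d" using d(1) by (rule order_tendstoD)
      then show "\<forall>\<^sub>F j in sequentially. dist (2 ^ j *\<^sub>R (LINT \<tau>|lborel. indicator {t..t + (1 / 2) ^ j} \<tau> *\<^sub>R g \<tau>)) (g t) < e"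
      proof eventually_elim
        case (elim j)
        have "(LINT \<tau>|lborel. indicator {t..t + (1 / 2) ^ j} \<tau> *\<^sub>R g \<tau>) = integral {t..t + (1 / 2) ^ j} g"
          using set_borel_integral_eq_integral(2)[OF si] by (simp add: set_lebesgue_integral_def)
        then show ?case using d(2)[of "(1 / 2) ^ j"] elim by (simp add: dist_norm power_one_over)
      qed
    qed
  qed
qed

lemma summable_imp_AE_tendsto_zero:
  fixes \<Delta> :: "nat \<Rightarrow> real \<Rightarrow> complex"
  assumes [measurable]: "\<And>j. \<Delta> j \<in> borel_measurable borel"
    and le: "\<And>j. (\<integral>\<^sup>+t. ennreal (exp (- \<bar>t\<bar>) * (norm (\<Delta> j t))\<^sup>2) \<partial>lborel) \<le> ennreal (x j)"
    and x: "summable x" "\<And>j. x j \<ge> 0"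
  shows "AE t in lborel. (\<lambda>j. \<Delta> j t) \<longlonglongrightarrow> 0"
proof -
  have "(\<integral>\<^sup>+t. (\<Sum>j. ennreal (exp (- \<bar>t\<bar>) * (norm (\<Delta> j t))\<^sup>2)) \<partial>lborel)
      = (\<Sum>j. (\<integral>\<^sup>+t. ennreal (exp (- \<bar>t\<bar>) * (norm (\<Delta> j t))\<^sup>2) \<partial>lborel))"
    by (rule nn_integral_suminf) auto
  also have "\<dots> \<le> (\<Sum>j. ennreal (x j))" by (intro suminf_le le) auto
  also have "\<dots> < \<infinity>" using x by (subst suminf_ennreal2) auto
  finally have "AE t in lborel. (\<Sum>j. ennreal (exp (- \<bar>t\<bar>) * (norm (\<Delta> j t))\<^sup>2)) \<noteq> \<infinity>"
    by (intro nn_integral_PInf_AE) auto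
  then show ?thesis
  proof eventually_elim
    case (elim t)
    then have "summable (\<lambda>j. exp (- \<bar>t\<bar>) * (norm (\<Delta> j t))\<^sup>2)"
      by (intro summable_suminf_not_top) (auto simp: top_ennreal.rep_eq)
    then have "(\<lambda>j. exp (- \<bar>t\<bar>) * (norm (\<Delta> j t))\<^sup>2) \<longlonglongrightarrow> 0" by (rule summable_LIMSEQ_zero)
    then have "(\<lambda>j. exp \<bar>t\<bar> * (exp (- \<bar>t\<bar>) * (norm (\<Delta> j t))\<^sup>2)) \<longlonglongrightarrow> 0" by (rule tendsto_mult_right_zero)
    then have "(\<lambda>j. (norm (\<Delta> j t))\<^sup>2) \<longlonglongrightarrow> 0" by (simp add: exp_minus field_simps)
    then have "(\<lambda>j. sqrt ((norm (\<Delta> j t))\<^sup>2)) \<longlonglongrightarrow> sqrt 0" by (rule tendsto_real_sqrt)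
    then show ?case by (simp add: tendsto_norm_zero_iff)
  qed
qed

lemma integrable_indicator_cis: "integrable lborel (\<lambda>\<tau>. indicator {a..b} \<tau> *\<^sub>R cis (- l * \<tau>))"
  by (rule borel_integrable_compact) (auto intro!: continuous_intros)

lemma interval_integral_partial_sum:
  assumes "\<sigma> > 0"
  shows "(LINT \<tau>|lborel. indicator {t..t + \<sigma>} \<tau> *\<^sub>R partial_sum c N \<tau>)
    = (\<Sum>n | freq n < real N. c n * (of_real \<sigma> * cis_mean (freq n * \<sigma>) * cis (- freq n * t)))"
proof -
  have "(LINT \<tau>|lborel. indicator {t..t + \<sigma>} \<tau> *\<^sub>R partial_sum c N \<tau>)
      = (LINT \<tau>|lborel. (\<Sum>n | freq n < real N. c n * (indicator {t..t + \<sigma>} \<tau> *\<^sub>R cis (- freq n * \<tau>))))"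
    unfolding partial_sum_def by (intro Bochner_Integration.integral_cong refl) (simp add: scaleR_sum_right)
  also have "\<dots> = (\<Sum>n | freq n < real N. LINT \<tau>|lborel. c n * (indicator {t..t + \<sigma>} \<tau> *\<^sub>R cis (- freq n * \<tau>)))"
    by (intro Bochner_Integration.integral_sum integrable_mult_right integrable_indicator_cis)
  also have "\<dots> = (\<Sum>n | freq n < real N. c n * (LINT \<tau>|lborel. indicator {t..t + \<sigma>} \<tau> *\<^sub>R cis (- freq n * \<tau>)))"
    by (intro sum.cong refl Bochner_Integration.integral_mult_right integrable_indicator_cis)
  finally show ?thesis unfolding cis_integral[OF assms] .
qed

text \<open>Both terms are limits along the same partial sums, the second because indicators are
  admissible weights, so the difference has coefficients \<open>c n * m j n\<close>. Its energy at
  scale \<open>j\<close> is bounded by block squares weighted with \<open>q j k\<close>. For a fixed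
  block these weights sum over \<open>j\<close> to at most 120, so the energies are
  summable.\<close>

lemma dyadic_difference_AE:
  assumes sq: "square_summable c" and l: "lacunary_limit c N g"
  shows "AE t in lborel. (\<lambda>j. dirichlet_sum c (Complex ((1 / 2) ^ j) t)
    - 2 ^ j *\<^sub>R (LINT \<tau>|lborel. indicator {t..t + (1 / 2) ^ j} \<tau> *\<^sub>R g \<tau>)) \<longlonglongrightarrow> 0"
proof -
  define m where "m = (\<lambda>j n. of_real (exp (- (freq n * (1 / 2) ^ j))) - cis_mean (freq n * (1 / 2) ^ j))"
  define \<Delta> where "\<Delta> = (\<lambda>j t. dirichlet_sum c (Complex ((1 / 2) ^ j) t)
    - 2 ^ j *\<^sub>R (LINT \<tau>|lborel. indicator {t..t + (1 / 2) ^ j} \<tau> *\<^sub>R g \<tau>))"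
  have lim: "(\<lambda>i. \<Sum>n | freq n < real (N i). (c n * m j n) * cis (- freq n * t)) \<longlonglongrightarrow> \<Delta> j t" for j t
  proof -
    have "(\<lambda>i. (\<Sum>n | freq n < real (N i). c n * exp (- (of_real (freq n) * Complex ((1 / 2) ^ j) t)))
        - 2 ^ j *\<^sub>R (LINT \<tau>|lborel. indicator {t..t + (1 / 2) ^ j} \<tau> *\<^sub>R partial_sum c (N i) \<tau>)) \<longlonglongrightarrow> \<Delta> j t"
      unfolding \<Delta>_def
      by (intro tendsto_diff tendsto_scaleR tendsto_const lacunary_limitD(5)[OF l indicator_exp_dominated]
          sums_imp_freq_sums[OF _ lacunary_limitD(1)[OF l]]
          dirichlet_sum_has_derivative(1) summable_norm_dirichlet[OF sq]) auto
    moreover have "(\<Sum>n | freq n < real (N i). c n * exp (- (of_real (freq n) * Complex ((1 / 2) ^ j) t)))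
        - 2 ^ j *\<^sub>R (LINT \<tau>|lborel. indicator {t..t + (1 / 2) ^ j} \<tau> *\<^sub>R partial_sum c (N i) \<tau>)
      = (\<Sum>n | freq n < real (N i). (c n * m j n) * cis (- freq n * t))" for i
    proof -
      have half: "0 < (1 / 2 :: real) ^ j" by simp
      have "2 ^ j *\<^sub>R (c n * (of_real ((1 / 2) ^ j) * cis_mean (freq n * (1 / 2) ^ j) * cis (- freq n * t)))
          = c n * (cis_mean (freq n * (1 / 2) ^ j) * cis (- freq n * t))" for n
        by (simp add: scaleR_conv_of_real power_one_over)
      then show ?thesis
        unfolding interval_integral_partial_sum[OF half] scaleR_sum_right exp_freq_Complex sum_subtractf[symmetric]
        by (intro sum.cong refl) (simp only: m_def, simp add: algebra_simps)
    qed
    ultimately show ?thesis by simp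
  qed
  have meas: "\<Delta> j \<in> borel_measurable borel" for j
    by (rule borel_measurable_LIMSEQ_metric[OF _ lim]) simp
  define q where "q = (\<lambda>j k. dyadic_weight ((real k + 1) * (1 / 2) ^ j))"
  have q0: "q j k \<ge> 0" for j k by (simp add: q_def dyadic_weight_nonneg)
  have q120: "(\<Sum>j<J. q j k) \<le> 120" for J k unfolding q_def by (rule sum_dyadic_weight_le)
  define b where "b = (\<lambda>j k. block_mass c 1 k * sqrt (q j k))"
  have b2: "(b j k)\<^sup>2 = (block_mass c 1 k)\<^sup>2 * q j k" for j k by (simp add: b_def power_mult_distrib q0)
  have q1: "q j k \<le> 120" for j k
    using q120[of k "Suc j"] sum_nonneg[of "{..<j}" "\<lambda>j. q j k"] q0 by simp
  have sb: "summable (\<lambda>k. (b j k)\<^sup>2)" for j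
  proof (rule summable_comparison_test)
    show "summable (\<lambda>k. (block_mass c 1 k)\<^sup>2 * 120)" using sq by (rule summable_mult2)
    show "\<exists>K. \<forall>k\<ge>K. norm ((b j k)\<^sup>2) \<le> (block_mass c 1 k)\<^sup>2 * 120"
      unfolding b2 using mult_left_mono[OF q1 zero_le_power2] q0 by auto
  qed
  define x where "x = (\<lambda>j. \<Sum>k. (b j k)\<^sup>2)"
  have x0: "x j \<ge> 0" for j unfolding x_def by (intro suminf_nonneg sb) auto
  have "summable x"
  proof (rule summableI_nonneg_bounded)
    fix J
    have "(\<Sum>j<J. x j) = (\<Sum>k. \<Sum>j<J. (b j k)\<^sup>2)" unfolding x_def by (rule suminf_sum[symmetric]) (rule sb)
    also have "\<dots> \<le> (\<Sum>k. (block_mass c 1 k)\<^sup>2 * 120)"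
    proof (rule suminf_le)
      show "(\<Sum>j<J. (b j k)\<^sup>2) \<le> (block_mass c 1 k)\<^sup>2 * 120" for k
        unfolding b2 sum_distrib_left[symmetric] using q120 by (intro mult_left_mono) auto
    qed (use sb sq in \<open>auto intro: summable_sum summable_mult2\<close>)
    finally show "(\<Sum>j<J. x j) \<le> (\<Sum>k. (block_mass c 1 k)\<^sup>2 * 120)" .
  qed (rule x0)
  have "(\<integral>\<^sup>+t. ennreal (exp (- \<bar>t - 0\<bar> / 1) * (norm (\<Delta> j t))\<^sup>2) \<partial>lborel) \<le> ennreal (energy_const * 1 * x j)" for j
    unfolding x_def
  proof (rule trig_limit_energy_le[where L = 1 and l = freq and F = "\<lambda>i. {n. freq n < real (N i)}" and \<alpha> = "\<lambda>i n. c n * m j n"])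
    fix i k
    have "(\<Sum>n\<in>{n\<in>{n. freq n < real (N i)}. nat \<lfloor>freq n / 1\<rfloor> = k}. norm (c n * m j n))
        \<le> (\<Sum>n\<in>{n\<in>{n. freq n < real (N i)}. nat \<lfloor>freq n / 1\<rfloor> = k}. norm (c n) * sqrt (q j k))"
    proof (intro sum_mono)
      fix n assume n: "n \<in> {n\<in>{n. freq n < real (N i)}. nat \<lfloor>freq n / 1\<rfloor> = k}"
      have "norm (m j n) \<le> sqrt (dyadic_weight ((real (nat \<lfloor>freq n\<rfloor>) + 1) * (1 / 2) ^ j))"
        unfolding m_def by (rule multiplier_le_dyadic_weight) (auto simp: power_le_one)
      then show "norm (c n * m j n) \<le> norm (c n) * sqrt (q j k)"
        using n by (auto simp: norm_mult q_def intro!: mult_left_mono)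
    qed
    also have "\<dots> = (\<Sum>n\<in>{n\<in>{n. freq n < real (N i)}. nat \<lfloor>freq n / 1\<rfloor> = k}. norm (c n)) * sqrt (q j k)"
      by (simp add: sum_distrib_right)
    also have "\<dots> \<le> b j k" unfolding b_def
      using sum_block_subset_le[of 1 "{n. freq n < real (N i)}" c c k] q0 by (intro mult_right_mono) auto
    finally show "(\<Sum>n\<in>{n\<in>{n. freq n < real (N i)}. nat \<lfloor>freq n / 1\<rfloor> = k}. norm (c n * m j n)) \<le> b j k" .
  qed (use sb lim in auto)
  then have "AE t in lborel. (\<lambda>j. \<Delta> j t) \<longlonglongrightarrow> 0"
    by (intro summable_imp_AE_tendsto_zero[where x = "\<lambda>j. energy_const * x j"] meas summable_mult \<open>summable x\<close>)
       (use x0 energy_const_nonneg in auto)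
  then show ?thesis by (simp add: \<Delta>_def)
qed

section \<open>The square function of the derivative\<close>

lemma deriv_dirichlet_energy_le:
  assumes sq: "square_summable c" and \<rho>: "\<rho> > 0"
  shows "summable (\<lambda>k. (block_mass c 1 k * ((real k + 1) * exp (- (real k * \<rho>))))\<^sup>2)"
    and "(\<integral>\<^sup>+t. ennreal (exp (- \<bar>t\<bar>) * (norm (deriv (dirichlet_sum c) (Complex \<rho> t)))\<^sup>2) \<partial>lborel)
    \<le> ennreal (energy_const * (\<Sum>k. (block_mass c 1 k * ((real k + 1) * exp (- (real k * \<rho>))))\<^sup>2))"
proof -
  define V where "V = (\<lambda>k. (real k + 1) * exp (- (real k * \<rho>)))"
  have V0: "V k \<ge> 0" for k by (simp add: V_def)
  \<comment> \<open>Crude in \<open>\<rho>\<close>, but it is only used for summability at a fixed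
    \<open>\<rho>\<close>.\<close>
  have Vb: "V k \<le> exp \<rho> / \<rho>" for k
  proof -
    have "(real k + 1) * \<rho> \<le> exp ((real k + 1) * \<rho>)" using exp_ge_add_one_self[of "(real k + 1) * \<rho>"] by linarith
    also have "\<dots> = exp (real k * \<rho>) * exp \<rho>" by (simp add: exp_add[symmetric] algebra_simps)
    finally show ?thesis using \<rho> by (simp add: V_def exp_minus field_simps)
  qed
  show sb: "summable (\<lambda>k. (block_mass c 1 k * ((real k + 1) * exp (- (real k * \<rho>))))\<^sup>2)"
  proof (rule summable_comparison_test)
    show "summable (\<lambda>k. (block_mass c 1 k)\<^sup>2 * (exp \<rho> / \<rho>)\<^sup>2)" using sq by (rule summable_mult2)
    show "\<exists>K. \<forall>k\<ge>K. norm ((block_mass c 1 k * ((real k + 1) * exp (- (real k * \<rho>))))\<^sup>2) \<le> (block_mass c 1 k)\<^sup>2 * (exp \<rho> / \<rho>)\<^sup>2"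
      using Vb V0 unfolding V_def by (auto simp: power_mult_distrib[of "block_mass _ _ _"] abs_mult intro!: mult_left_mono power_mono)
  qed
  have "(\<integral>\<^sup>+t. ennreal (exp (- \<bar>t - 0\<bar> / 1) * (norm (deriv (dirichlet_sum c) (Complex \<rho> t)))\<^sup>2) \<partial>lborel)
    \<le> ennreal (energy_const * 1 * (\<Sum>k. (block_mass c 1 k * ((real k + 1) * exp (- (real k * \<rho>))))\<^sup>2))"
  proof (rule trig_limit_energy_le[where L = 1 and l = freq and F = "\<lambda>i. {..<i}" and
        \<alpha> = "\<lambda>i n. - of_real (freq n) * c n * of_real (exp (- freq n * \<rho>))"])
    show "AE t in lborel. (\<lambda>j. \<Sum>n<j. - of_real (freq n) * c n * of_real (exp (- freq n * \<rho>)) * cis (- freq n * t))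
        \<longlonglongrightarrow> deriv (dirichlet_sum c) (Complex \<rho> t)"
      using dirichlet_sum_has_derivative(3)[OF summable_norm_dirichlet[OF sq], of "Complex \<rho> t" for t] \<rho>
      unfolding exp_freq_Complex sums_def by (simp add: mult.assoc)
    fix j k
    have "(\<Sum>n\<in>{n\<in>{..<j}. nat \<lfloor>freq n / 1\<rfloor> = k}. norm (- of_real (freq n) * c n * of_real (exp (- freq n * \<rho>))))
       \<le> (\<Sum>n\<in>{n\<in>{..<j}. nat \<lfloor>freq n / 1\<rfloor> = k}. norm (c n) * V k)"
    proof (intro sum_mono)
      fix n assume n: "n \<in> {n\<in>{..<j}. nat \<lfloor>freq n / 1\<rfloor> = k}"
      have le: "freq n * exp (- freq n * \<rho>) \<le> V k"
        unfolding V_def using n \<rho> floor_freq_le[of n] freq_less_floor[of n] by (intro mult_mono) auto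
      show "norm (- of_real (freq n) * c n * of_real (exp (- freq n * \<rho>))) \<le> norm (c n) * V k"
        using mult_left_mono[OF le norm_ge_zero[of "c n"]] by (simp add: norm_mult mult.assoc mult.left_commute)
    qed
    also have "\<dots> = (\<Sum>n\<in>{n\<in>{..<j}. nat \<lfloor>freq n / 1\<rfloor> = k}. norm (c n)) * V k" by (simp add: sum_distrib_right)
    also have "\<dots> \<le> block_mass c 1 k * V k"
      using sum_block_subset_le[of 1 "{..<j}" c c k] V0 by (intro mult_right_mono) auto
    finally show "(\<Sum>n\<in>{n\<in>{..<j}. nat \<lfloor>freq n / 1\<rfloor> = k}. norm (- of_real (freq n) * c n * of_real (exp (- freq n * \<rho>))))
       \<le> block_mass c 1 k * ((real k + 1) * exp (- (real k * \<rho>)))" by (simp add: V_def)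
  qed (use sb in auto)
  then show "(\<integral>\<^sup>+t. ennreal (exp (- \<bar>t\<bar>) * (norm (deriv (dirichlet_sum c) (Complex \<rho> t)))\<^sup>2) \<partial>lborel)
    \<le> ennreal (energy_const * (\<Sum>k. (block_mass c 1 k * ((real k + 1) * exp (- (real k * \<rho>))))\<^sup>2))" by simp
qed

lemma nn_integral_rho_exp_le:
  fixes v :: real
  assumes v: "v > 0"
  shows "(\<integral>\<^sup>+\<rho>. ennreal (\<rho> * exp (- 2 * v * \<rho>)) * indicator {0..1} \<rho> \<partial>lborel) \<le> ennreal (1 / (4 * v\<^sup>2))"
proof -
  define F where "F = (\<lambda>\<rho>. - (\<rho> / (2 * v) + 1 / (4 * v\<^sup>2)) * exp (- 2 * v * \<rho>))"
  have "(\<integral>\<^sup>+\<rho>. ennreal (\<rho> * exp (- 2 * v * \<rho>)) * indicator {0..1} \<rho> \<partial>lborel) = ennreal (F 1 - F 0)"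
  proof (rule nn_integral_FTC_Icc)
    fix x :: real
    show "(F has_real_derivative x * exp (- 2 * v * x)) (at x)"
      unfolding F_def using v
      by (auto intro!: derivative_eq_intros) (simp add: field_simps power2_eq_square)
  qed auto
  also have "\<dots> \<le> ennreal (1 / (4 * v\<^sup>2))"
  proof (intro ennreal_leI)
    have "0 \<le> (1 / (2 * v) + 1 / (4 * v\<^sup>2)) * exp (- 2 * v * 1)" using v by simp
    then have "F 1 \<le> 0" unfolding F_def by (simp only: mult_minus_left neg_le_0_iff_le)
    moreover have "F 0 = - (1 / (4 * v\<^sup>2))" by (simp add: F_def)
    ultimately show "F 1 - F 0 \<le> 1 / (4 * v\<^sup>2)" by linarith
  qed
  finally show ?thesis .
qed

text \<open>By Tonelli's theorem block \<open>k\<close> contributes a multiple of the integral of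
  \<open>\<rho> * (k + 1)\<^sup>2 * exp (- 2 * k * \<rho>)\<close> over \<open>(0, 1]\<close>, which
  is bounded uniformly in \<open>k\<close>: the weight \<open>\<rho>\<close> compensates the two
  factors of frequency produced by differentiation.\<close>

lemma deriv_dirichlet_square_function_AE:
  assumes sq: "square_summable c"
  shows "AE t in lborel. (\<integral>\<^sup>+\<rho>. ennreal (\<rho> * (norm (deriv (dirichlet_sum c) (Complex \<rho> t)))\<^sup>2) * indicator {0<..1} \<rho> \<partial>lborel) < \<infinity>"
proof -
  \<comment> \<open>Extension by zero to \<open>\<rho> <= 0\<close> makes the integrand jointly
    Borel measurable, as Tonelli's theorem requires.\<close>
  define G where "G = (\<lambda>(\<rho>, t). indicator ({0<..} \<times> UNIV) (\<rho>, t) *\<^sub>R deriv (dirichlet_sum c) (Complex \<rho> t))"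
  have "continuous_on ({0<..} \<times> UNIV) (\<lambda>x. deriv (dirichlet_sum c) (Complex (fst x) (snd x)))"
    by (rule continuous_on_Complex[OF deriv_dirichlet_sum_holomorphic[OF sq]]) (auto intro!: continuous_intros)
  then have "(\<lambda>x. indicator ({0<..} \<times> UNIV) x *\<^sub>R deriv (dirichlet_sum c) (Complex (fst x) (snd x))) \<in> borel_measurable borel"
    by (intro borel_measurable_continuous_on_indicator) (auto intro!: borel_open open_Times)
  then have [measurable]: "G \<in> borel_measurable (borel \<Otimes>\<^sub>M borel)"
    by (simp add: G_def case_prod_unfold borel_prod)
  have Geq: "G (\<rho>, t) = deriv (dirichlet_sum c) (Complex \<rho> t)" if "\<rho> > 0" for \<rho> t
    using that by (simp add: G_def)
  define W where "W = (\<lambda>t. \<integral>\<^sup>+\<rho>. ennreal (\<rho> * (norm (G (\<rho>, t)))\<^sup>2) * indicator {0<..1} \<rho> \<partial>lborel)"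
  have Weq: "W t = (\<integral>\<^sup>+\<rho>. ennreal (\<rho> * (norm (deriv (dirichlet_sum c) (Complex \<rho> t)))\<^sup>2) * indicator {0<..1} \<rho> \<partial>lborel)" for t
    unfolding W_def by (intro nn_integral_cong) (auto simp: Geq indicator_def)
  have [measurable]: "W \<in> borel_measurable borel" unfolding W_def by measurable
  define B where "B = (\<lambda>k. block_mass c 1 k)"
  let ?E = "\<lambda>k. ennreal (energy_const * (B k)\<^sup>2 * exp 2 * (real k + 1)\<^sup>2)"
    and ?e = "\<lambda>k \<rho>. ennreal (\<rho> * exp (- 2 * (real k + 1) * \<rho>)) * indicator {0..1} \<rho>"
    and ?g = "\<lambda>\<rho> t. ennreal (exp (- \<bar>t\<bar>)) * (ennreal (\<rho> * (norm (G (\<rho>, t)))\<^sup>2) * indicator {0<..1} \<rho>)"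
  have "(\<integral>\<^sup>+t. ennreal (exp (- \<bar>t\<bar>)) * W t \<partial>lborel)
     = (\<integral>\<^sup>+t. (\<integral>\<^sup>+\<rho>. ?g \<rho> t \<partial>lborel) \<partial>lborel)"
    unfolding W_def by (simp add: nn_integral_cmult)
  also have "\<dots> = (\<integral>\<^sup>+\<rho>. (\<integral>\<^sup>+t. ?g \<rho> t \<partial>lborel) \<partial>lborel)"
    by (rule lborel_pair.Fubini') measurable
  also have "\<dots> \<le> (\<integral>\<^sup>+\<rho>. (\<Sum>k. ?E k *
       ?e k \<rho>) \<partial>lborel)"
  proof (rule nn_integral_mono)
    fix \<rho> :: real
    show "(\<integral>\<^sup>+t. ?g \<rho> t \<partial>lborel)
      \<le> (\<Sum>k. ?E k * ?e k \<rho>)"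
    proof (cases "\<rho> \<in> {0<..1}")
      case True
      then have \<rho>: "0 < \<rho>" "\<rho> \<le> 1" by auto
      have "(\<integral>\<^sup>+t. ?g \<rho> t \<partial>lborel)
         = (\<integral>\<^sup>+t. ennreal \<rho> * ennreal (exp (- \<bar>t\<bar>) * (norm (G (\<rho>, t)))\<^sup>2) \<partial>lborel)"
        using True by (intro nn_integral_cong) (simp add: ennreal_mult[symmetric] mult_ac)
      also have "\<dots> = ennreal \<rho> * (\<integral>\<^sup>+t. ennreal (exp (- \<bar>t\<bar>) * (norm (G (\<rho>, t)))\<^sup>2) \<partial>lborel)"
        by (rule nn_integral_cmult) measurable
      also have "\<dots> \<le> ennreal \<rho> * ennreal (energy_const * (\<Sum>k. (B k * ((real k + 1) * exp (- (real k * \<rho>))))\<^sup>2))"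
        using deriv_dirichlet_energy_le(2)[OF sq \<rho>(1)] by (intro mult_left_mono) (auto simp: Geq[OF \<rho>(1)] B_def)
      also have "\<dots> = (\<Sum>k. ennreal (\<rho> * (energy_const * (B k * ((real k + 1) * exp (- (real k * \<rho>))))\<^sup>2)))"
        using deriv_dirichlet_energy_le(1)[OF sq \<rho>(1)] \<rho> energy_const_nonneg unfolding B_def
        by (subst suminf_ennreal2) (auto simp: ennreal_mult[symmetric] suminf_mult suminf_nonneg summable_mult)
      also have "\<dots> \<le> (\<Sum>k. ?E k * ?e k \<rho>)"
      proof (intro suminf_le allI)
        fix k
        \<comment> \<open>Passing from \<open>k\<close> to \<open>k + 1\<close> in the exponent
          costs \<open>exp 2\<close> for \<open>\<rho> <= 1\<close> and lets block 0 decay like the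
          others.\<close>
        have "(exp (- (real k * \<rho>)))\<^sup>2 = exp (2 * \<rho>) * exp (- 2 * (real k + 1) * \<rho>)"
          by (simp add: power2_eq_square exp_add[symmetric] algebra_simps)
        also have "\<dots> \<le> exp 2 * exp (- 2 * (real k + 1) * \<rho>)" using \<rho> by (intro mult_right_mono) auto
        finally have "(energy_const * (B k)\<^sup>2 * (real k + 1)\<^sup>2 * \<rho>) * (exp (- (real k * \<rho>)))\<^sup>2
            \<le> (energy_const * (B k)\<^sup>2 * (real k + 1)\<^sup>2 * \<rho>) * (exp 2 * exp (- 2 * (real k + 1) * \<rho>))"
          using \<rho> energy_const_nonneg by (intro mult_left_mono) auto
        then have "\<rho> * (energy_const * (B k * ((real k + 1) * exp (- (real k * \<rho>))))\<^sup>2)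
          \<le> (energy_const * (B k)\<^sup>2 * exp 2 * (real k + 1)\<^sup>2) * (\<rho> * exp (- 2 * (real k + 1) * \<rho>))"
          by (simp only: power_mult_distrib) (simp only: mult_ac)
        then show "ennreal (\<rho> * (energy_const * (B k * ((real k + 1) * exp (- (real k * \<rho>))))\<^sup>2))
          \<le> ?E k * ?e k \<rho>"
          using True energy_const_nonneg by (simp add: ennreal_mult[symmetric] ennreal_leI)
      qed auto
      finally show ?thesis .
    qed auto
  qed
  also have "\<dots> = (\<Sum>k. ?E k *
      (\<integral>\<^sup>+\<rho>. ?e k \<rho> \<partial>lborel))"
    by (subst nn_integral_suminf) (auto simp: nn_integral_cmult)
  also have "\<dots> \<le> (\<Sum>k. ennreal (energy_const * exp 2 / 4 * (B k)\<^sup>2))"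
  proof (intro suminf_le allI)
    fix k
    have "?E k *
      (\<integral>\<^sup>+\<rho>. ?e k \<rho> \<partial>lborel)
      \<le> ?E k * ennreal (1 / (4 * (real k + 1)\<^sup>2))"
      by (intro mult_left_mono nn_integral_rho_exp_le) auto
    also have "\<dots> = ennreal (energy_const * exp 2 / 4 * (B k)\<^sup>2)"
    proof -
      have "real k + 1 \<noteq> 0" by simp
      then show ?thesis using energy_const_nonneg by (simp add: ennreal_mult[symmetric])
    qed
    finally show "?E k *
      (\<integral>\<^sup>+\<rho>. ?e k \<rho> \<partial>lborel) \<le> ennreal (energy_const * exp 2 / 4 * (B k)\<^sup>2)" .
  qed auto
  also have "\<dots> < \<infinity>"
    using energy_const_nonneg sq by (subst suminf_ennreal2) (auto intro!: summable_mult simp: B_def)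
  finally have "AE t in lborel. ennreal (exp (- \<bar>t\<bar>)) * W t \<noteq> \<infinity>"
    by (intro nn_integral_PInf_AE) auto
  then show ?thesis
  proof eventually_elim
    case (elim t)
    then have "W t \<noteq> \<infinity>" by (auto simp: ennreal_mult_eq_top_iff)
    then show ?case by (simp add: Weq less_top)
  qed
qed

text \<open>On \<open>(r / 2, r]\<close> the measure \<open>d\<rho> / \<rho>\<close> is bounded, so
  splitting \<open>norm D\<close> at \<open>\<delta> / \<rho>\<close> again replaces the
  Cauchy-Schwarz inequality. The first summand integrates to exactly
  \<open>\<delta>\<close>.\<close>

lemma norm_diff_le_square_function:
  assumes sq: "square_summable c" and \<sigma>: "r / 2 < \<sigma>" "\<sigma> \<le> r" "r > 0" and \<delta>: "\<delta> > 0"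
  shows "ennreal (norm (dirichlet_sum c (Complex r t) - dirichlet_sum c (Complex \<sigma> t)))
    \<le> ennreal \<delta> + ennreal (1 / \<delta>) * (\<integral>\<^sup>+\<rho>. ennreal (\<rho> * (norm (deriv (dirichlet_sum c) (Complex \<rho> t)))\<^sup>2) * indicator {r/2<..r} \<rho> \<partial>lborel)"
proof -
  define D where "D = (\<lambda>\<rho>. deriv (dirichlet_sum c) (Complex \<rho> t))"
  have pos: "\<rho> > 0" if "\<rho> \<in> {\<sigma>..r}" for \<rho> using that \<sigma> by auto
  have contD: "continuous_on {\<sigma>..r} D"
    unfolding D_def
    by (rule continuous_on_Complex[OF deriv_dirichlet_sum_holomorphic[OF sq]]) (use pos in \<open>auto intro!: continuous_intros\<close>)
  have int: "integrable lborel (\<lambda>\<rho>. indicator {\<sigma>..r} \<rho> *\<^sub>R D \<rho>)"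
    by (rule borel_integrable_compact) (use contD in auto)
  have "(LINT \<rho>|lborel. indicator {\<sigma>..r} \<rho> *\<^sub>R D \<rho>) = dirichlet_sum c (Complex r t) - dirichlet_sum c (Complex \<sigma> t)"
  proof (rule integral_FTC_Icc)
    fix x assume "\<sigma> \<le> x" "x \<le> r"
    then have "x > 0" using pos by auto
    then have "(dirichlet_sum c has_field_derivative D x) (at (Complex x t))"
      unfolding D_def by (intro dirichlet_sum_has_derivative(2)[OF summable_norm_dirichlet[OF sq]]) auto
    then have "(dirichlet_sum c has_field_derivative D x) (at (of_real x + \<i> * of_real t))"
      by (simp add: Complex_eq)
    then have "((\<lambda>z. dirichlet_sum c (z + \<i> * of_real t)) has_field_derivative D x) (at (of_real x))"
      by (simp add: DERIV_shift)
    then have "((\<lambda>x. dirichlet_sum c (of_real x + \<i> * of_real t)) has_vector_derivative D x) (at x within {\<sigma>..r})"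
      by (rule has_vector_derivative_real_field)
    then show "((\<lambda>x. dirichlet_sum c (Complex x t)) has_vector_derivative D x) (at x within {\<sigma>..r})"
      by (simp add: Complex_eq)
  qed (use \<sigma> contD in auto)
  moreover define D' where "D' = (\<lambda>\<rho>. indicator {\<sigma>..r} \<rho> *\<^sub>R D \<rho>)"
  ultimately have "ennreal (norm (dirichlet_sum c (Complex r t) - dirichlet_sum c (Complex \<sigma> t)))
      \<le> (\<integral>\<^sup>+\<rho>. ennreal (norm (D' \<rho>)) \<partial>lborel)"
    using integral_norm_bound_ennreal[OF int] by simp
  also have "\<dots> \<le> (\<integral>\<^sup>+\<rho>. ennreal (2 * \<delta> / r) * indicator {r/2<..r} \<rho>
      + ennreal (1 / \<delta>) * (ennreal (indicator {\<sigma>..r} \<rho> * (\<rho> * (norm (D' \<rho>))\<^sup>2))) \<partial>lborel)"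
  proof (rule nn_integral_mono)
    fix \<rho> :: real
    show "ennreal (norm (D' \<rho>)) \<le> ennreal (2 * \<delta> / r) * indicator {r/2<..r} \<rho>
      + ennreal (1 / \<delta>) * (ennreal (indicator {\<sigma>..r} \<rho> * (\<rho> * (norm (D' \<rho>))\<^sup>2)))"
    proof (cases "\<rho> \<in> {\<sigma>..r}")
      case True
      have \<rho>: "\<rho> > 0" "r / 2 < \<rho>" "\<rho> \<le> r" using True pos \<sigma> by auto
      have "norm (D \<rho>) \<le> \<delta> / \<rho> + \<rho> * (norm (D \<rho>))\<^sup>2 / \<delta>"
      proof (cases "\<rho> * norm (D \<rho>) \<le> \<delta>")
        case True
        then have "norm (D \<rho>) \<le> \<delta> / \<rho>" using \<rho> by (simp add: field_simps)
        then show ?thesis using \<delta> \<rho> by (simp add: add_increasing2)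
      next
        case False
        then have "\<delta> * norm (D \<rho>) \<le> (\<rho> * norm (D \<rho>)) * norm (D \<rho>)" by (intro mult_right_mono) auto
        then have "norm (D \<rho>) \<le> \<rho> * (norm (D \<rho>))\<^sup>2 / \<delta>" using \<delta> by (simp add: power2_eq_square field_simps)
        moreover have "0 \<le> \<delta> / \<rho>" using \<delta> \<rho> by simp
        ultimately show ?thesis by linarith
      qed
      also have "\<delta> / \<rho> \<le> 2 * \<delta> / r" using \<rho> \<delta> \<sigma> by (simp add: field_simps)
      finally have "norm (D \<rho>) \<le> 2 * \<delta> / r + 1 / \<delta> * (\<rho> * (norm (D \<rho>))\<^sup>2)" by simp
      then have "ennreal (norm (D \<rho>)) \<le> ennreal (2 * \<delta> / r + 1 / \<delta> * (\<rho> * (norm (D \<rho>))\<^sup>2))" by (rule ennreal_leI)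
      also have "\<dots> = ennreal (2 * \<delta> / r) + ennreal (1 / \<delta>) * ennreal (\<rho> * (norm (D \<rho>))\<^sup>2)"
        using \<delta> \<rho> \<sigma> by (subst ennreal_plus) (auto simp: ennreal_mult[symmetric])
      finally show ?thesis using True \<rho> by (simp add: D'_def)
    qed (simp add: D'_def)
  qed
  also have "\<dots> = ennreal (2 * \<delta> / r) * emeasure lborel {r/2<..r}
      + ennreal (1 / \<delta>) * (\<integral>\<^sup>+\<rho>. ennreal (indicator {\<sigma>..r} \<rho> * (\<rho> * (norm (D' \<rho>))\<^sup>2)) \<partial>lborel)"
  proof -
    have [measurable]: "D' \<in> borel_measurable borel"
      using borel_measurable_integrable[OF int] by (simp add: D'_def)
    show ?thesis by (subst nn_integral_add) (auto simp: nn_integral_cmult nn_integral_cmult_indicator)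
  qed
  also have "ennreal (2 * \<delta> / r) * emeasure lborel {r/2<..r} = ennreal \<delta>"
    using \<delta> \<sigma> by (simp add: ennreal_mult[symmetric])
  also have "(\<integral>\<^sup>+\<rho>. ennreal (indicator {\<sigma>..r} \<rho> * (\<rho> * (norm (D' \<rho>))\<^sup>2)) \<partial>lborel)
      \<le> (\<integral>\<^sup>+\<rho>. ennreal (\<rho> * (norm (deriv (dirichlet_sum c) (Complex \<rho> t)))\<^sup>2) * indicator {r/2<..r} \<rho> \<partial>lborel)"
    using \<sigma> by (intro nn_integral_mono) (auto simp: D'_def D_def indicator_def)
  finally show ?thesis by (simp add: add_left_mono mult_left_mono)
qed

text \<open>The values at \<open>\<sigma> = (1 / 2) ^ j\<close> converge because the interval
  averages do and the differences tend to 0. Between consecutive dyadic points the variation is at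
  most \<open>\<delta> + H j / \<delta>\<close>, where the \<open>H j\<close> are disjoint pieces of
  a finite square function and hence tend to 0.\<close>

lemma dirichlet_sum_boundary_limit_AE:
  assumes sq: "square_summable c" and l: "lacunary_limit c N g"
  shows "AE t in lborel. ((\<lambda>\<sigma>. dirichlet_sum c (Complex \<sigma> t)) \<longlongrightarrow> g t) (at_right 0)"
  using lebesgue_differentiation_dyadic[OF lacunary_limitD(4)[OF l indicator_exp_dominated]]
    dyadic_difference_AE[OF sq l] deriv_dirichlet_square_function_AE[OF sq]
proof eventually_elim
  case (elim t)
  define f where "f = (\<lambda>\<sigma>. dirichlet_sum c (Complex \<sigma> t))"
  define h where "h = (\<lambda>\<rho>. ennreal (\<rho> * (norm (deriv (dirichlet_sum c) (Complex \<rho> t)))\<^sup>2))"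
  define A where "A = (\<lambda>j::nat. {(1/2::real) ^ j / 2<..(1/2) ^ j})"
  have dy: "(\<lambda>j. f ((1 / 2) ^ j)) \<longlonglongrightarrow> g t"
    using tendsto_add[OF elim(1,2)] by (simp add: f_def)
  have posD: "continuous_on {0<..} (\<lambda>\<rho>. deriv (dirichlet_sum c) (Complex \<rho> t))"
    by (rule continuous_on_Complex[OF deriv_dirichlet_sum_holomorphic[OF sq]]) (auto intro!: continuous_intros)
  \<comment> \<open>A Borel version of \<open>h\<close>; the layers \<open>A j\<close> lie in
    \<open>\<rho> > 0\<close>, where the two agree.\<close>
  define h' where "h' = (\<lambda>\<rho>. ennreal (\<rho> * (norm (indicator {0<..} \<rho> *\<^sub>R deriv (dirichlet_sum c) (Complex \<rho> t)))\<^sup>2))"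
  have [measurable]: "(\<lambda>\<rho>. indicator {0<..} \<rho> *\<^sub>R deriv (dirichlet_sum c) (Complex \<rho> t)) \<in> borel_measurable borel"
    using posD by (intro borel_measurable_continuous_on_indicator) auto
  have [measurable]: "h' \<in> borel_measurable borel" unfolding h'_def by measurable
  have hh': "h \<rho> = h' \<rho>" if "\<rho> > 0" for \<rho> using that by (simp add: h_def h'_def)
  have Apos: "\<rho> > 0" "\<rho> \<le> 1" if "\<rho> \<in> A j" for \<rho> j
    using that less_trans[of 0 "(1/2::real) ^ j / 2" \<rho>] power_le_one[of "1/2::real" j] by (auto simp: A_def)
  have disj: "disjoint_family A"
    unfolding disjoint_family_on_def
  proof safe
    have False if "\<rho> \<in> A i" "\<rho> \<in> A j" "i < j" for \<rho> i j
    proof -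
      have "(1/2::real) ^ j \<le> (1/2) ^ Suc i" by (rule power_decreasing) (use that in auto)
      then show False using that by (simp add: A_def)
    qed
    then show "\<rho> \<in> {}" if "i \<noteq> j" "\<rho> \<in> A i" "\<rho> \<in> A j" for \<rho> i j
      using that by (metis linorder_neqE_nat)
  qed
  define H where "H = (\<lambda>j. \<integral>\<^sup>+\<rho>. h \<rho> * indicator (A j) \<rho> \<partial>lborel)"
  have HH': "H j = (\<integral>\<^sup>+\<rho>. h' \<rho> * indicator (A j) \<rho> \<partial>lborel)" for j
    unfolding H_def by (intro nn_integral_cong) (auto simp: indicator_def dest: Apos hh')
  have [measurable]: "A j \<in> sets borel" for j by (simp add: A_def)
  have "(\<Sum>j. H j) = (\<integral>\<^sup>+\<rho>. (\<Sum>j. h' \<rho> * indicator (A j) \<rho>) \<partial>lborel)"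
    unfolding HH' by (rule nn_integral_suminf[symmetric]) simp
  also have "\<dots> \<le> (\<integral>\<^sup>+\<rho>. h \<rho> * indicator {0<..1} \<rho> \<partial>lborel)"
  proof (rule nn_integral_mono)
    fix \<rho> :: real
    have "(\<Sum>j. h' \<rho> * indicator (A j) \<rho>) = h' \<rho> * indicator (\<Union>j. A j) \<rho>"
      using suminf_indicator[OF disj, of \<rho>] by (simp add: ennreal_suminf_cmult)
    also have "\<dots> \<le> h \<rho> * indicator {0<..1} \<rho>"
      by (auto simp: indicator_def dest: Apos hh')
    finally show "(\<Sum>j. h' \<rho> * indicator (A j) \<rho>) \<le> h \<rho> * indicator {0<..1} \<rho>" .
  qed
  also have "\<dots> < \<infinity>" using elim(3) by (simp add: h_def)
  finally have Hfin: "(\<Sum>j. H j) < \<infinity>" .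
  have Hj: "H j < \<infinity>" for j
    using le_less_trans[OF _ Hfin, of "H j"] sum_le_suminf[of H "{j}"] by simp
  define H' where "H' = (\<lambda>j. enn2real (H j))"
  have HH: "H j = ennreal (H' j)" for j using Hj by (simp add: H'_def)
  have H'0: "H' j \<ge> 0" for j by (simp add: H'_def)
  have "summable H'"
    using Hfin unfolding HH by (intro summable_suminf_not_top) (auto simp: H'_def)
  then have H0: "H' \<longlonglongrightarrow> 0" by (rule summable_LIMSEQ_zero)
  show ?case unfolding f_def[symmetric]
  proof (rule tendstoI)
    fix e :: real assume e: "e > 0"
    define \<delta> where "\<delta> = e / 4"
    have \<delta>: "\<delta> > 0" using e by (simp add: \<delta>_def)
    have "\<forall>\<^sub>F j in sequentially. dist (f ((1 / 2) ^ j)) (g t) < e / 2"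
      using dy e by (intro tendstoD) auto
    moreover have "\<forall>\<^sub>F j in sequentially. H' j < \<delta> * \<delta>"
      using H0 \<delta> by (intro order_tendstoD) auto
    ultimately have "\<forall>\<^sub>F j in sequentially. dist (f ((1 / 2) ^ j)) (g t) < e / 2 \<and> H' j < \<delta> * \<delta>" by eventually_elim auto
    then obtain J where J: "\<And>j. j \<ge> J \<Longrightarrow> dist (f ((1 / 2) ^ j)) (g t) < e / 2" "\<And>j. j \<ge> J \<Longrightarrow> H' j < \<delta> * \<delta>"
      by (auto simp: eventually_sequentially)
    have "dist (f \<sigma>) (g t) < e" if \<sigma>: "0 < \<sigma>" "\<sigma> < (1 / 2) ^ J" for \<sigma>
    proof -
      obtain n where n: "(1 / 2 :: real) ^ n < \<sigma>" using real_arch_pow_inv[of \<sigma> "1/2"] \<sigma> by auto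
      \<comment> \<open>Since \<open>m\<close> is least, \<open>\<sigma>\<close> lies in the layer
        \<open>A j\<close> with \<open>j = m - 1\<close>.\<close>
      define m where "m = (LEAST n. (1 / 2 :: real) ^ n < \<sigma>)"
      have m: "(1 / 2 :: real) ^ m < \<sigma>" unfolding m_def by (rule LeastI[of _ n]) (rule n)
      have "m > J"
      proof (rule ccontr)
        assume "\<not> m > J" then have "(1 / 2 :: real) ^ J \<le> (1 / 2) ^ m" by (intro power_decreasing) auto
        then show False using m \<sigma> by linarith
      qed
      then obtain j where j: "m = Suc j" "j \<ge> J" by (cases m) auto
      have "\<not> (1 / 2 :: real) ^ j < \<sigma>" using not_less_Least[of j "\<lambda>n. (1 / 2 :: real) ^ n < \<sigma>"] j by (simp add: m_def)
      then have \<sigma>j: "(1/2) ^ j / 2 < \<sigma>" "\<sigma> \<le> (1/2) ^ j" using m j by auto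
      have "ennreal (norm (f ((1/2) ^ j) - f \<sigma>)) \<le> ennreal \<delta> + ennreal (1 / \<delta>) * H j"
        using norm_diff_le_square_function[OF sq \<sigma>j _ \<delta>, of t] by (simp add: f_def H_def h_def A_def)
      also have "\<dots> = ennreal (\<delta> + 1 / \<delta> * H' j)"
        using \<delta> H'0 by (simp add: HH ennreal_mult[symmetric])
      finally have "norm (f ((1/2) ^ j) - f \<sigma>) \<le> \<delta> + 1 / \<delta> * H' j"
        using \<delta> H'0 by (subst (asm) ennreal_le_iff) auto
      also have "1 / \<delta> * H' j \<le> 1 / \<delta> * (\<delta> * \<delta>)"
        using \<delta> J(2)[OF j(2)] by (intro mult_left_mono) auto
      finally have "dist (f ((1/2) ^ j)) (f \<sigma>) \<le> e / 2" using \<delta> by (simp add: dist_norm \<delta>_def)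
      then show ?thesis using J(1)[OF j(2)] dist_triangle[of "f \<sigma>" "g t" "f ((1/2) ^ j)"] by (simp add: dist_commute)
    qed
    then show "\<forall>\<^sub>F \<sigma> in at_right 0. dist (f \<sigma>) (g t) < e"
      unfolding eventually_at_right_field by (intro exI[of _ "(1/2) ^ J"]) auto
  qed
qed

section \<open>Sufficiency of the block condition\<close>

lemma ex_limit_at_right_iff:
  fixes h :: "real \<Rightarrow> complex"
  shows "(\<exists>l. (h \<longlongrightarrow> l) (at_right 0)) \<longleftrightarrow>
    (\<forall>n. \<exists>m. \<forall>p q. 0 < p \<and> p < 1 / real (Suc m) \<and> 0 < q \<and> q < 1 / real (Suc m) \<longrightarrow> dist (h p) (h q) \<le> 1 / real (Suc n))"
    (is "?L \<longleftrightarrow> ?R")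
proof
  assume ?L
  then obtain l where l: "(h \<longlongrightarrow> l) (at_right 0)" by blast
  show ?R
  proof
    fix n
    have "\<forall>\<^sub>F \<sigma> in at_right 0. dist (h \<sigma>) l < 1 / real (Suc n) / 2"
      using l by (rule tendstoD) simp
    then obtain b where b: "b > 0" "\<And>\<sigma>. 0 < \<sigma> \<Longrightarrow> \<sigma> < b \<Longrightarrow> dist (h \<sigma>) l < 1 / real (Suc n) / 2"
      unfolding eventually_at_right_field by auto
    obtain m where m: "1 / real (Suc m) < b" using b(1) nat_approx_posE by metis
    have "dist (h p) (h q) \<le> 1 / real (Suc n)" if "0 < p" "p < 1 / real (Suc m)" "0 < q" "q < 1 / real (Suc m)" for p q
      using b(2)[of p] b(2)[of q] that m dist_triangle2[of "h p" "h q" l] by linarith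
    then show "\<exists>m. \<forall>p q. 0 < p \<and> p < 1 / real (Suc m) \<and> 0 < q \<and> q < 1 / real (Suc m) \<longrightarrow> dist (h p) (h q) \<le> 1 / real (Suc n)"
      by blast
  qed
next
  assume R: ?R
  define s where "s = (\<lambda>k. h (1 / real (Suc (Suc k))))"
  have "Cauchy s"
  proof (rule metric_CauchyI)
    fix e :: real assume "e > 0"
    then obtain n where n: "1 / real (Suc n) < e" using nat_approx_posE by metis
    obtain m where m: "\<And>p q. 0 < p \<and> p < 1 / real (Suc m) \<and> 0 < q \<and> q < 1 / real (Suc m) \<Longrightarrow> dist (h p) (h q) \<le> 1 / real (Suc n)"
      using R by blast
    have "dist (s i) (s j) < e" if "i \<ge> m" "j \<ge> m" for i j
    proof -
      have "dist (s i) (s j) \<le> 1 / real (Suc n)"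
        unfolding s_def by (rule m) (use that in \<open>auto simp: field_simps\<close>)
      then show ?thesis using n by linarith
    qed
    then show "\<exists>M. \<forall>m\<ge>M. \<forall>n\<ge>M. dist (s m) (s n) < e" by blast
  qed
  then obtain l where l: "s \<longlonglongrightarrow> l" by (auto simp: Cauchy_convergent_iff convergent_def)
  have "(h \<longlongrightarrow> l) (at_right 0)"
  proof (rule tendstoI)
    fix e :: real assume "e > 0"
    then obtain n where n: "1 / real (Suc n) < e" using nat_approx_posE by metis
    obtain m where m: "\<And>p q. 0 < p \<and> p < 1 / real (Suc m) \<and> 0 < q \<and> q < 1 / real (Suc m) \<Longrightarrow> dist (h p) (h q) \<le> 1 / real (Suc n)"
      using R by blast
    have "dist (h p) l < e" if "0 < p" "p < 1 / real (Suc m)" for p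
    proof -
      have "dist (h p) l \<le> 1 / real (Suc n)"
      proof (rule LIMSEQ_le_const2[OF tendsto_dist[OF tendsto_const l]], intro exI[of _ m] allI impI)
        fix k assume "k \<ge> m"
        then show "dist (h p) (s k) \<le> 1 / real (Suc n)"
          unfolding s_def using that by (intro m) (auto simp: field_simps)
      qed
      then show ?thesis using n by linarith
    qed
    then show "\<forall>\<^sub>F p in at_right 0. dist (h p) l < e"
      unfolding eventually_at_right_field by (intro exI[of _ "1 / real (Suc m)"]) auto
  qed
  then show ?L by blast
qed

lemma boundary_value_measurable:
  assumes f: "f holomorphic_on right_half_plane"
  shows "boundary_value f \<in> borel_measurable borel"
proof -
  have cont: "continuous_on UNIV (\<lambda>t. f (Complex \<sigma> t))" if "\<sigma> > 0" for \<sigma>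
    by (rule continuous_on_Complex[OF f]) (use that in \<open>auto intro!: continuous_intros\<close>)
  define C where "C = {t. \<exists>l. ((\<lambda>\<sigma>. f (Complex \<sigma> t)) \<longlongrightarrow> l) (at_right 0)}"
  define K where "K = (\<lambda>n m. {t. \<forall>p q. 0 < p \<and> p < 1 / real (Suc m) \<and> 0 < q \<and> q < 1 / real (Suc m) \<longrightarrow>
     dist (f (Complex p t)) (f (Complex q t)) \<le> 1 / real (Suc n)})"
  have "closed (K n m)" for n m
  proof -
    \<comment> \<open>The weak inequality in the Cauchy criterion makes each set closed, so the
      uncountable intersection over \<open>p\<close> and \<open>q\<close> stays Borel.\<close>
    have "K n m = (\<Inter>p\<in>{0<..<1 / real (Suc m)}. \<Inter>q\<in>{0<..<1 / real (Suc m)}.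
        {t. dist (f (Complex p t)) (f (Complex q t)) \<le> 1 / real (Suc n)})"
      by (auto simp: K_def)
    also have "closed \<dots>"
      by (intro closed_INT ballI closed_Collect_le continuous_on_dist cont continuous_on_const) auto
    finally show ?thesis .
  qed
  then have [measurable]: "K n m \<in> sets borel" for n m by (rule borel_closed)
  have "C = (\<Inter>n. \<Union>m. K n m)"
    unfolding C_def ex_limit_at_right_iff K_def by auto
  then have [measurable]: "C \<in> sets borel" by simp
  \<comment> \<open>Where no limit exists, the predicate under the definite description in
    \<open>Lim\<close> is constantly false; the value is then this one constant for every
    \<open>t\<close>.\<close>
  define c0 where "c0 = (THE l::complex. False)"
  have eq: "boundary_value f t = (if t \<in> C then lim (\<lambda>k. f (Complex (1 / real (Suc k)) t)) else c0)" for t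
  proof (cases "t \<in> C")
    case True
    then obtain l where l: "((\<lambda>\<sigma>. f (Complex \<sigma> t)) \<longlongrightarrow> l) (at_right 0)" by (auto simp: C_def)
    have "filterlim (\<lambda>k. 1 / real (Suc k)) (at_right 0) sequentially"
      unfolding filterlim_at using LIMSEQ_inverse_real_of_nat by (auto simp: inverse_eq_divide)
    then have "(\<lambda>k. f (Complex (1 / real (Suc k)) t)) \<longlonglongrightarrow> l" using l by (rule filterlim_compose[rotated])
    then have "lim (\<lambda>k. f (Complex (1 / real (Suc k)) t)) = l" by (rule limI)
    moreover have "boundary_value f t = l" unfolding boundary_value_def by (rule tendsto_Lim[OF _ l]) simp
    ultimately show ?thesis using True by simp
  next
    case False
    then have "(\<lambda>l. ((\<lambda>\<sigma>. f (Complex \<sigma> t)) \<longlongrightarrow> l) (at_right 0)) = (\<lambda>l. False)" by (auto simp: C_def)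
    then show ?thesis using False unfolding boundary_value_def Topological_Spaces.Lim_def c0_def by simp
  qed
  have [measurable]: "(\<lambda>t. f (Complex (1 / real (Suc k)) t)) \<in> borel_measurable borel" for k
    by (intro borel_measurable_continuous_onI cont) simp
  have "(\<lambda>t. if t \<in> C then lim (\<lambda>k. f (Complex (1 / real (Suc k)) t)) else c0) \<in> borel_measurable borel"
    by (intro measurable_If_set borel_measurable_lim_metric) (simp_all del: of_nat_Suc)
  then show ?thesis by (simp add: eq[abs_def])
qed

lemma boundary_value_cong:
  assumes "\<And>s. Re s > 0 \<Longrightarrow> f s = g s"
  shows "boundary_value f = boundary_value g"
proof
  fix t
  have "((\<lambda>\<sigma>. f (Complex \<sigma> t)) \<longlongrightarrow> l) (at_right 0) \<longleftrightarrow> ((\<lambda>\<sigma>. g (Complex \<sigma> t)) \<longlongrightarrow> l) (at_right 0)" for l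
    by (intro filterlim_cong refl) (use assms eventually_at_right_less[of 0] in \<open>auto elim!: eventually_mono\<close>)
  then show "boundary_value f t = boundary_value g t" unfolding boundary_value_def Topological_Spaces.Lim_def by simp
qed

text \<open>The limit \<open>g\<close> of the partial sums agrees almost everywhere with the
  horizontal limit. From here on the boundary function itself takes the place of
  \<open>g\<close>.\<close>

lemma boundary_value_dirichlet_sum:
  assumes sq: "square_summable c"
  obtains N where "lacunary_limit c N (boundary_value (dirichlet_sum c))"
proof -
  define u where "u = boundary_value (dirichlet_sum c)"
  obtain N g where l: "lacunary_limit c N g" using lacunary_partial_sums_converge[OF sq] by blast
  note [measurable] = lacunary_limitD(2)[OF l]
  have um [measurable]: "u \<in> borel_measurable borel"
    unfolding u_def by (intro boundary_value_measurable dirichlet_sum_holomorphic summable_norm_dirichlet[OF sq])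
  have eq: "AE t in lborel. u t = g t"
    using dirichlet_sum_boundary_limit_AE[OF sq l] by eventually_elim (simp add: u_def boundary_value_def tendsto_Lim)
  have "lacunary_limit c N u"
    unfolding lacunary_limit_def
  proof (intro conjI allI impI um lacunary_limitD(1)[OF l])
    show "AE t in lborel. (\<lambda>j. partial_sum c (N j) t) \<longlonglongrightarrow> u t"
      using lacunary_limitD(3)[OF l] eq by eventually_elim simp
    fix w D x assume w: "exp_dominated w D x"
    note [measurable] = exp_dominatedD(1)[OF w]
    have eq': "AE t in lborel. w t *\<^sub>R u t = w t *\<^sub>R g t" using eq by eventually_elim simp
    show "integrable lborel (\<lambda>t. w t *\<^sub>R u t)"
      using lacunary_limitD(4)[OF l w] integrable_cong_AE[OF _ _ eq'] by simp
    show "(\<lambda>j. LINT t|lborel. w t *\<^sub>R partial_sum c (N j) t) \<longlonglongrightarrow> (LINT t|lborel. w t *\<^sub>R u t)"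
      using lacunary_limitD(5)[OF l w] integral_cong_AE[OF _ _ eq'] by simp
  qed
  then show ?thesis using that by (simp add: u_def)
qed

text \<open>Blocks start at index 1, and the coefficient \<open>c 1\<close>, which is \<open>a\<^sub>2\<close>, is bounded separately.\<close>

definition block_bound :: "(nat \<Rightarrow> complex) \<Rightarrow> real \<Rightarrow> bool" where
  "block_bound c M \<longleftrightarrow> 0 < M \<and> norm (c 1) \<le> M \<and>
    (\<forall>L\<ge>1. summable (\<lambda>k. (block_mass c L (Suc k))\<^sup>2) \<and> (\<Sum>k. (block_mass c L (Suc k))\<^sup>2) \<le> M\<^sup>2)"

text \<open>Since \<open>e <= 3\<close>, block 0 at scale 1 contains just the indices 0 and 1. Index
  0 is the constant term, so a bound for \<open>c 1\<close> covers what the blocks of index at least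
  1 miss.\<close>

lemma freq_less_one: "freq n < 1 \<Longrightarrow> n \<le> 1"
proof -
  assume "freq n < 1"
  then have "exp (freq n) < exp 1" by simp
  then have "real (Suc n) < exp 1" by (simp add: freq_def)
  then show "n \<le> 1" using exp_le by linarith
qed

lemma block_mass_one_le:
  assumes M: "block_bound c M" and "y \<ge> 1"
  shows "block_mass c y 1 \<le> M"
proof (rule power2_le_imp_le)
  have "(block_mass c y (Suc 0))\<^sup>2 \<le> (\<Sum>k. (block_mass c y (Suc k))\<^sup>2)"
    using sum_le_suminf[of "\<lambda>k. (block_mass c y (Suc k))\<^sup>2" "{0}"] assms by (auto simp: block_bound_def)
  also have "\<dots> \<le> M\<^sup>2" using assms by (auto simp: block_bound_def)
  finally show "(block_mass c y 1)\<^sup>2 \<le> M\<^sup>2" by simp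
qed (use M in \<open>auto simp: block_bound_def\<close>)

text \<open>Dyadic descent: the frequencies in \<open>[x / 2, x)\<close> contribute at most
  \<open>2 * M * x\<close>, and summing over \<open>x\<close>, \<open>x / 2\<close>,
  \<open>x / 4\<close> and so on gives \<open>4 * M * x\<close>. The descent stops at
  \<open>x <= 1\<close>, where index 1 alone can have a positive frequency.\<close>

lemma low_frequency_le:
  assumes M: "block_bound c M" and "x > 0"
  shows "(\<Sum>n | freq n < x. norm (c n) * freq n) \<le> 4 * x * M"
proof -
  have M0: "M > 0" and c1: "norm (c 1) \<le> M" using M by (auto simp: block_bound_def)
  have "0 < x \<Longrightarrow> x \<le> 2 ^ p \<Longrightarrow> (\<Sum>n | freq n < x. norm (c n) * freq n) \<le> 4 * x * M" for p x
  proof (induction p arbitrary: x)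
    case 0
    have sub: "{n. freq n < x} \<subseteq> {0, 1}"
    proof
      fix n assume "n \<in> {n. freq n < x}"
      then have "freq n < 1" using 0 by simp
      then show "n \<in> {0, 1}" using freq_less_one[of n] by auto
    qed
    have "(\<Sum>n | freq n < x. norm (c n) * freq n) = (\<Sum>n\<in>{0, 1}. if freq n < x then norm (c n) * freq n else 0)"
      by (rule sum.mono_neutral_cong_left) (use sub in auto)
    also have "\<dots> = (if freq 1 < x then norm (c 1) * freq 1 else 0)" by simp
    also have "\<dots> \<le> M * x"
    proof (cases "freq 1 < x")
      case True
      then have "norm (c 1) * freq 1 \<le> M * x" using M0 by (intro mult_mono c1 less_imp_le[OF True]) auto
      then show ?thesis using True by simp
    qed (use M0 0 in simp)
    also have "\<dots> \<le> 4 * x * M" using M0 0 by simp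
    finally show ?case .
  next
    case (Suc p)
    show ?case
    proof (cases "x \<le> 1")
      case True
      then have "x \<le> 2 ^ p" using one_le_power[of "2::real" p] by linarith
      then show ?thesis using Suc by blast
    next
      case False
      define H where "H = {n. x / 2 \<le> freq n \<and> freq n < x}"
      \<comment> \<open>\<open>H\<close> lies in block 1 at scale \<open>x / 2\<close>, but scales
        below 1 are not covered by \<open>block_bound\<close>. For \<open>x < 2\<close> the scale 1
        is taken instead, and the only member of \<open>H\<close> that can lie below frequency 1 is
        the index 1.\<close>
      define y where "y = max 1 (x / 2)"
      have finH: "finite H" unfolding H_def by (rule finite_subset[OF _ finite_freq_less[of x]]) auto
      have "{n. freq n < x} = {n. freq n < x / 2} \<union> H" using False by (auto simp: H_def)
      then have "(\<Sum>n | freq n < x. norm (c n) * freq n) = (\<Sum>n | freq n < x / 2. norm (c n) * freq n) + (\<Sum>n\<in>H. norm (c n) * freq n)"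
        by (simp only:) (rule sum.union_disjoint, use finH in \<open>auto simp del: less_divide_eq_numeral1 simp: H_def\<close>)
      also have "(\<Sum>n | freq n < x / 2. norm (c n) * freq n) \<le> 4 * (x / 2) * M"
        using Suc False by (intro Suc.IH) auto
      also have "(\<Sum>n\<in>H. norm (c n) * freq n) \<le> (\<Sum>n\<in>H. norm (c n) * x)"
        by (intro sum_mono mult_left_mono) (auto simp: H_def)
      also have "\<dots> = (\<Sum>n\<in>H. norm (c n)) * x" by (simp add: sum_distrib_right)
      finally have le: "(\<Sum>n | freq n < x. norm (c n) * freq n) \<le> 4 * (x / 2) * M + (\<Sum>n\<in>H. norm (c n)) * x"
        by simp
      have "(\<Sum>n\<in>H. norm (c n)) \<le> 2 * M"
      proof -
        have "H \<subseteq> insert 1 {n. nat \<lfloor>freq n / y\<rfloor> = 1}"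
        proof
          fix n assume n: "n \<in> H"
          show "n \<in> insert 1 {n. nat \<lfloor>freq n / y\<rfloor> = 1}"
          proof (cases "freq n < 1")
            case True
            have "n \<noteq> 0"
            proof
              assume "n = 0"
              with n False show False by (simp add: H_def)
            qed
            then show ?thesis using freq_less_one[OF True] by simp
          next
            case F: False
            have "y \<le> freq n" "freq n < 2 * y" using n F by (auto simp: H_def y_def)
            then have "1 \<le> freq n / y" "freq n / y < 2" by (auto simp: y_def field_simps)
            then have "\<lfloor>freq n / y\<rfloor> = 1" by linarith
            then show ?thesis by simp
          qed
        qed
        then have "(\<Sum>n\<in>H. norm (c n)) \<le> (\<Sum>n\<in>insert 1 {n. nat \<lfloor>freq n / y\<rfloor> = 1}. norm (c n))"
          by (intro sum_mono2) (auto simp: y_def)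
        also have "\<dots> \<le> norm (c 1) + block_mass c y 1"
          unfolding block_mass_def by (subst sum.insert_if) (auto simp: y_def)
        also have "\<dots> \<le> 2 * M" using c1 block_mass_one_le[OF M, of y] by (simp add: y_def)
        finally show ?thesis .
      qed
      then have "(\<Sum>n\<in>H. norm (c n)) * x \<le> 2 * M * x" using False by (intro mult_right_mono) auto
      with le show ?thesis by (simp add: algebra_simps)
    qed
  qed
  moreover obtain p where "x < 2 ^ p" using real_arch_pow[of 2 x] by auto
  ultimately show ?thesis using \<open>x > 0\<close> by (meson less_imp_le)
qed

lemma block_bound_summable:
  assumes "block_bound c M"
  shows "square_summable c"
  using assms summable_Suc_iff[of "\<lambda>k. (block_mass c 1 k)\<^sup>2"] by (auto simp: block_bound_def)

text \<open>The outer 2 pays for the passage to the mean. Inside, \<open>exp 1\<close> compares an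
  indicator with the kernel, \<open>2 + 2 * energy_const\<close> comes from
  \<open>weighted_L1_le_L2\<close> with \<open>\<delta> = M\<close>, and 4 from
  \<open>low_frequency_le\<close>.\<close>

definition bmo_const :: real where
  "bmo_const = 2 * (exp 1 * (2 + 2 * energy_const) + 4)"

lemma bmo_const_nonneg: "bmo_const \<ge> 0"
  using energy_const_nonneg by (simp add: bmo_const_def add_nonneg_nonneg)

lemma norm_cis_diff_le: "norm (cis x - cis y) \<le> \<bar>x - y\<bar>"
proof -
  have "norm (cis x - cis y) = norm (cis y) * norm (cis (x - y) - 1)"
    unfolding norm_mult[symmetric] right_diff_distrib by (simp add: cis_mult)
  also have "norm (cis (x - y) - 1) = norm (exp (\<i> * of_real (x - y)) - 1)" by (simp add: cis_conv_exp)
  also have "\<dots> \<le> \<bar>x - y\<bar>"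
  proof -
    have "norm (exp (\<i> * of_real (x - y)) - (\<Sum>i\<le>0. (\<i> * of_real (x - y)) ^ i / fact i))
       \<le> exp \<bar>Re (\<i> * of_real (x - y))\<bar> * norm (\<i> * of_real (x - y)) ^ Suc 0 / fact 0"
      by (rule Taylor_exp)
    then show ?thesis by (simp add: norm_mult del: of_real_diff)
  qed
  finally show ?thesis by simp
qed

lemma boundary_oscillation_le:
  assumes M: "block_bound c M" and ab: "a < b"
    and l: "lacunary_limit c N u"
  obtains \<kappa> where "(\<integral>\<^sup>+t. ennreal (indicator {a..b} t * norm (u t - \<kappa>)) \<partial>lborel) \<le> ennreal (bmo_const / 2 * M * (b - a))"
proof -
  note sm = lacunary_limitD(1)[OF l] and [measurable] = lacunary_limitD(2)[OF l] and lim = lacunary_limitD(3)[OF l]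
  define T where "T = b - a"
  \<comment> \<open>The scale has to be at least \<open>1 / T\<close> for the kernel bound and at
    least 1 for \<open>block_bound\<close>. With this choice the frequencies from
    \<open>1 / T\<close> on miss block 0, except possibly for index 1 when \<open>L = 1\<close>;
    \<open>bb 0 = M\<close> accounts for it.\<close>
  define L where "L = max 1 (1 / T)"
  have T: "T > 0" using ab by (simp add: T_def)
  have TL: "T * L \<ge> 1" using T by (auto simp: L_def max_def field_simps)
  have L1: "L \<ge> 1" by (simp add: L_def)
  have M0: "M > 0" and c1: "norm (c 1) \<le> M" using M by (auto simp: block_bound_def)
  define low where "low = {n. freq n < 1 / T}"
  have fin: "finite low" by (simp add: low_def)
  define lowf where "lowf = (\<lambda>t. \<Sum>n\<in>low. c n * cis (- freq n * t))"
  have [measurable]: "lowf \<in> borel_measurable borel" unfolding lowf_def by measurable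
  define bb where "bb = (\<lambda>k. if k = 0 then M else block_mass c L k)"
  have sSuc: "summable (\<lambda>k. (bb (Suc k))\<^sup>2)" and leSuc: "(\<Sum>k. (bb (Suc k))\<^sup>2) \<le> M\<^sup>2"
    using M L1 by (auto simp: bb_def block_bound_def)
  then have sb: "summable (\<lambda>k. (bb k)\<^sup>2)" using summable_Suc_iff[of "\<lambda>k. (bb k)\<^sup>2"] by simp
  have bb2: "(\<Sum>k. (bb k)\<^sup>2) \<le> 2 * M\<^sup>2"
    using suminf_split_head[OF sb] leSuc by (simp add: bb_def)
  define F where "F = (\<lambda>j. {n. freq n < real (N j) \<and> n \<notin> low})"
  have "(\<integral>\<^sup>+t. ennreal (exp (- \<bar>t - a\<bar> / T) * (norm (u t - lowf t))\<^sup>2) \<partial>lborel) \<le> ennreal (energy_const * T * (\<Sum>k. (bb k)\<^sup>2))"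
  proof (rule trig_limit_energy_le[where L = L and F = F and \<alpha> = "\<lambda>j. c" and l = freq])
    show "finite (F j)" for j unfolding F_def by (rule finite_subset[OF _ finite_freq_less]) auto
    show "AE t in lborel. (\<lambda>j. \<Sum>n\<in>F j. c n * cis (- freq n * t)) \<longlonglongrightarrow> u t - lowf t"
      using lim
    proof eventually_elim
      case (elim t)
      obtain J :: nat where J: "1 / T < real J" using reals_Archimedean2 by blast
      have ev: "partial_sum c (N j) t - lowf t = (\<Sum>n\<in>F j. c n * cis (- freq n * t))" if "j \<ge> J" for j
      proof -
        have "real J \<le> real (N j)" using that seq_suble[OF sm, of j] by simp
        then have "low \<subseteq> {n. freq n < real (N j)}" using J by (auto simp: low_def)
        moreover have "F j = {n. freq n < real (N j)} - low" by (auto simp: F_def)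
        ultimately show ?thesis by (simp add: partial_sum_def lowf_def sum_diff)
      qed
      have "(\<lambda>j. partial_sum c (N j) t - lowf t) \<longlonglongrightarrow> u t - lowf t"
        by (intro tendsto_diff elim tendsto_const)
      then show ?case
        by (rule Lim_transform_eventually) (use ev in \<open>auto simp: eventually_sequentially\<close>)
    qed
    fix j k
    show "(\<Sum>n\<in>{n\<in>F j. nat \<lfloor>freq n / L\<rfloor> = k}. norm (c n)) \<le> bb k"
    proof (cases "k = 0")
      case False
      then show ?thesis using sum_block_subset_le[of L "F j" c c k] L1 by (simp add: bb_def)
    next
      case True
      have "{n\<in>F j. nat \<lfloor>freq n / L\<rfloor> = k} \<subseteq> {1}"
      proof
        fix n assume n: "n \<in> {n\<in>F j. nat \<lfloor>freq n / L\<rfloor> = k}"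
        then have "\<lfloor>freq n / L\<rfloor> \<le> 0" using True by simp
        then have "freq n / L < 1" by linarith
        then have 1: "freq n < L" using L1 by simp
        have 2: "1 / T \<le> freq n" using n by (auto simp: F_def low_def)
        then have "L = 1" using 1 by (auto simp: L_def max_def split: if_splits)
        then have "n \<le> 1" using 1 freq_less_one by simp
        moreover have "n \<noteq> 0"
        proof
          assume "n = 0"
          with 2 have "1 / T \<le> 0" by simp
          with T show False by simp
        qed
        ultimately show "n \<in> {1}" by simp
      qed
      then have "(\<Sum>n\<in>{n\<in>F j. nat \<lfloor>freq n / L\<rfloor> = k}. norm (c n)) \<le> (\<Sum>n\<in>{1}. norm (c n))"
        by (intro sum_mono2) auto
      then show ?thesis using c1 True by (simp add: bb_def)
    qed
  qed (use T L1 TL sb in auto)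
  also have "\<dots> \<le> ennreal (energy_const * T * (2 * M\<^sup>2))"
    using bb2 energy_const_nonneg T by (intro ennreal_leI mult_left_mono) auto
  finally have high: "(\<integral>\<^sup>+t. ennreal (exp (- \<bar>t - a\<bar> / T) * (norm (u t - lowf t))\<^sup>2) \<partial>lborel) \<le> ennreal (energy_const * T * (2 * M\<^sup>2))" .
  have ind: "indicator {a..b} t \<le> exp 1 * exp (- \<bar>t - a\<bar> / T)" for t :: real
    using indicator_le_exp_kernel[of a b a T T t] T by (simp add: T_def)
  have H1: "(\<integral>\<^sup>+t. ennreal (indicator {a..b} t * norm (u t - lowf t)) \<partial>lborel)
     \<le> ennreal (exp 1 * (M * (2 * T) + energy_const * T * (2 * M\<^sup>2) / M))"
    by (rule weighted_L1_le_L2[OF _ _ _ ind T high]) (use energy_const_nonneg T M0 in auto)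
  have H1': "exp 1 * (M * (2 * T) + energy_const * T * (2 * M\<^sup>2) / M) = exp 1 * (2 + 2 * energy_const) * M * T"
    using M0 by (simp add: power2_eq_square algebra_simps)
  define \<kappa> where "\<kappa> = lowf a"
  have lowle: "norm (lowf t - \<kappa>) \<le> 4 * M" if t: "t \<in> {a..b}" for t
  proof -
    have "norm (lowf t - \<kappa>) = norm (\<Sum>n\<in>low. c n * (cis (- freq n * t) - cis (- freq n * a)))"
      by (simp add: lowf_def \<kappa>_def sum_subtractf right_diff_distrib)
    also have "\<dots> \<le> (\<Sum>n\<in>low. norm (c n) * freq n * T)"
    proof (rule sum_norm_le)
      fix n
      have "norm (cis (- freq n * t) - cis (- freq n * a)) \<le> \<bar>- freq n * t - - freq n * a\<bar>" by (rule norm_cis_diff_le)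
      also have "- freq n * t - - freq n * a = - (freq n * (t - a))" by (simp add: algebra_simps)
      also have "\<bar>- (freq n * (t - a))\<bar> = freq n * (t - a)" using t by simp
      also have "\<dots> \<le> freq n * T" using t by (intro mult_left_mono) (auto simp: T_def)
      finally show "norm (c n * (cis (- freq n * t) - cis (- freq n * a))) \<le> norm (c n) * freq n * T"
        unfolding norm_mult mult.assoc by (intro mult_left_mono) auto
    qed
    also have "\<dots> = (\<Sum>n\<in>low. norm (c n) * freq n) * T" by (simp add: sum_distrib_right)
    also have "\<dots> \<le> (4 * (1 / T) * M) * T"
      unfolding low_def using T by (intro mult_right_mono low_frequency_le[OF M]) auto
    finally show ?thesis using T by simp
  qed
  have "(\<integral>\<^sup>+t. ennreal (indicator {a..b} t * norm (u t - \<kappa>)) \<partial>lborel)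
      \<le> (\<integral>\<^sup>+t. ennreal (indicator {a..b} t * norm (u t - lowf t)) + ennreal (4 * M) * indicator {a..b} t \<partial>lborel)"
  proof (rule nn_integral_mono)
    fix t
    have "norm (u t - \<kappa>) \<le> norm (u t - lowf t) + norm (lowf t - \<kappa>)"
      using norm_triangle_ineq[of "u t - lowf t" "lowf t - \<kappa>"] by simp
    then show "ennreal (indicator {a..b} t * norm (u t - \<kappa>)) \<le> ennreal (indicator {a..b} t * norm (u t - lowf t)) + ennreal (4 * M) * indicator {a..b} t"
      using lowle[of t] M0 by (auto simp: indicator_def ennreal_plus[symmetric] intro!: ennreal_leI simp del: ennreal_plus)
  qed
  also have "\<dots> = (\<integral>\<^sup>+t. ennreal (indicator {a..b} t * norm (u t - lowf t)) \<partial>lborel) + ennreal (4 * M) * emeasure lborel {a..b}"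
    by (subst nn_integral_add) (auto simp: nn_integral_cmult_indicator)
  also have "\<dots> \<le> ennreal (exp 1 * (2 + 2 * energy_const) * M * T) + ennreal (4 * M) * ennreal T"
    using H1 unfolding H1' using ab by (intro add_mono) (auto simp: T_def)
  also have "\<dots> = ennreal (bmo_const / 2 * M * (b - a))"
  proof -
    have "ennreal X + ennreal (4 * M) * ennreal T = ennreal (X + 4 * M * T)" if "X \<ge> 0" for X
      using that M0 T by (simp add: ennreal_mult)
    note this[of "exp 1 * (2 + 2 * energy_const) * M * T"]
    moreover have "0 \<le> exp 1 * (2 + 2 * energy_const) * M * T" using M0 T energy_const_nonneg by simp
    moreover have "exp 1 * (2 + 2 * energy_const) * M * T + 4 * M * T = bmo_const / 2 * M * (b - a)"
      by (simp add: bmo_const_def T_def algebra_simps)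
    ultimately show ?thesis
      by (simp only:)
  qed
  finally show ?thesis by (rule that)
qed

abbreviation oscillation :: "(real \<Rightarrow> complex) \<Rightarrow> real \<Rightarrow> real \<Rightarrow> ennreal" where
  "oscillation u a b \<equiv> \<integral>\<^sup>+t\<in>{a..b}. ennreal (norm (u t - interval_mean u a b)) \<partial>lborel"

text \<open>Any constant \<open>\<kappa>\<close> does as well as the mean up to a factor 2, because
  the mean itself differs from \<open>\<kappa>\<close> by at most \<open>X\<close>.\<close>

lemma mean_oscillation_le:
  fixes u :: "real \<Rightarrow> complex"
  assumes ab: "a < b" and int: "integrable lborel (\<lambda>t. indicator {a..b} t *\<^sub>R u t)" and X: "X \<ge> 0"
    and le: "(\<integral>\<^sup>+t. ennreal (indicator {a..b} t * norm (u t - \<kappa>)) \<partial>lborel) \<le> ennreal (X * (b - a))"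
  shows "oscillation u a b \<le> ennreal (2 * X * (b - a))"
proof -
  have i1: "integrable lborel (\<lambda>t. indicator {a..b} t *\<^sub>R \<kappa>)"
    by (intro integrable_scaleR_left integrable_real_indicator) (auto simp: emeasure_lborel_Icc_eq)
  have int': "integrable lborel (\<lambda>t. indicator {a..b} t *\<^sub>R (u t - \<kappa>))"
    using Bochner_Integration.integrable_diff[OF int i1] by (simp add: scaleR_diff_right)
  have "(LINT t|lborel. indicator {a..b} t *\<^sub>R (u t - \<kappa>)) = (LINT t|lborel. indicator {a..b} t *\<^sub>R u t) - (LINT t|lborel. indicator {a..b} t *\<^sub>R \<kappa>)"
    unfolding scaleR_diff_right by (rule Bochner_Integration.integral_diff[OF int i1])
  also have "(LINT t|lborel. indicator {a..b} t *\<^sub>R \<kappa>) = of_real (b - a) * \<kappa>"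
    using ab by (simp add: scaleR_conv_of_real)
  also have "(LINT t|lborel. indicator {a..b} t *\<^sub>R u t) = of_real (b - a) * interval_mean u a b"
    using ab by (simp add: interval_mean_def set_lebesgue_integral_def)
  finally have "(LINT t|lborel. indicator {a..b} t *\<^sub>R (u t - \<kappa>)) = of_real (b - a) * (interval_mean u a b - \<kappa>)"
    by (simp only: right_diff_distrib)
  then have "ennreal ((b - a) * norm (interval_mean u a b - \<kappa>)) \<le> (\<integral>\<^sup>+t. ennreal (norm (indicator {a..b} t *\<^sub>R (u t - \<kappa>))) \<partial>lborel)"
    using integral_norm_bound_ennreal[OF int'] ab by (simp add: norm_mult del: of_real_diff)
  also have "\<dots> \<le> ennreal (X * (b - a))" using le by simp
  finally have m: "norm (interval_mean u a b - \<kappa>) \<le> X"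
    using ab X by (subst (asm) ennreal_le_iff) auto
  have [measurable]: "(\<lambda>t. indicator {a..b} t * norm (u t - \<kappa>)) \<in> borel_measurable borel"
    using measurable_compose[OF borel_measurable_integrable[OF int'] borel_measurable_norm] by simp
  have "oscillation u a b
     \<le> (\<integral>\<^sup>+t. ennreal (indicator {a..b} t * norm (u t - \<kappa>)) + ennreal X * indicator {a..b} t \<partial>lborel)"
  proof (rule nn_integral_mono)
    fix t
    have "norm (u t - interval_mean u a b) \<le> norm (u t - \<kappa>) + norm (interval_mean u a b - \<kappa>)"
      using norm_triangle_ineq4[of "u t - \<kappa>" "interval_mean u a b - \<kappa>"] by simp
    then show "ennreal (norm (u t - interval_mean u a b)) * indicator {a..b} t \<le> ennreal (indicator {a..b} t * norm (u t - \<kappa>)) + ennreal X * indicator {a..b} t"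
      using m X by (auto simp: indicator_def ennreal_plus[symmetric] intro!: ennreal_leI simp del: ennreal_plus)
  qed
  also have "\<dots> = (\<integral>\<^sup>+t. ennreal (indicator {a..b} t * norm (u t - \<kappa>)) \<partial>lborel) + ennreal X * emeasure lborel {a..b}"
    by (subst nn_integral_add) (auto simp: nn_integral_cmult_indicator)
  also have "\<dots> \<le> ennreal (X * (b - a)) + ennreal X * ennreal (b - a)"
    using le ab by (intro add_mono) auto
  also have "\<dots> = ennreal (2 * X * (b - a))"
    using X ab by (simp add: ennreal_mult[symmetric] ennreal_plus[symmetric] del: ennreal_plus)
  finally show ?thesis .
qed

section \<open>The square integral on vertical lines\<close>

lemma one_plus_square_kernel_le:
  fixes t :: real
  shows "1 / (1 + t\<^sup>2) \<le> exp 1 * (1 / (1 + (real (nat \<lfloor>\<bar>t\<bar>\<rfloor>))\<^sup>2)) * (exp (- \<bar>t - real (nat \<lfloor>\<bar>t\<bar>\<rfloor>)\<bar>) + exp (- \<bar>t + real (nat \<lfloor>\<bar>t\<bar>\<rfloor>)\<bar>))"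
proof -
  define m where "m = real (nat \<lfloor>\<bar>t\<bar>\<rfloor>)"
  have m: "0 \<le> m" "m \<le> \<bar>t\<bar>" "\<bar>t\<bar> < m + 1" by (auto simp: m_def of_nat_nat)
  have "m\<^sup>2 \<le> t\<^sup>2" using m by (metis power2_abs power_mono)
  moreover have "0 < 1 + t\<^sup>2" "0 < 1 + m\<^sup>2" by (auto intro: add_pos_nonneg)
  ultimately have 1: "1 / (1 + t\<^sup>2) \<le> 1 / (1 + m\<^sup>2)" by (intro divide_left_mono mult_pos_pos) auto
  have "\<bar>t - m\<bar> \<le> 1 \<or> \<bar>t + m\<bar> \<le> 1" using m by linarith
  then have "exp (- 1) \<le> exp (- \<bar>t - m\<bar>) \<or> exp (- 1) \<le> exp (- \<bar>t + m\<bar>)" by auto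
  then have "exp (- 1) \<le> exp (- \<bar>t - m\<bar>) + exp (- \<bar>t + m\<bar>)"
    by (auto intro: add_increasing add_increasing2)
  then have "exp 1 * exp (- 1) \<le> exp 1 * (exp (- \<bar>t - m\<bar>) + exp (- \<bar>t + m\<bar>))" by (intro mult_left_mono) auto
  then have 2: "1 \<le> exp 1 * (exp (- \<bar>t - m\<bar>) + exp (- \<bar>t + m\<bar>))" by (simp add: exp_add[symmetric])
  have "1 / (1 + t\<^sup>2) \<le> 1 / (1 + m\<^sup>2) * 1" using 1 by simp
  also have "\<dots> \<le> 1 / (1 + m\<^sup>2) * (exp 1 * (exp (- \<bar>t - m\<bar>) + exp (- \<bar>t + m\<bar>)))"
    by (intro mult_left_mono 2) (auto intro: add_nonneg_nonneg)
  finally show ?thesis unfolding m_def[symmetric] by (simp add: mult_ac)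
qed

text \<open>The damping factors \<open>exp (- freq n * \<sigma>)\<close> are at most 1, so the block
  masses of \<open>c\<close> bound all vertical lines alike.\<close>

lemma dirichlet_sum_energy_le:
  assumes sq: "square_summable c" and \<sigma>: "\<sigma> > 0"
  shows "(\<integral>\<^sup>+t. ennreal (exp (- \<bar>t - x\<bar>) * (norm (dirichlet_sum c (Complex \<sigma> t)))\<^sup>2) \<partial>lborel)
    \<le> ennreal (energy_const * (\<Sum>k. (block_mass c 1 k)\<^sup>2))"
proof -
  have "(\<integral>\<^sup>+t. ennreal (exp (- \<bar>t - x\<bar> / 1) * (norm (dirichlet_sum c (Complex \<sigma> t)))\<^sup>2) \<partial>lborel)
    \<le> ennreal (energy_const * 1 * (\<Sum>k. (block_mass c 1 k)\<^sup>2))"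
  proof (rule trig_limit_energy_le[where L = 1 and F = "\<lambda>j. {..<j}" and \<alpha> = "\<lambda>j n. c n * of_real (exp (- freq n * \<sigma>))" and l = freq])
    show "AE t in lborel. (\<lambda>j. \<Sum>n<j. c n * of_real (exp (- freq n * \<sigma>)) * cis (- freq n * t)) \<longlonglongrightarrow> dirichlet_sum c (Complex \<sigma> t)"
      using dirichlet_sum_has_derivative(1)[OF summable_norm_dirichlet[OF sq], of "Complex \<sigma> t" for t] \<sigma>
      unfolding exp_freq_Complex sums_def by (simp add: mult.assoc)
    show "(\<Sum>n\<in>{n\<in>{..<j}. nat \<lfloor>freq n / 1\<rfloor> = k}. norm (c n * of_real (exp (- freq n * \<sigma>)))) \<le> block_mass c 1 k" for j k
      by (rule sum_block_subset_le) (use \<sigma> in \<open>auto simp: norm_mult intro!: mult_left_le\<close>)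
  qed (use sq in auto)
  then show ?thesis by simp
qed

text \<open>The weight \<open>1 / (1 + t\<^sup>2)\<close> is dominated by kernels of width 1 centred
  at \<open>m\<close> and \<open>- m\<close>, with coefficients of order
  \<open>1 / (1 + m\<^sup>2)\<close>. Uniformity of the energy bound in the centre then gives a
  bound independent of \<open>\<sigma>\<close>.\<close>

lemma dirichlet_sum_square_integrable:
  assumes sq: "square_summable c" and \<sigma>: "\<sigma> > 0"
  shows "(\<integral>\<^sup>+t. ennreal ((norm (dirichlet_sum c (Complex \<sigma> t)))\<^sup>2 / (1 + \<sigma>\<^sup>2 + t\<^sup>2)) \<partial>lborel)
    \<le> ennreal (2 * exp 1 * energy_const * (\<Sum>k. (block_mass c 1 k)\<^sup>2) * schur_bound)"
proof -
  define f where "f = (\<lambda>t. dirichlet_sum c (Complex \<sigma> t))"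
  define S where "S = (\<Sum>k. (block_mass c 1 k)\<^sup>2)"
  have S0: "S \<ge> 0" unfolding S_def by (intro suminf_nonneg sq) auto
  have "continuous_on UNIV f" unfolding f_def
    by (rule continuous_on_Complex[OF dirichlet_sum_holomorphic[OF summable_norm_dirichlet[OF sq]]])
       (use \<sigma> in \<open>auto intro!: continuous_intros\<close>)
  then have [measurable]: "f \<in> borel_measurable borel" by (rule borel_measurable_continuous_onI)
  define K where "K = (\<lambda>m t. exp (- \<bar>t - real m\<bar>) + exp (- \<bar>t + real m\<bar>))"
  have "(\<integral>\<^sup>+t. ennreal ((norm (f t))\<^sup>2 / (1 + \<sigma>\<^sup>2 + t\<^sup>2)) \<partial>lborel)
    \<le> (\<integral>\<^sup>+t. (\<Sum>m. ennreal (exp 1 * (1 / (1 + (real m)\<^sup>2))) * ennreal (K m t * (norm (f t))\<^sup>2)) \<partial>lborel)"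
  proof (rule nn_integral_mono)
    fix t :: real
    define m where "m = nat \<lfloor>\<bar>t\<bar>\<rfloor>"
    have "(norm (f t))\<^sup>2 / (1 + \<sigma>\<^sup>2 + t\<^sup>2) \<le> (norm (f t))\<^sup>2 / (1 + t\<^sup>2)"
      by (intro divide_left_mono) (auto intro!: mult_pos_pos add_pos_nonneg)
    also have "\<dots> = 1 / (1 + t\<^sup>2) * (norm (f t))\<^sup>2" by simp
    also have "\<dots> \<le> (exp 1 * (1 / (1 + (real m)\<^sup>2)) * K m t) * (norm (f t))\<^sup>2"
      unfolding K_def m_def by (intro mult_right_mono one_plus_square_kernel_le) auto
    finally have "ennreal ((norm (f t))\<^sup>2 / (1 + \<sigma>\<^sup>2 + t\<^sup>2)) \<le> ennreal (exp 1 * (1 / (1 + (real m)\<^sup>2))) * ennreal (K m t * (norm (f t))\<^sup>2)"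
      by (subst ennreal_mult[symmetric]) (auto simp: K_def mult.assoc intro!: ennreal_leI add_nonneg_nonneg)
    also have "\<dots> \<le> (\<Sum>m. ennreal (exp 1 * (1 / (1 + (real m)\<^sup>2))) * ennreal (K m t * (norm (f t))\<^sup>2))"
      using sum_le_suminf[of "\<lambda>m. ennreal (exp 1 * (1 / (1 + (real m)\<^sup>2))) * ennreal (K m t * (norm (f t))\<^sup>2)" "{m}"] by simp
    finally show "ennreal ((norm (f t))\<^sup>2 / (1 + \<sigma>\<^sup>2 + t\<^sup>2)) \<le> (\<Sum>m. ennreal (exp 1 * (1 / (1 + (real m)\<^sup>2))) * ennreal (K m t * (norm (f t))\<^sup>2))" .
  qed
  also have "\<dots> = (\<Sum>m. ennreal (exp 1 * (1 / (1 + (real m)\<^sup>2))) * (\<integral>\<^sup>+t. ennreal (K m t * (norm (f t))\<^sup>2) \<partial>lborel))"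
    by (subst nn_integral_suminf) (auto simp: nn_integral_cmult K_def)
  also have "\<dots> \<le> (\<Sum>m. ennreal (2 * exp 1 * energy_const * S * (1 / (1 + (real m)\<^sup>2))))"
  proof (intro suminf_le allI)
    fix m
    have "(\<integral>\<^sup>+t. ennreal (K m t * (norm (f t))\<^sup>2) \<partial>lborel)
      = (\<integral>\<^sup>+t. ennreal (exp (- \<bar>t - real m\<bar>) * (norm (f t))\<^sup>2) + ennreal (exp (- \<bar>t - (- real m)\<bar>) * (norm (f t))\<^sup>2) \<partial>lborel)"
      by (intro nn_integral_cong) (simp add: K_def distrib_right)
    also have "\<dots> = (\<integral>\<^sup>+t. ennreal (exp (- \<bar>t - real m\<bar>) * (norm (f t))\<^sup>2) \<partial>lborel) + (\<integral>\<^sup>+t. ennreal (exp (- \<bar>t - (- real m)\<bar>) * (norm (f t))\<^sup>2) \<partial>lborel)"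
      by (rule nn_integral_add) auto
    also have "\<dots> \<le> ennreal (energy_const * S) + ennreal (energy_const * S)"
      unfolding f_def S_def by (intro add_mono dirichlet_sum_energy_le[OF sq \<sigma>])
    also have "\<dots> = ennreal (2 * energy_const * S)"
      using energy_const_nonneg S0 by (simp add: ennreal_plus[symmetric] del: ennreal_plus)
    finally have "ennreal (exp 1 * (1 / (1 + (real m)\<^sup>2))) * (\<integral>\<^sup>+t. ennreal (K m t * (norm (f t))\<^sup>2) \<partial>lborel)
       \<le> ennreal (exp 1 * (1 / (1 + (real m)\<^sup>2))) * ennreal (2 * energy_const * S)"
      by (intro mult_left_mono) auto
    also have "\<dots> = ennreal (2 * exp 1 * energy_const * S * (1 / (1 + (real m)\<^sup>2)))"
      using energy_const_nonneg S0 by (subst ennreal_mult[symmetric]) (auto simp: mult_ac intro!: divide_nonneg_pos add_pos_nonneg)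
    finally show "ennreal (exp 1 * (1 / (1 + (real m)\<^sup>2))) * (\<integral>\<^sup>+t. ennreal (K m t * (norm (f t))\<^sup>2) \<partial>lborel)
       \<le> ennreal (2 * exp 1 * energy_const * S * (1 / (1 + (real m)\<^sup>2)))" .
  qed auto
  also have "\<dots> = ennreal (2 * exp 1 * energy_const * S * schur_bound)"
  proof -
    have "summable (\<lambda>m. 2 * exp 1 * energy_const * S * (1 / (1 + (real m)\<^sup>2)))"
      by (intro summable_mult summable_inverse_one_plus_square)
    then show ?thesis
      using energy_const_nonneg S0 summable_inverse_one_plus_square unfolding schur_bound_def
      by (subst suminf_ennreal2) (auto simp: suminf_mult[symmetric] intro!: divide_nonneg_pos add_pos_nonneg mult_nonneg_nonneg)
  qed
  finally show ?thesis by (simp add: f_def S_def)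
qed

lemma block_bound_imp_BMOA:
  assumes M: "block_bound c M" and f: "\<And>s. Re s > 0 \<Longrightarrow> f s = dirichlet_sum c s"
  shows "f \<in> BMOA" and "BMO_enorm (boundary_value f) \<le> ennreal (bmo_const * M)"
proof -
  have sq: "square_summable c" by (rule block_bound_summable[OF M])
  have M0: "M > 0" using M by (auto simp: block_bound_def)
  define u where "u = boundary_value (dirichlet_sum c)"
  have fu: "boundary_value f = u" unfolding u_def by (rule boundary_value_cong) (rule f)
  have osc: "oscillation u a b \<le> ennreal (bmo_const * M * (b - a))" if ab: "a < b" for a b
  proof -
    obtain N where l: "lacunary_limit c N u" using boundary_value_dirichlet_sum[OF sq] unfolding u_def by blast
    obtain \<kappa> where "(\<integral>\<^sup>+t. ennreal (indicator {a..b} t * norm (u t - \<kappa>)) \<partial>lborel) \<le> ennreal (bmo_const / 2 * M * (b - a))"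
      using boundary_oscillation_le[OF M ab l] by blast
    from mean_oscillation_le[OF ab lacunary_limitD(4)[OF l indicator_exp_dominated] _ this]
    show ?thesis using bmo_const_nonneg M0 by simp
  qed
  have "BMO_enorm u \<le> ennreal (bmo_const * M)"
    unfolding BMO_enorm_def
  proof (rule SUP_least)
    fix x :: "real \<times> real" assume "x \<in> {(a, b). a < b}"
    then obtain a b where x: "x = (a, b)" "a < b" by auto
    have "oscillation u a b / ennreal (b - a)
        \<le> ennreal (bmo_const * M * (b - a)) / ennreal (b - a)"
      by (intro divide_right_mono_ennreal osc x)
    also have "\<dots> = ennreal (bmo_const * M)" using x bmo_const_nonneg M0 by (simp add: divide_ennreal)
    finally show "(case x of (a, b) \<Rightarrow> oscillation u a b / ennreal (b - a)) \<le> ennreal (bmo_const * M)"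
      using x by simp
  qed
  then show le: "BMO_enorm (boundary_value f) \<le> ennreal (bmo_const * M)" by (simp add: fu)
  have "f holomorphic_on right_half_plane"
    by (rule holomorphic_transform[OF dirichlet_sum_holomorphic[OF summable_norm_dirichlet[OF sq]]]) (use f in auto)
  moreover have "(SUP \<sigma> \<in> {0<..}. \<integral>\<^sup>+ t. ennreal ((cmod (f (Complex \<sigma> t)))\<^sup>2 / (1 + \<sigma>\<^sup>2 + t\<^sup>2)) \<partial>lborel)
      \<le> ennreal (2 * exp 1 * energy_const * (\<Sum>k. (block_mass c 1 k)\<^sup>2) * schur_bound)"
    by (rule SUP_least) (use dirichlet_sum_square_integrable[OF sq] f in simp)
  ultimately show "f \<in> BMOA" unfolding BMOA_def
    using le by (auto intro: le_less_trans)
qed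

section \<open>Nonnegative coefficients\<close>

lemma higher_deriv_exp_sum:
  "(deriv ^^ m) (\<lambda>s. \<Sum>n<N. c n * exp (- (of_real (freq n) * s)))
    = (\<lambda>s. \<Sum>n<N. c n * (- of_real (freq n)) ^ m * exp (- (of_real (freq n) * s)))"
proof (induction m)
  case (Suc m)
  have "deriv (\<lambda>s. \<Sum>n<N. c n * (- of_real (freq n)) ^ m * exp (- (of_real (freq n) * s))) s
      = (\<Sum>n<N. c n * (- of_real (freq n)) ^ Suc m * exp (- (of_real (freq n) * s)))" for s
    by (rule DERIV_imp_deriv) (auto intro!: derivative_eq_intros sum.cong simp: algebra_simps)
  with Suc show ?case by auto
qed simp

text \<open>Landau's theorem: the Taylor coefficients at a point of convergence dominate those of every partial
  sum, so the Taylor expansion, which converges up to the imaginary axis, dominates the Dirichlet series.\<close>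

lemma landau_summable:
  fixes \<alpha> :: "nat \<Rightarrow> real"
  assumes \<alpha>: "\<And>n. \<alpha> n \<ge> 0" and f: "f holomorphic_on right_half_plane"
    and sums: "\<And>s. Re s > \<sigma>\<^sub>0 \<Longrightarrow> (\<lambda>n. of_real (\<alpha> n) * exp (- (of_real (freq n) * s))) sums f s"
    and \<sigma>: "\<sigma> > 0"
  shows "summable (\<lambda>n. \<alpha> n * exp (- freq n * \<sigma>))"
proof -
  have big: "summable (\<lambda>n. \<alpha> n * exp (- freq n * x))" if "x > \<sigma>\<^sub>0" for x
  proof -
    have "summable (\<lambda>n. of_real (\<alpha> n) * exp (- (of_real (freq n) * of_real x)) :: complex)"
      using sums[of "of_real x"] that by (auto simp: sums_iff)
    then have "summable (\<lambda>n. of_real (\<alpha> n * exp (- freq n * x)) :: complex)"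
      by (simp add: exp_of_real[symmetric])
    then show ?thesis by (simp only: summable_complex_of_real)
  qed
  \<comment> \<open>The room beyond \<open>\<sigma>\<^sub>0\<close> keeps a ball of radius
    \<open>1 / 2\<close> inside the region of convergence, where uniform convergence passes to all
    derivatives.\<close>
  define x0 where "x0 = max \<sigma>\<^sub>0 0 + max \<sigma> 0 + 1"
  have x0: "x0 > \<sigma>\<^sub>0 + 1 / 2" "x0 > \<sigma>" "x0 > 0" using \<sigma> by (auto simp: x0_def)
  define z where "z = complex_of_real x0"
  define D where "D = (\<lambda>m. (deriv ^^ m) f z)"
  have D: "(\<Sum>n<N. \<alpha> n * freq n ^ m * exp (- freq n * x0)) \<le> norm (D m)" for N m
  proof -
    have "uniform_limit (ball z (1/2)) (\<lambda>N s. \<Sum>n<N. of_real (\<alpha> n) * exp (- (of_real (freq n) * s))) (\<lambda>s. \<Sum>n. of_real (\<alpha> n) * exp (- (of_real (freq n) * s))) sequentially"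
    proof (rule Weierstrass_m_test)
      show "summable (\<lambda>n. \<alpha> n * exp (- freq n * (x0 - 1/2)))" using x0 by (intro big) simp
      fix n s assume s: "s \<in> ball z (1/2)"
      have "\<bar>Re s - x0\<bar> < 1 / 2"
        using s abs_Re_le_cmod[of "s - z"] by (simp add: z_def dist_norm norm_minus_commute)
      then have "x0 - 1/2 \<le> Re s" by linarith
      then have "freq n * (x0 - 1/2) \<le> freq n * Re s" by (intro mult_left_mono) auto
      then show "norm (of_real (\<alpha> n) * exp (- (of_real (freq n) * s))) \<le> \<alpha> n * exp (- freq n * (x0 - 1/2))"
        unfolding norm_mult norm_exp_freq using \<alpha>[of n] by (auto intro!: mult_left_mono)
    qed
    moreover have "(\<Sum>n. of_real (\<alpha> n) * exp (- (of_real (freq n) * s))) = f s" if "s \<in> ball z (1/2)" for s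
    proof -
      have "\<bar>Re s - x0\<bar> < 1 / 2"
        using that abs_Re_le_cmod[of "s - z"] by (simp add: z_def dist_norm norm_minus_commute)
      then have "Re s > \<sigma>\<^sub>0" using x0 by linarith
      then show ?thesis using sums[of s] by (simp add: sums_iff)
    qed
    ultimately have "uniform_limit (ball z (1/2)) (\<lambda>N s. \<Sum>n<N. of_real (\<alpha> n) * exp (- (of_real (freq n) * s))) f sequentially"
      by (rule uniform_limit_cong'[OF refl, THEN iffD1, rotated])
    then have "(\<lambda>N. (deriv ^^ m) (\<lambda>s. \<Sum>n<N. of_real (\<alpha> n) * exp (- (of_real (freq n) * s))) z) \<longlonglongrightarrow> D m"
      unfolding D_def by (rule higher_deriv_complex_uniform_limit) (auto intro!: always_eventually holomorphic_intros)
    then have "(\<lambda>N. norm (\<Sum>n<N. of_real (\<alpha> n) * (- of_real (freq n)) ^ m * exp (- (of_real (freq n) * z)) :: complex)) \<longlonglongrightarrow> norm (D m)"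
      unfolding higher_deriv_exp_sum by (rule tendsto_norm)
    moreover have "norm (\<Sum>n<N. of_real (\<alpha> n) * (- of_real (freq n)) ^ m * exp (- (of_real (freq n) * z)) :: complex)
        = (\<Sum>n<N. \<alpha> n * freq n ^ m * exp (- freq n * x0))" for N
    proof -
      \<comment> \<open>At the real point \<open>z\<close> all terms of the derivative of order
        \<open>m\<close> carry the common sign \<open>(-1) ^ m\<close>, so nothing cancels in the
        norm.\<close>
      have "(\<Sum>n<N. of_real (\<alpha> n) * (- of_real (freq n)) ^ m * exp (- (of_real (freq n) * z)) :: complex)
          = (-1) ^ m * of_real (\<Sum>n<N. \<alpha> n * freq n ^ m * exp (- freq n * x0))"
        unfolding of_real_sum sum_distrib_left
        by (intro sum.cong refl) (simp add: z_def exp_of_real[symmetric] power_minus[of "complex_of_real _"] mult_ac)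
      moreover have "(\<Sum>n<N. \<alpha> n * freq n ^ m * exp (- freq n * x0)) \<ge> 0" using \<alpha> by (intro sum_nonneg) auto
      ultimately show ?thesis by (simp add: norm_mult norm_power del: of_real_sum)
    qed
    ultimately have lim: "(\<lambda>N. \<Sum>n<N. \<alpha> n * freq n ^ m * exp (- freq n * x0)) \<longlonglongrightarrow> norm (D m)" by simp
    show ?thesis
      by (rule incseq_le[OF _ lim]) (use \<alpha> in \<open>auto intro!: incseq_SucI\<close>)
  qed
  have ball: "ball z x0 \<subseteq> right_half_plane"
  proof
    fix s assume "s \<in> ball z x0"
    then have "\<bar>Re s - x0\<bar> < x0" using abs_Re_le_cmod[of "s - z"] by (simp add: z_def dist_norm norm_minus_commute)
    then show "s \<in> right_half_plane" by auto
  qed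
  \<comment> \<open>The expansion converges at \<open>z + \<rho>'\<close>, hence absolutely at the
    smaller radius \<open>\<rho>\<close>, and \<open>x0 - \<rho> = \<sigma>\<close>.\<close>
  define \<rho> where "\<rho> = x0 - \<sigma>"
  define \<rho>' where "\<rho>' = x0 - \<sigma> / 2"
  have \<rho>: "0 < \<rho>" "\<rho> < \<rho>'" "\<rho>' < x0" using x0 \<sigma> by (auto simp: \<rho>_def \<rho>'_def)
  have "(\<lambda>m. (deriv ^^ m) f z / fact m * ((z + of_real \<rho>') - z) ^ m) sums f (z + of_real \<rho>')"
    by (rule holomorphic_power_series[where r = x0]) (use f ball \<rho> in \<open>auto intro: holomorphic_on_subset simp: dist_norm\<close>)
  then have "summable (\<lambda>m. D m / fact m * of_real \<rho>' ^ m)" by (auto simp: D_def sums_iff)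
  then have sD: "summable (\<lambda>m. norm (D m / fact m * of_real \<rho> ^ m))"
    by (rule powser_insidea) (use \<rho> in auto)
  show ?thesis
  proof (rule summableI_nonneg_bounded)
    fix N
    \<comment> \<open>Expanding \<open>exp (freq n * \<rho>)\<close> moves the evaluation from
      \<open>x0\<close> back to \<open>\<sigma>\<close>, term by term dominated by the Taylor series
      of \<open>f\<close>.\<close>
    have exps: "(\<lambda>m. \<alpha> n * exp (- freq n * x0) * ((freq n * \<rho>) ^ m / fact m)) sums (\<alpha> n * exp (- freq n * x0) * exp (freq n * \<rho>))" for n
      using exp_converges[of "freq n * \<rho>"] by (intro sums_mult) (simp add: divide_inverse mult.commute)
    have "(\<lambda>m. \<Sum>n<N. \<alpha> n * exp (- freq n * x0) * ((freq n * \<rho>) ^ m / fact m)) sums (\<Sum>n<N. \<alpha> n * exp (- freq n * x0) * exp (freq n * \<rho>))"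
      by (rule sums_sum) (rule exps)
    then have "(\<Sum>n<N. \<alpha> n * exp (- freq n * x0) * exp (freq n * \<rho>)) \<le> (\<Sum>m. norm (D m / fact m * of_real \<rho> ^ m))"
    proof (rule sums_le[OF _ _ summable_sums[OF sD], rotated])
      fix m
      have "(\<Sum>n<N. \<alpha> n * exp (- freq n * x0) * ((freq n * \<rho>) ^ m / fact m)) = (\<Sum>n<N. \<alpha> n * freq n ^ m * exp (- freq n * x0)) * (\<rho> ^ m / fact m)"
        unfolding sum_distrib_right by (intro sum.cong refl) (simp add: power_mult_distrib)
      also have "\<dots> \<le> norm (D m) * (\<rho> ^ m / fact m)" using \<rho> by (intro mult_right_mono D) auto
      also have "\<dots> = norm (D m / fact m * of_real \<rho> ^ m)" using \<rho> by (simp add: norm_mult norm_divide norm_power)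
      finally show "(\<Sum>n<N. \<alpha> n * exp (- freq n * x0) * ((freq n * \<rho>) ^ m / fact m)) \<le> norm (D m / fact m * of_real \<rho> ^ m)" .
    qed
    moreover have "exp (- freq n * x0) * exp (freq n * \<rho>) = exp (- freq n * \<sigma>)" for n
      by (simp add: exp_add[symmetric] \<rho>_def algebra_simps)
    ultimately show "(\<Sum>n<N. \<alpha> n * exp (- freq n * \<sigma>)) \<le> (\<Sum>m. norm (D m / fact m * of_real \<rho> ^ m))"
      by (simp add: mult.assoc)
  qed (use \<alpha> in auto)
qed

lemma extension_eq_dirichlet_sum:
  assumes abs: "\<And>\<sigma>. \<sigma> > 0 \<Longrightarrow> summable (\<lambda>n. norm (c n) * exp (- freq n * \<sigma>))"
    and f: "f holomorphic_on right_half_plane"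
    and sums: "\<And>s. Re s > \<sigma>\<^sub>0 \<Longrightarrow> (\<lambda>n. c n * exp (- (of_real (freq n) * s))) sums f s"
    and s: "Re s > 0"
  shows "f s = dirichlet_sum c s"
proof (rule analytic_continuation_open[where s = "{s. Re s > max \<sigma>\<^sub>0 0}" and s' = right_half_plane and f = f and g = "dirichlet_sum c"])
  show "dirichlet_sum c holomorphic_on right_half_plane" by (rule dirichlet_sum_holomorphic[OF abs])
  show "{s. Re s > max \<sigma>\<^sub>0 0} \<noteq> {}"
    by (auto intro: exI[of _ "of_real (max \<sigma>\<^sub>0 0 + 1)"])
  show "connected right_half_plane" by (intro convex_connected convex_halfspace_Re_gt)
  show "f z = dirichlet_sum c z" if "z \<in> {s. Re s > max \<sigma>\<^sub>0 0}" for z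
    using sums[of z] that by (simp add: dirichlet_sum_def sums_iff)
qed (use f s in \<open>auto intro!: open_Collect_conj open_halfspace_Re_gt\<close>)

text \<open>Blocks of length \<open>1 / T\<close>, tuned to the kernel of width \<open>T\<close>.
  Block 0 is left out as in the lower energy bound, and \<open>F\<close> is finite; infinite block
  sums are reached by exhaustion.\<close>

definition block_squares :: "real \<Rightarrow> nat set \<Rightarrow> (nat \<Rightarrow> real) \<Rightarrow> real" where
  "block_squares T F \<beta> = (\<Sum>k\<in>(\<lambda>n. nat \<lfloor>freq n * T\<rfloor>) ` F - {0}. (\<Sum>n\<in>{n\<in>F. nat \<lfloor>freq n * T\<rfloor> = k}. \<beta> n)\<^sup>2)"

lemma block_squares_mono:
  assumes "F \<subseteq> F'" "finite F'" "\<And>n. \<beta> n \<ge> 0"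
  shows "block_squares T F \<beta> \<le> block_squares T F' \<beta>"
proof -
  have "block_squares T F \<beta> \<le> (\<Sum>k\<in>(\<lambda>n. nat \<lfloor>freq n * T\<rfloor>) ` F - {0}. (\<Sum>n\<in>{n\<in>F'. nat \<lfloor>freq n * T\<rfloor> = k}. \<beta> n)\<^sup>2)"
    unfolding block_squares_def using assms by (intro sum_mono power_mono sum_mono2 sum_nonneg) auto
  also have "\<dots> \<le> block_squares T F' \<beta>" unfolding block_squares_def using assms by (intro sum_mono2) auto
  finally show ?thesis .
qed

text \<open>Serves two regularisations, the smoothing by narrow kernels and the shift into the
  half-plane; their parameter tends to 0 along \<open>1 / (j + 1)\<close>.\<close>

lemma block_squares_le_limit:
  assumes lim: "\<And>n. (\<lambda>j. \<beta> (inverse (real (Suc j))) n) \<longlonglongrightarrow> \<alpha> n"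
    and le: "\<And>r. 0 < r \<Longrightarrow> r \<le> 1 \<Longrightarrow> block_squares T F (\<beta> r) \<le> X"
  shows "block_squares T F \<alpha> \<le> X"
proof (rule LIMSEQ_le_const2)
  show "(\<lambda>j. block_squares T F (\<beta> (inverse (real (Suc j))))) \<longlonglongrightarrow> block_squares T F \<alpha>"
    unfolding block_squares_def by (intro tendsto_intros lim)
  show "\<exists>J. \<forall>j\<ge>J. block_squares T F (\<beta> (inverse (real (Suc j)))) \<le> X"
    by (intro exI allI impI le) (auto simp: inverse_le_1_iff)
qed

text \<open>The lower energy bound speaks of finite sums. Truncation at \<open>M\<close> changes
  \<open>h\<close> by at most \<open>\<epsilon> M\<close>, uniformly in \<open>t\<close>; squaring
  the triangle inequality doubles the constant, and the error vanishes as \<open>M\<close>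
  grows.\<close>

lemma block_squares_le_energy:
  fixes \<beta> :: "nat \<Rightarrow> real" and h :: "real \<Rightarrow> complex"
  assumes \<beta>: "\<And>n. \<beta> n \<ge> 0" "summable \<beta>" and h: "\<And>t. (\<lambda>n. of_real (\<beta> n) * cis (- freq n * t)) sums h t"
    and T: "T > 0" and X: "X \<ge> 0" "(\<integral>\<^sup>+t. ennreal (exp (- \<bar>t\<bar> / T) * (norm (h t - \<kappa>))\<^sup>2) \<partial>lborel) \<le> ennreal X"
    and F: "finite F" "0 \<notin> F"
  shows "block_squares T F \<beta> \<le> 4 / T * X"
proof -
  define \<epsilon> where "\<epsilon> = (\<lambda>M. suminf \<beta> - (\<Sum>n<M. \<beta> n))"
  have \<epsilon>0: "\<epsilon> M \<ge> 0" for M unfolding \<epsilon>_def using sum_le_suminf[OF \<beta>(2), of "{..<M}"] \<beta>(1) by simp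
  have hM: "norm (h t - (\<Sum>n<M. of_real (\<beta> n) * cis (- freq n * t))) \<le> \<epsilon> M" for t M
  proof -
    have "(\<lambda>n. of_real (\<beta> (n + M)) * cis (- freq (n + M) * t)) sums (h t - (\<Sum>n<M. of_real (\<beta> n) * cis (- freq n * t)))"
      using sums_split_initial_segment[OF h, of M t] by simp
    moreover have "(\<lambda>n. \<beta> (n + M)) sums \<epsilon> M"
      unfolding \<epsilon>_def using sums_split_initial_segment[OF summable_sums[OF \<beta>(2)], of M] by simp
    ultimately show ?thesis
      using norm_suminf_le[of "\<lambda>n. of_real (\<beta> (n + M)) * cis (- freq (n + M) * t)" "\<lambda>n. \<beta> (n + M)"] \<beta>(1)
      by (auto simp: sums_iff norm_mult)
  qed
  have bound: "block_squares T F \<beta> \<le> 2 / T * (2 * X + 4 * T * (\<epsilon> M)\<^sup>2)" if M: "F \<subseteq> {..<M}" for M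
  proof -
    define G where "G = {1..<M}"
    have FG: "F \<subseteq> G"
    proof
      fix n assume "n \<in> F" then show "n \<in> G" using M F(2) by (cases "n = 0") (auto simp: G_def)
    qed
    show ?thesis
    proof (cases "M = 0")
      case True
      then have "F = {}" using M by auto
      then show ?thesis using T X by (simp add: block_squares_def)
    next
      case False
      \<comment> \<open>Index 0 has frequency 0 and is absorbed in the free constant.\<close>
      define c where "c = of_real (\<beta> 0) - \<kappa>"
      define hM where "hM = (\<lambda>t. c + (\<Sum>n\<in>G. of_real (\<beta> n) * cis (- freq n * t)))"
      have hM_eq: "hM t = (\<Sum>n<M. of_real (\<beta> n) * cis (- freq n * t)) - \<kappa>" for t
      proof -
        have "{..<M} = insert 0 G" using False by (auto simp: G_def)
        then show ?thesis by (simp add: hM_def c_def G_def)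
      qed
      have le: "exp (- \<bar>t\<bar> / T) * (norm (hM t))\<^sup>2 \<le> 2 * (exp (- \<bar>t\<bar> / T) * (norm (h t - \<kappa>))\<^sup>2) + 2 * (\<epsilon> M)\<^sup>2 * exp (- \<bar>t\<bar> / T)" for t
      proof -
        have "norm (hM t) \<le> norm (h t - \<kappa>) + \<epsilon> M"
          using norm_triangle_ineq4[of "h t - \<kappa>" "h t - (\<Sum>n<M. of_real (\<beta> n) * cis (- freq n * t))"] hM[of t M]
          by (simp add: hM_eq)
        then have "(norm (hM t))\<^sup>2 \<le> (norm (h t - \<kappa>) + \<epsilon> M)\<^sup>2" by (intro power_mono) auto
        also have "\<dots> \<le> 2 * (norm (h t - \<kappa>))\<^sup>2 + 2 * (\<epsilon> M)\<^sup>2"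
          using sum_squares_bound[of "norm (h t - \<kappa>)" "\<epsilon> M"] by (simp add: power2_sum)
        finally have "exp (- \<bar>t\<bar> / T) * (norm (hM t))\<^sup>2 \<le> exp (- \<bar>t\<bar> / T) * (2 * (norm (h t - \<kappa>))\<^sup>2 + 2 * (\<epsilon> M)\<^sup>2)"
          by (rule mult_left_mono) simp
        then show ?thesis by (simp add: algebra_simps)
      qed
      have [measurable]: "h \<in> borel_measurable borel"
        by (rule borel_measurable_LIMSEQ_metric[OF _ h[unfolded sums_def]]) simp
      have [measurable]: "hM \<in> borel_measurable borel" unfolding hM_def by measurable
      \<comment> \<open>Through \<open>enn2real\<close> the Bochner integral is at most the
        nonnegative one even before integrability is known.\<close>
      have "ennreal (LINT t|lborel. exp (- \<bar>t\<bar> / T) * (norm (hM t))\<^sup>2) \<le> (\<integral>\<^sup>+t. ennreal (exp (- \<bar>t\<bar> / T) * (norm (hM t))\<^sup>2) \<partial>lborel)"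
      proof (subst integral_eq_nn_integral)
        show "ennreal (enn2real x) \<le> x" for x by (cases x) auto
      qed auto
      also have "\<dots> \<le> (\<integral>\<^sup>+t. (ennreal 2 * ennreal (exp (- \<bar>t\<bar> / T) * (norm (h t - \<kappa>))\<^sup>2) + ennreal (2 * (\<epsilon> M)\<^sup>2) * ennreal (exp (- \<bar>t - 0\<bar> / T))) \<partial>lborel)"
      proof (rule nn_integral_mono)
        fix t
        show "ennreal (exp (- \<bar>t\<bar> / T) * (norm (hM t))\<^sup>2) \<le> ennreal 2 * ennreal (exp (- \<bar>t\<bar> / T) * (norm (h t - \<kappa>))\<^sup>2) + ennreal (2 * (\<epsilon> M)\<^sup>2) * ennreal (exp (- \<bar>t - 0\<bar> / T))"
          using ennreal_leI[OF le[of t]] by (simp add: ennreal_mult')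
      qed
      also have "\<dots> = ennreal 2 * (\<integral>\<^sup>+t. ennreal (exp (- \<bar>t\<bar> / T) * (norm (h t - \<kappa>))\<^sup>2) \<partial>lborel) + ennreal (2 * (\<epsilon> M)\<^sup>2) * (\<integral>\<^sup>+t. ennreal (exp (- \<bar>t - 0\<bar> / T)) \<partial>lborel)"
        by (subst nn_integral_add) (simp_all add: nn_integral_cmult)
      also have "(\<integral>\<^sup>+t. ennreal (exp (- \<bar>t - 0\<bar> / T)) \<partial>lborel) = ennreal (2 * T)"
        using integrable_exp_kernel[OF T, of 0] by (subst nn_integral_eq_integral) (auto simp: has_bochner_integral_iff)
      also have "ennreal 2 * (\<integral>\<^sup>+t. ennreal (exp (- \<bar>t\<bar> / T) * (norm (h t - \<kappa>))\<^sup>2) \<partial>lborel) + ennreal (2 * (\<epsilon> M)\<^sup>2) * ennreal (2 * T)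
          \<le> ennreal 2 * ennreal X + ennreal (2 * (\<epsilon> M)\<^sup>2) * ennreal (2 * T)"
        by (intro add_right_mono mult_left_mono X) auto
      also have "\<dots> = ennreal (2 * X + 4 * T * (\<epsilon> M)\<^sup>2)"
      proof -
        have "ennreal 2 * ennreal X + ennreal (2 * (\<epsilon> M)\<^sup>2) * ennreal (2 * T) = ennreal (2 * X + 2 * (\<epsilon> M)\<^sup>2 * (2 * T))"
          using X(1) T by (simp only: ennreal_mult'[symmetric] ennreal_plus mult_nonneg_nonneg zero_le_power2 less_imp_le zero_le_numeral)
        then show ?thesis by (simp add: mult_ac)
      qed
      finally have I: "(LINT t|lborel. exp (- \<bar>t\<bar> / T) * (norm (hM t))\<^sup>2) \<le> 2 * X + 4 * T * (\<epsilon> M)\<^sup>2"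
        using X T by (subst (asm) ennreal_le_iff) auto
      have "block_squares T F \<beta> \<le> block_squares T G \<beta>" by (rule block_squares_mono[OF FG _ \<beta>(1)]) (simp add: G_def)
      also have "\<dots> \<le> 2 / T * (LINT t|lborel. exp (- \<bar>t\<bar> / T) * (norm (hM t))\<^sup>2)"
        unfolding block_squares_def hM_def by (rule trig_sum_energy_ge) (use T \<beta> in \<open>auto simp: G_def intro: freq_pos\<close>)
      also have "\<dots> \<le> 2 / T * (2 * X + 4 * T * (\<epsilon> M)\<^sup>2)" using T I by (intro mult_left_mono) auto
      finally show ?thesis .
    qed
  qed
  obtain M0 where M0: "F \<subseteq> {..<M0}" using F(1) finite_nat_iff_bounded by blast
  have "block_squares T F \<beta> \<le> 2 / T * (2 * X + 4 * T * 0\<^sup>2)"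
  proof (rule LIMSEQ_le_const)
    have "\<epsilon> \<longlonglongrightarrow> suminf \<beta> - suminf \<beta>"
      unfolding \<epsilon>_def by (intro tendsto_diff tendsto_const summable_LIMSEQ \<beta>)
    then have "\<epsilon> \<longlonglongrightarrow> 0" by simp
    then show "(\<lambda>M. 2 / T * (2 * X + 4 * T * (\<epsilon> M)\<^sup>2)) \<longlonglongrightarrow> 2 / T * (2 * X + 4 * T * 0\<^sup>2)"
      by (intro tendsto_intros)
    show "\<exists>M. \<forall>n\<ge>M. block_squares T F \<beta> \<le> 2 / T * (2 * X + 4 * T * (\<epsilon> n)\<^sup>2)"
      using M0 by (intro exI[of _ M0] allI impI bound) auto
  qed
  then show ?thesis by simp
qed

section \<open>From mean to square mean oscillation\<close>

lemma norm_diff_square_le: "(norm (x - z))\<^sup>2 \<le> 2 * (norm (x - y))\<^sup>2 + 2 * (norm (y - z))\<^sup>2"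
proof -
  have "norm (x - z) \<le> norm (x - y) + norm (y - z)" using norm_triangle_ineq[of "x - y" "y - z"] by simp
  then have "(norm (x - z))\<^sup>2 \<le> (norm (x - y) + norm (y - z))\<^sup>2" by (intro power_mono) auto
  also have "\<dots> \<le> 2 * (norm (x - y))\<^sup>2 + 2 * (norm (y - z))\<^sup>2"
    using sum_squares_bound[of "norm (x - y)" "norm (y - z)"] by (simp add: power2_sum)
  finally show ?thesis .
qed

text \<open>The gauge-integral mean, suited to the continuous smoothed functions;
  \<open>interval_mean\<close> is its Lebesgue counterpart.\<close>

definition cmean :: "(real \<Rightarrow> complex) \<Rightarrow> real \<Rightarrow> real \<Rightarrow> complex" where
  "cmean h a b = integral {a..b} h /\<^sub>R (b - a)"

lemma norm_cmean_diff_le: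
  assumes h: "continuous_on UNIV h" and ab: "a < b"
  shows "norm (cmean h a b - c) * (b - a) \<le> integral {a..b} (\<lambda>t. norm (h t - c))"
proof -
  have i: "h integrable_on {a..b}" "(\<lambda>t. h t - c) integrable_on {a..b}" "(\<lambda>t. norm (h t - c)) integrable_on {a..b}"
    by (intro integrable_continuous_real continuous_intros continuous_on_subset[OF h] subset_UNIV)+
  have "integral {a..b} (\<lambda>t. h t - c) = (b - a) *\<^sub>R (cmean h a b - c)"
    using ab Henstock_Kurzweil_Integration.integral_diff[OF i(1) integrable_const_ivl[of c a b]]
    by (simp add: cmean_def scaleR_diff_right)
  then have "norm (cmean h a b - c) * (b - a) = norm (integral {a..b} (\<lambda>t. h t - c))" using ab by simp
  also have "\<dots> \<le> integral {a..b} (\<lambda>t. norm (h t - c))"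
    by (rule integral_norm_bound_integral) (use i in auto)
  finally show ?thesis .
qed

text \<open>A stopping-time free form of the Calderon--Zygmund argument: a half of the interval with a large
  average is recentred at its own mean, and the cost is paid by that average.\<close>

lemma L1_oscillation_imp_L2_aux:
  fixes h :: "real \<Rightarrow> complex"
  assumes h: "continuous_on UNIV h" and B: "B > 0"
    and osc: "\<And>a b. a < b \<Longrightarrow> integral {a..b} (\<lambda>t. norm (h t - cmean h a b)) \<le> B * (b - a)"
    and \<delta>: "\<And>x y. x \<in> {p..q} \<Longrightarrow> y \<in> {p..q} \<Longrightarrow> \<bar>x - y\<bar> \<le> \<delta> \<Longrightarrow> norm (h x - h y) \<le> B"
  shows "a < b \<Longrightarrow> p \<le> a \<Longrightarrow> b \<le> q \<Longrightarrow> b - a \<le> 2 ^ N * \<delta> \<Longrightarrow>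
    integral {a..b} (\<lambda>t. norm (h t - c)) \<le> 4 * B * (b - a) \<Longrightarrow>
    integral {a..b} (\<lambda>t. (norm (h t - c))\<^sup>2) \<le> 64 * B * integral {a..b} (\<lambda>t. norm (h t - c))"
proof (induction N arbitrary: a b c)
  case 0
  have i: "(\<lambda>t. norm (h t - c)) integrable_on {a..b}" "(\<lambda>t. (norm (h t - c))\<^sup>2) integrable_on {a..b}"
    by (intro integrable_continuous_real continuous_intros continuous_on_subset[OF h] subset_UNIV)+
  \<comment> \<open>On so short an interval \<open>h\<close> varies by at most \<open>B\<close>, and
    the average of \<open>norm (h t - c)\<close> is at most \<open>4 * B\<close>.\<close>
  have bd: "norm (h t - c) \<le> 5 * B" if t: "t \<in> {a..b}" for t
  proof -
    have "integral {a..b} (\<lambda>s. norm (h t - c)) \<le> integral {a..b} (\<lambda>s. B + norm (h s - c))"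
    proof (rule integral_le)
      fix s assume s: "s \<in> {a..b}"
      have "norm (h t - h s) \<le> B" using t s 0 by (intro \<delta>) auto
      then show "norm (h t - c) \<le> B + norm (h s - c)" using norm_triangle_ineq[of "h t - h s" "h s - c"] by simp
    qed (use i in \<open>auto intro: integrable_add\<close>)
    also have "\<dots> = B * (b - a) + integral {a..b} (\<lambda>s. norm (h s - c))"
      using 0 i by (subst integral_add) auto
    also have "\<dots> \<le> 5 * B * (b - a)" using 0 by simp
    finally show ?thesis using 0 by simp
  qed
  have "integral {a..b} (\<lambda>t. (norm (h t - c))\<^sup>2) \<le> integral {a..b} (\<lambda>t. 64 * B * norm (h t - c))"
  proof (rule integral_le)
    fix t assume t: "t \<in> {a..b}"
    have "norm (h t - c) * norm (h t - c) \<le> (64 * B) * norm (h t - c)"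
      using bd[OF t] B by (intro mult_right_mono) auto
    then show "(norm (h t - c))\<^sup>2 \<le> 64 * B * norm (h t - c)" by (simp add: power2_eq_square)
  qed (use i in \<open>auto intro: integrable_on_mult_right\<close>)
  then show ?case by simp
next
  case (Suc N)
  have i: "(\<lambda>t. norm (h t - c)) integrable_on {x..y}" "(\<lambda>t. (norm (h t - c))\<^sup>2) integrable_on {x..y}" for x y c
    by (intro integrable_continuous_real continuous_intros continuous_on_subset[OF h] subset_UNIV)+
  have half: "integral {x..y} (\<lambda>t. (norm (h t - c))\<^sup>2) \<le> 64 * B * integral {x..y} (\<lambda>t. norm (h t - c))"
    if xy: "x < y" "a \<le> x" "y \<le> b" "y - x = (b - a) / 2" for x y
  proof (cases "integral {x..y} (\<lambda>t. norm (h t - c)) \<le> 4 * B * (y - x)")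
    case True
    show ?thesis by (rule Suc.IH[OF _ _ _ _ True]) (use xy Suc.prems in auto)
  next
    case False
    \<comment> \<open>Recentring at the mean brings the average down to \<open>B\<close>, so the
      induction hypothesis applies; as the half has half the length, \<open>m\<close> and
      \<open>c\<close> differ by at most \<open>8 * B\<close>. The constant 64 solves
      \<open>2 * K + 2 * 8^2 = 4 * K\<close>: the left side is the cost of recentring, the right
      side uses an average above \<open>4 * B\<close>.\<close>
    define m where "m = cmean h x y"
    have "integral {x..y} (\<lambda>t. norm (h t - m)) \<le> B * (y - x)" unfolding m_def by (rule osc) fact
    moreover have "B * (y - x) \<le> 4 * B * (y - x)" using B xy by simp
    ultimately have m4: "integral {x..y} (\<lambda>t. norm (h t - m)) \<le> 4 * B * (y - x)" by linarith
    have "integral {x..y} (\<lambda>t. (norm (h t - m))\<^sup>2) \<le> 64 * B * integral {x..y} (\<lambda>t. norm (h t - m))"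
      by (rule Suc.IH[OF _ _ _ _ m4]) (use xy Suc.prems in auto)
    also have "\<dots> \<le> 64 * B * (B * (y - x))" unfolding m_def using B by (intro mult_left_mono osc xy) auto
    finally have 1: "integral {x..y} (\<lambda>t. (norm (h t - m))\<^sup>2) \<le> 64 * B * (B * (y - x))" .
    have "norm (m - c) * (y - x) \<le> integral {x..y} (\<lambda>t. norm (h t - c))"
      unfolding m_def by (rule norm_cmean_diff_le[OF h]) fact
    also have "\<dots> \<le> integral {a..b} (\<lambda>t. norm (h t - c))"
      by (rule integral_subset_le) (use i xy in auto)
    also have "\<dots> \<le> 4 * B * (b - a)" by fact
    also have "b - a = 2 * (y - x)" using xy by simp
    also have "4 * B * (2 * (y - x)) = 8 * B * (y - x)" by simp
    finally have "norm (m - c) \<le> 8 * B" using xy by simp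
    then have mc: "(norm (m - c))\<^sup>2 \<le> (8 * B)\<^sup>2" by (intro power_mono) auto
    have "integral {x..y} (\<lambda>t. (norm (h t - c))\<^sup>2) \<le> integral {x..y} (\<lambda>t. 2 * (norm (h t - m))\<^sup>2 + 128 * B\<^sup>2)"
    proof (rule integral_le)
      fix t
      have "(norm (h t - c))\<^sup>2 \<le> 2 * (norm (h t - m))\<^sup>2 + 2 * (norm (m - c))\<^sup>2"
        by (rule norm_diff_square_le)
      then show "(norm (h t - c))\<^sup>2 \<le> 2 * (norm (h t - m))\<^sup>2 + 128 * B\<^sup>2"
        using mc by (simp add: power_mult_distrib)
    qed (use i in \<open>auto intro!: integrable_add integrable_on_mult_right\<close>)
    also have "\<dots> = 2 * integral {x..y} (\<lambda>t. (norm (h t - m))\<^sup>2) + 128 * B\<^sup>2 * (y - x)"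
      using xy i by (subst integral_add) (auto intro: integrable_on_mult_right)
    also have "\<dots> \<le> 64 * B * (4 * B * (y - x))" using 1 by (simp add: power2_eq_square algebra_simps)
    also have "\<dots> \<le> 64 * B * integral {x..y} (\<lambda>t. norm (h t - c))" using False B by (intro mult_left_mono) auto
    finally show ?thesis .
  qed
  define m where "m = (a + b) / 2"
  have m: "a < m" "m < b" using Suc.prems by (auto simp: m_def)
  have "integral {a..b} (\<lambda>t. (norm (h t - c))\<^sup>2) = integral {a..m} (\<lambda>t. (norm (h t - c))\<^sup>2) + integral {m..b} (\<lambda>t. (norm (h t - c))\<^sup>2)"
    using Henstock_Kurzweil_Integration.integral_combine[OF _ _ i(2)] m by (metis less_imp_le)
  also have "\<dots> \<le> 64 * B * integral {a..m} (\<lambda>t. norm (h t - c)) + 64 * B * integral {m..b} (\<lambda>t. norm (h t - c))"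
    by (intro add_mono half) (use m in \<open>auto simp: m_def field_simps\<close>)
  also have "\<dots> = 64 * B * integral {a..b} (\<lambda>t. norm (h t - c))"
    using Henstock_Kurzweil_Integration.integral_combine[OF _ _ i(1)] m by (metis less_imp_le distrib_left)
  finally show ?case .
qed

text \<open>Uniform continuity ends the bisection after finitely many steps, and the resulting bound
  is independent of their number. This is why the boundary function is smoothed first.\<close>

lemma L1_oscillation_imp_L2:
  fixes h :: "real \<Rightarrow> complex"
  assumes h: "continuous_on UNIV h" and B: "B > 0"
    and osc: "\<And>a b. a < b \<Longrightarrow> integral {a..b} (\<lambda>t. norm (h t - cmean h a b)) \<le> B * (b - a)" and ab: "a < b"
  shows "integral {a..b} (\<lambda>t. (norm (h t - cmean h a b))\<^sup>2) \<le> 64 * B\<^sup>2 * (b - a)"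
proof -
  have "uniformly_continuous_on {a..b} h"
    by (intro compact_uniformly_continuous continuous_on_subset[OF h]) auto
  then obtain d where d: "d > 0" "\<And>x y. x \<in> {a..b} \<Longrightarrow> y \<in> {a..b} \<Longrightarrow> dist x y < d \<Longrightarrow> dist (h x) (h y) < B"
    unfolding uniformly_continuous_on_def using B by (metis dist_commute)
  define \<delta> where "\<delta> = d / 2"
  have \<delta>: "norm (h x - h y) \<le> B" if "x \<in> {a..b}" "y \<in> {a..b}" "\<bar>x - y\<bar> \<le> \<delta>" for x y
    using d(2)[of x y] that d(1) by (simp add: \<delta>_def dist_norm)
  obtain N where "(b - a) / \<delta> < 2 ^ N" using real_arch_pow[of 2 "(b - a) / \<delta>"] by auto
  then have N: "b - a \<le> 2 ^ N * \<delta>" using d(1) by (simp add: \<delta>_def field_simps)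
  have "integral {a..b} (\<lambda>t. norm (h t - cmean h a b)) \<le> B * (b - a)" by (rule osc) fact
  moreover have "B * (b - a) \<le> 4 * B * (b - a)" using B ab by simp
  ultimately have "integral {a..b} (\<lambda>t. (norm (h t - cmean h a b))\<^sup>2) \<le> 64 * B * integral {a..b} (\<lambda>t. norm (h t - cmean h a b))"
    by (intro L1_oscillation_imp_L2_aux[OF h B osc \<delta> ab _ _ N]) auto
  also have "\<dots> \<le> 64 * B * (B * (b - a))" using B by (intro mult_left_mono osc ab) auto
  finally show ?thesis by (simp add: power2_eq_square mult_ac)
qed

section \<open>Square oscillation against the exponential kernel\<close>

lemma nn_integral_continuous_Icc:
  fixes f :: "real \<Rightarrow> real"
  assumes f: "continuous_on UNIV f" and f0: "\<And>x. f x \<ge> 0"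
  shows "(\<integral>\<^sup>+x. ennreal (f x) * indicator {a..b} x \<partial>lborel) = ennreal (integral {a..b} f)"
proof -
  have si: "set_integrable lborel {a..b} f"
    by (rule borel_integrable_atLeastAtMost') (rule continuous_on_subset[OF f], simp)
  have "(\<integral>\<^sup>+x. ennreal (f x) * indicator {a..b} x \<partial>lborel) = (\<integral>\<^sup>+x. ennreal (indicator {a..b} x *\<^sub>R f x) \<partial>lborel)"
    by (intro nn_integral_cong) (auto simp: indicator_def)
  also have "\<dots> = ennreal (LINT x|lborel. indicator {a..b} x *\<^sub>R f x)"
    by (rule nn_integral_eq_integral) (use si f0 in \<open>auto simp: set_integrable_def indicator_def\<close>)
  also have "(LINT x|lborel. indicator {a..b} x *\<^sub>R f x) = integral {a..b} f"
    using set_borel_integral_eq_integral(2)[OF si] by (simp add: set_lebesgue_integral_def)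
  finally show ?thesis .
qed

text \<open>On \<open>k * T <= \<bar>t\<bar> < (k + 1) * T\<close> the kernel is at most
  \<open>exp (- k)\<close>; the remaining factor bounds the square oscillation about the central
  mean over the interval of radius \<open>(k + 1) * T\<close>, in units of
  \<open>T * B\<^sup>2\<close>.\<close>

definition kernel_sum_const :: real where
  "kernel_sum_const = (\<Sum>k::nat. exp (- real k) * (4 * (real k + 1) * (64 + (real k + 1)\<^sup>2)))"

lemma kernel_sum_const_summable: "summable (\<lambda>k::nat. exp (- real k) * (4 * (real k + 1) * (64 + (real k + 1)\<^sup>2)))"
proof (rule summable_comparison_test_bigo)
  show "summable (\<lambda>k::nat. norm (exp (- real k / 2)))"
    using summable_exp_neg[of "1/2"] by simp
  show "(\<lambda>k::nat. exp (- real k) * (4 * (real k + 1) * (64 + (real k + 1)\<^sup>2))) \<in> O(\<lambda>k. exp (- real k / 2))"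
    by real_asymp
qed

lemma kernel_sum_const_nonneg: "kernel_sum_const \<ge> 0"
  unfolding kernel_sum_const_def by (intro suminf_nonneg kernel_sum_const_summable) (auto intro!: mult_nonneg_nonneg add_nonneg_nonneg)

lemma weighted_L2_oscillation_le:
  fixes h :: "real \<Rightarrow> complex"
  assumes h: "continuous_on UNIV h" and B: "B > 0"
    and osc: "\<And>a b. a < b \<Longrightarrow> integral {a..b} (\<lambda>t. norm (h t - cmean h a b)) \<le> B * (b - a)" and T: "T > 0"
  shows "(\<integral>\<^sup>+t. ennreal (exp (- \<bar>t\<bar> / T) * (norm (h t - cmean h (- T) T))\<^sup>2) \<partial>lborel) \<le> ennreal (kernel_sum_const * T * B\<^sup>2)"
proof -
  define \<kappa> where "\<kappa> = cmean h (- T) T"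
  define J where "J = (\<lambda>k::nat. {- ((real k + 1) * T)..(real k + 1) * T})"
  have [measurable]: "h \<in> borel_measurable borel" by (rule borel_measurable_continuous_onI[OF h])
  have i: "(\<lambda>t. norm (h t - c)) integrable_on {x..y}" "(\<lambda>t. (norm (h t - c))\<^sup>2) integrable_on {x..y}" for x y c
    by (intro integrable_continuous_real continuous_intros continuous_on_subset[OF h] subset_UNIV)+
  have Jk: "(\<integral>\<^sup>+t. ennreal ((norm (h t - \<kappa>))\<^sup>2) * indicator (J k) t \<partial>lborel) \<le> ennreal (4 * (real k + 1) * (64 + (real k + 1)\<^sup>2) * T * B\<^sup>2)" for k
  proof -
    define R where "R = (real k + 1) * T"
    have R: "R > 0" "T \<le> R" using T by (auto simp: R_def)
    define m where "m = cmean h (- R) R"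
    \<comment> \<open>The means over the radii \<open>T\<close> and \<open>(k + 1) * T\<close>
      differ by at most \<open>B * (k + 1)\<close>. Linear growth is crude, but harmless against
      \<open>exp (- k)\<close>.\<close>
    have "norm (\<kappa> - m) * (T - - T) \<le> integral {- T..T} (\<lambda>t. norm (h t - m))"
      unfolding \<kappa>_def by (rule norm_cmean_diff_le[OF h]) (use T in simp)
    also have "\<dots> \<le> integral {- R..R} (\<lambda>t. norm (h t - m))"
      by (rule integral_subset_le) (use i R in auto)
    also have "\<dots> \<le> B * (R - - R)" unfolding m_def by (rule osc) (use R in simp)
    finally have "norm (\<kappa> - m) \<le> B * (real k + 1)" using T by (simp add: R_def)
    then have \<kappa>m: "(norm (\<kappa> - m))\<^sup>2 \<le> (B * (real k + 1))\<^sup>2" by (intro power_mono) auto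
    have "integral {- R..R} (\<lambda>t. (norm (h t - \<kappa>))\<^sup>2) \<le> integral {- R..R} (\<lambda>t. 2 * (norm (h t - m))\<^sup>2 + 2 * (B * (real k + 1))\<^sup>2)"
    proof (rule integral_le)
      fix t
      have "(norm (h t - \<kappa>))\<^sup>2 \<le> 2 * (norm (h t - m))\<^sup>2 + 2 * (norm (m - \<kappa>))\<^sup>2"
        by (rule norm_diff_square_le)
      then show "(norm (h t - \<kappa>))\<^sup>2 \<le> 2 * (norm (h t - m))\<^sup>2 + 2 * (B * (real k + 1))\<^sup>2"
        using \<kappa>m by (simp add: norm_minus_commute[of m])
    qed (use i in \<open>auto intro!: integrable_add integrable_on_mult_right\<close>)
    also have "\<dots> = 2 * integral {- R..R} (\<lambda>t. (norm (h t - m))\<^sup>2) + 2 * (B * (real k + 1))\<^sup>2 * (2 * R)"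
      using R i by (subst integral_add) (auto intro: integrable_on_mult_right)
    also have "\<dots> \<le> 2 * (64 * B\<^sup>2 * (R - - R)) + 2 * (B * (real k + 1))\<^sup>2 * (2 * R)"
      unfolding m_def by (intro add_mono mult_left_mono L1_oscillation_imp_L2[OF h B osc]) (use R in auto)
    also have "\<dots> = 4 * (real k + 1) * (64 + (real k + 1)\<^sup>2) * T * B\<^sup>2"
      by (simp add: R_def power2_eq_square algebra_simps)
    finally have "integral {- R..R} (\<lambda>t. (norm (h t - \<kappa>))\<^sup>2) \<le> 4 * (real k + 1) * (64 + (real k + 1)\<^sup>2) * T * B\<^sup>2" .
    moreover have "(\<integral>\<^sup>+t. ennreal ((norm (h t - \<kappa>))\<^sup>2) * indicator {- R..R} t \<partial>lborel) = ennreal (integral {- R..R} (\<lambda>t. (norm (h t - \<kappa>))\<^sup>2))"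
      by (rule nn_integral_continuous_Icc) (auto intro!: continuous_intros h)
    ultimately show ?thesis by (simp add: J_def R_def ennreal_leI)
  qed
  have "(\<integral>\<^sup>+t. ennreal (exp (- \<bar>t\<bar> / T) * (norm (h t - \<kappa>))\<^sup>2) \<partial>lborel)
      \<le> (\<integral>\<^sup>+t. (\<Sum>k. ennreal (exp (- real k)) * (ennreal ((norm (h t - \<kappa>))\<^sup>2) * indicator (J k) t)) \<partial>lborel)"
  proof (rule nn_integral_mono)
    fix t :: real
    define k where "k = nat \<lfloor>\<bar>t\<bar> / T\<rfloor>"
    have "0 \<le> \<bar>t\<bar> / T" using T by simp
    then have k: "real k \<le> \<bar>t\<bar> / T" "\<bar>t\<bar> / T < real k + 1" by (auto simp: k_def of_nat_nat)
    have "t \<in> J k" using k(2) T by (auto simp: J_def field_simps abs_if split: if_splits)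
    have "exp (- \<bar>t\<bar> / T) * (norm (h t - \<kappa>))\<^sup>2 \<le> exp (- real k) * (norm (h t - \<kappa>))\<^sup>2"
      using k(1) by (intro mult_right_mono) auto
    then have "ennreal (exp (- \<bar>t\<bar> / T) * (norm (h t - \<kappa>))\<^sup>2) \<le> ennreal (exp (- real k)) * (ennreal ((norm (h t - \<kappa>))\<^sup>2) * indicator (J k) t)"
      using \<open>t \<in> J k\<close> by (simp add: ennreal_mult[symmetric] ennreal_leI)
    also have "\<dots> \<le> (\<Sum>k. ennreal (exp (- real k)) * (ennreal ((norm (h t - \<kappa>))\<^sup>2) * indicator (J k) t))"
      using sum_le_suminf[of "\<lambda>k. ennreal (exp (- real k)) * (ennreal ((norm (h t - \<kappa>))\<^sup>2) * indicator (J k) t)" "{k}"] by simp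
    finally show "ennreal (exp (- \<bar>t\<bar> / T) * (norm (h t - \<kappa>))\<^sup>2) \<le> (\<Sum>k. ennreal (exp (- real k)) * (ennreal ((norm (h t - \<kappa>))\<^sup>2) * indicator (J k) t))" .
  qed
  also have "\<dots> = (\<Sum>k. ennreal (exp (- real k)) * (\<integral>\<^sup>+t. ennreal ((norm (h t - \<kappa>))\<^sup>2) * indicator (J k) t \<partial>lborel))"
    by (subst nn_integral_suminf) (auto simp: nn_integral_cmult J_def)
  also have "\<dots> \<le> (\<Sum>k. ennreal (exp (- real k) * (4 * (real k + 1) * (64 + (real k + 1)\<^sup>2)) * (T * B\<^sup>2)))"
  proof (intro suminf_le allI)
    fix k
    have "ennreal (exp (- real k)) * (\<integral>\<^sup>+t. ennreal ((norm (h t - \<kappa>))\<^sup>2) * indicator (J k) t \<partial>lborel)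
        \<le> ennreal (exp (- real k)) * ennreal (4 * (real k + 1) * (64 + (real k + 1)\<^sup>2) * T * B\<^sup>2)"
      by (intro mult_left_mono Jk) auto
    also have "\<dots> = ennreal (exp (- real k) * (4 * (real k + 1) * (64 + (real k + 1)\<^sup>2)) * (T * B\<^sup>2))"
      by (subst ennreal_mult'[symmetric]) (auto simp: mult_ac)
    finally show "ennreal (exp (- real k)) * (\<integral>\<^sup>+t. ennreal ((norm (h t - \<kappa>))\<^sup>2) * indicator (J k) t \<partial>lborel)
        \<le> ennreal (exp (- real k) * (4 * (real k + 1) * (64 + (real k + 1)\<^sup>2)) * (T * B\<^sup>2))" .
  qed auto
  also have "\<dots> = ennreal (kernel_sum_const * (T * B\<^sup>2))"
    unfolding kernel_sum_const_def suminf_mult2[OF kernel_sum_const_summable]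
    by (rule suminf_ennreal2[OF _ summable_mult2[OF kernel_sum_const_summable]]) (use T in auto)
  finally show ?thesis by (simp add: \<kappa>_def mult.assoc)
qed

section \<open>Necessity of the block condition\<close>

lemma summable_smoothing_weights:
  assumes "0 < r" "r \<le> 1"
  shows "summable (\<lambda>k. 1 / (1 + r\<^sup>2 * (real k)\<^sup>2))"
proof (rule summable_comparison_test)
  show "summable (\<lambda>k. 1 / r\<^sup>2 * (1 / (1 + (real k)\<^sup>2)))" by (intro summable_mult summable_inverse_one_plus_square)
  show "\<exists>K. \<forall>k\<ge>K. norm (1 / (1 + r\<^sup>2 * (real k)\<^sup>2)) \<le> 1 / r\<^sup>2 * (1 / (1 + (real k)\<^sup>2))"
  proof (intro exI allI impI)
    fix k
    have "r\<^sup>2 \<le> 1" using assms by (simp add: power_le_one)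
    then have "r\<^sup>2 * (1 + (real k)\<^sup>2) \<le> 1 + r\<^sup>2 * (real k)\<^sup>2" by (simp add: algebra_simps)
    moreover have "0 < 1 + (real k)\<^sup>2" "0 < 1 + r\<^sup>2 * (real k)\<^sup>2" by (auto intro: add_pos_nonneg)
    moreover from this have "0 < r\<^sup>2 * (1 + (real k)\<^sup>2)" using assms by simp
    ultimately have "1 / (1 + r\<^sup>2 * (real k)\<^sup>2) \<le> 1 / (r\<^sup>2 * (1 + (real k)\<^sup>2))" by (intro divide_left_mono mult_pos_pos) auto
    then show "norm (1 / (1 + r\<^sup>2 * (real k)\<^sup>2)) \<le> 1 / r\<^sup>2 * (1 / (1 + (real k)\<^sup>2))" by (simp add: add_nonneg_nonneg)
  qed
qed

lemma summable_smoothed_coefficients: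
  assumes sq: "square_summable c" and r: "0 < r" "r \<le> 1"
  shows "summable (\<lambda>n. norm (c n) * (1 / (1 + r\<^sup>2 * (freq n)\<^sup>2)))"
proof (rule summable_weighted_blocks[OF sq summable_smoothing_weights[OF r]])
  fix n
  have "(real (nat \<lfloor>freq n\<rfloor>))\<^sup>2 \<le> (freq n)\<^sup>2" by (intro power_mono floor_freq_le) auto
  then have "1 + r\<^sup>2 * (real (nat \<lfloor>freq n\<rfloor>))\<^sup>2 \<le> 1 + r\<^sup>2 * (freq n)\<^sup>2" by (intro add_left_mono mult_left_mono) auto
  then show "1 / (1 + r\<^sup>2 * (freq n)\<^sup>2) \<le> 1 / (1 + r\<^sup>2 * (real (nat \<lfloor>freq n\<rfloor>))\<^sup>2)"
    by (intro divide_left_mono mult_pos_pos add_pos_nonneg) auto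
qed (auto simp: add_nonneg_nonneg)

text \<open>Convolution with the normalised kernel multiplies the coefficient at frequency
  \<open>l\<close> by \<open>1 / (1 + r\<^sup>2 * l\<^sup>2)\<close>: positive, summable over
  blocks, and tending to 1 as \<open>r\<close> tends to 0.\<close>

lemma exp_kernel_cis:
  assumes "r > 0"
  shows "has_bochner_integral lborel (\<lambda>s. (exp (- \<bar>s - t\<bar> / r) / (2 * r)) *\<^sub>R cis (- l * s)) (of_real (1 / (1 + r\<^sup>2 * l\<^sup>2)) * cis (- l * t))"
proof -
  have "has_bochner_integral lborel (\<lambda>s::real. exp (- \<bar>- t + 1 * s\<bar> / r) *\<^sub>R cis (- l * (- t + 1 * s))) (of_real (2 * r / (1 + r\<^sup>2 * (- l)\<^sup>2)) /\<^sub>R \<bar>1\<bar>)"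
    by (rule lborel_has_bochner_integral_real_affine_iff[THEN iffD1]) (use exp_kernel_fourier[OF assms, of "- l"] in auto)
  then have "has_bochner_integral lborel (\<lambda>s. (cis (- l * t) / of_real (2 * r)) * (exp (- \<bar>- t + 1 * s\<bar> / r) *\<^sub>R cis (- l * (- t + 1 * s))))
      ((cis (- l * t) / of_real (2 * r)) * (of_real (2 * r / (1 + r\<^sup>2 * (- l)\<^sup>2)) /\<^sub>R \<bar>1\<bar>))"
    by (rule has_bochner_integral_mult_right)
  moreover have "(cis (- l * t) / of_real (2 * r)) * (exp (- \<bar>- t + 1 * s\<bar> / r) *\<^sub>R cis (- l * (- t + 1 * s)))
      = (exp (- \<bar>s - t\<bar> / r) / (2 * r)) *\<^sub>R cis (- l * s)" for s
  proof -
    have "cis (- l * t) * cis (- l * (- t + s)) = cis (- l * s)" by (simp add: cis_mult algebra_simps)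
    then show ?thesis using assms by (simp add: scaleR_conv_of_real mult.left_commute)
  qed
  moreover have "(cis (- l * t) / of_real (2 * r)) * (of_real (2 * r / (1 + r\<^sup>2 * (- l)\<^sup>2)) /\<^sub>R \<bar>1\<bar>) = of_real (1 / (1 + r\<^sup>2 * l\<^sup>2)) * cis (- l * t)"
    using assms by simp
  ultimately show ?thesis by (simp only:)
qed

lemma smoothing_kernel_dominated:
  assumes r: "0 < r" "r \<le> 1"
  shows "exp_dominated (\<lambda>s. exp (- \<bar>s - t\<bar> / r) / (2 * r)) (1 / (2 * r)) t"
  unfolding exp_dominated_def
proof (intro conjI allI)
  fix s
  have "\<bar>s - t\<bar> * r \<le> \<bar>s - t\<bar> * 1" using r by (intro mult_left_mono) auto
  then have "\<bar>s - t\<bar> \<le> \<bar>s - t\<bar> / r" using r by (simp add: field_simps)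
  then show "exp (- \<bar>s - t\<bar> / r) / (2 * r) \<le> 1 / (2 * r) * exp (- \<bar>s - t\<bar>)"
    using r by (simp add: divide_right_mono)
qed (use r in auto)

text \<open>Both sides are limits along the same lacunary partial sums: the integral because the
  kernel is an admissible weight, the series because its coefficients are absolutely
  summable.\<close>

lemma smoothed_series:
  assumes sq: "square_summable c" and r: "0 < r" "r \<le> 1"
  defines "u \<equiv> boundary_value (dirichlet_sum c)"
  shows "integrable lborel (\<lambda>s. (exp (- \<bar>s - t\<bar> / r) / (2 * r)) *\<^sub>R u s)" (is ?int)
    and "(\<lambda>n. c n * of_real (1 / (1 + r\<^sup>2 * (freq n)\<^sup>2)) * cis (- freq n * t)) sums
      (LINT s|lborel. (exp (- \<bar>s - t\<bar> / r) / (2 * r)) *\<^sub>R u s)" (is ?sums)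
proof -
  let ?w = "\<lambda>s. exp (- \<bar>s - t\<bar> / r) / (2 * r)"
  obtain N where l: "lacunary_limit c N u" using boundary_value_dirichlet_sum[OF sq] unfolding u_def by blast
  note 2 = lacunary_limitD(5)[OF l smoothing_kernel_dominated[OF r]]
  show ?int by (rule lacunary_limitD(4)[OF l smoothing_kernel_dominated[OF r]])
  have eq: "(LINT s|lborel. ?w s *\<^sub>R partial_sum c M s) = (\<Sum>n | freq n < real M. c n * of_real (1 / (1 + r\<^sup>2 * (freq n)\<^sup>2)) * cis (- freq n * t))" for M
  proof -
    have "has_bochner_integral lborel (\<lambda>s. \<Sum>n | freq n < real M. c n * (?w s *\<^sub>R cis (- freq n * s)))
      (\<Sum>n | freq n < real M. c n * (of_real (1 / (1 + r\<^sup>2 * (freq n)\<^sup>2)) * cis (- freq n * t)))"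
      by (intro has_bochner_integral_sum has_bochner_integral_mult_right exp_kernel_cis r)
    moreover have "(\<Sum>n | freq n < real M. c n * (?w s *\<^sub>R cis (- freq n * s))) = ?w s *\<^sub>R partial_sum c M s" for s
      unfolding partial_sum_def scaleR_sum_right by (intro sum.cong refl) (simp add: scaleR_conv_of_real)
    ultimately show ?thesis by (simp add: has_bochner_integral_iff mult.assoc)
  qed
  have "summable (\<lambda>n. c n * of_real (1 / (1 + r\<^sup>2 * (freq n)\<^sup>2)) * cis (- freq n * t))"
  proof (rule summable_norm_cancel)
    have "0 \<le> 1 / (1 + r\<^sup>2 * (freq n)\<^sup>2)" for n by (simp add: add_nonneg_nonneg)
    then have "norm (c n * of_real (1 / (1 + r\<^sup>2 * (freq n)\<^sup>2)) * cis (- freq n * t)) = norm (c n) * (1 / (1 + r\<^sup>2 * (freq n)\<^sup>2))" for n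
      by (simp only: norm_mult norm_of_real norm_cis abs_of_nonneg mult_1_right)
    then show "summable (\<lambda>n. norm (c n * of_real (1 / (1 + r\<^sup>2 * (freq n)\<^sup>2)) * cis (- freq n * t)))"
      using summable_smoothed_coefficients[OF sq r] by (simp only:)
  qed
  then obtain S where S: "(\<lambda>n. c n * of_real (1 / (1 + r\<^sup>2 * (freq n)\<^sup>2)) * cis (- freq n * t)) sums S" by (auto simp: summable_def)
  have "S = (LINT s|lborel. ?w s *\<^sub>R u s)"
    using sums_imp_freq_sums[OF S lacunary_limitD(1)[OF l]] 2[of t] unfolding eq by (rule LIMSEQ_unique)
  with S show ?sums by simp
qed

lemma absolutely_summable_trig_continuous:
  assumes s: "summable (\<lambda>n. norm (\<gamma> n))" and h: "\<And>t. (\<lambda>n. \<gamma> n * cis (- freq n * t)) sums h t"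
  shows "continuous_on UNIV h"
proof -
  have "uniform_limit UNIV (\<lambda>N t. \<Sum>n<N. \<gamma> n * cis (- freq n * t)) (\<lambda>t. \<Sum>n. \<gamma> n * cis (- freq n * t)) sequentially"
    by (rule Weierstrass_m_test[OF _ s]) (simp add: norm_mult)
  moreover have "(\<lambda>t. \<Sum>n. \<gamma> n * cis (- freq n * t)) = h" using h by (auto simp: sums_iff)
  ultimately have "uniform_limit UNIV (\<lambda>N t. \<Sum>n<N. \<gamma> n * cis (- freq n * t)) h sequentially" by simp
  then show ?thesis
    by (rule uniform_limit_theorem[rotated]) (auto intro!: always_eventually continuous_intros)
qed

section \<open>Mean oscillation under convolution\<close>

lemma double_oscillation_le:
  fixes u :: "real \<Rightarrow> complex"
  assumes [measurable]: "u \<in> borel_measurable borel" and ab: "a < b" and B: "B \<ge> 0"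
    and osc: "(\<integral>\<^sup>+t\<in>{a..b}. ennreal (norm (u t - m)) \<partial>lborel) \<le> ennreal (B * (b - a))"
  shows "(\<integral>\<^sup>+t. (\<integral>\<^sup>+t'. ennreal (norm (u t - u t')) * indicator {a..b} t * indicator {a..b} t' \<partial>lborel) \<partial>lborel) \<le> ennreal (2 * B * (b - a)\<^sup>2)"
proof -
  define g where "g = (\<lambda>t. ennreal (norm (u t - m)) * indicator {a..b} t)"
  define I where "I = (\<lambda>t. indicator {a..b} t :: ennreal)"
  have [measurable]: "g \<in> borel_measurable borel" "I \<in> borel_measurable borel" by (auto simp: g_def I_def)
  have Ii: "(\<integral>\<^sup>+t. I t \<partial>lborel) = ennreal (b - a)" using ab by (simp add: I_def)
  have gi: "(\<integral>\<^sup>+t. g t \<partial>lborel) \<le> ennreal (B * (b - a))" using osc by (simp add: g_def)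
  have "(\<integral>\<^sup>+t. (\<integral>\<^sup>+t'. ennreal (norm (u t - u t')) * indicator {a..b} t * indicator {a..b} t' \<partial>lborel) \<partial>lborel)
     \<le> (\<integral>\<^sup>+t. (\<integral>\<^sup>+t'. g t * I t' + I t * g t' \<partial>lborel) \<partial>lborel)"
  proof (intro nn_integral_mono)
    fix t t'
    have "norm (u t - u t') \<le> norm (u t - m) + norm (u t' - m)"
      using norm_triangle_ineq4[of "u t - m" "u t' - m"] by simp
    then show "ennreal (norm (u t - u t')) * indicator {a..b} t * indicator {a..b} t' \<le> g t * I t' + I t * g t'"
      by (auto simp: g_def I_def indicator_def ennreal_plus[symmetric] intro!: ennreal_leI simp del: ennreal_plus)
  qed
  also have "\<dots> = (\<integral>\<^sup>+t. g t * ennreal (b - a) + I t * (\<integral>\<^sup>+t'. g t' \<partial>lborel) \<partial>lborel)"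
    by (intro nn_integral_cong) (simp add: nn_integral_add nn_integral_cmult Ii)
  also have "\<dots> = (\<integral>\<^sup>+t. g t \<partial>lborel) * ennreal (b - a) + ennreal (b - a) * (\<integral>\<^sup>+t'. g t' \<partial>lborel)"
    by (subst nn_integral_add) (auto simp: nn_integral_multc Ii)
  also have "\<dots> \<le> ennreal (B * (b - a)) * ennreal (b - a) + ennreal (b - a) * ennreal (B * (b - a))"
    by (intro add_mono mult_mono gi) auto
  also have "\<dots> = ennreal (2 * B * (b - a)\<^sup>2)"
  proof -
    have "ennreal (B * (b - a)) * ennreal (b - a) = ennreal (B * (b - a)\<^sup>2)"
      using B ab by (simp add: ennreal_mult'[symmetric] power2_eq_square mult.assoc)
    then show ?thesis using B by (simp add: mult.commute[of "ennreal (b - a)"] ennreal_plus[symmetric] del: ennreal_plus)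
  qed
  finally show ?thesis .
qed

text \<open>The double integral of \<open>norm (u t - u t')\<close> over a square contains no mean
  and is compatible with translations, so Tonelli's theorem averages it over \<open>s\<close>.
  Passing from the mean oscillation to the double integral costs a factor 2, and returning costs
  nothing.\<close>

lemma smoothing_oscillation_le:
  fixes u :: "real \<Rightarrow> complex" and w :: "real \<Rightarrow> real"
  assumes um [measurable]: "u \<in> borel_measurable borel" and wm [measurable]: "w \<in> borel_measurable borel"
    and w0: "\<And>s. w s \<ge> 0" and w1: "(\<integral>\<^sup>+s. ennreal (w s) \<partial>lborel) = 1" and B: "B \<ge> 0"
    and osc: "\<And>a b. a < b \<Longrightarrow> oscillation u a b \<le> ennreal (B * (b - a))"
    and int: "\<And>t. integrable lborel (\<lambda>s. w (s - t) *\<^sub>R u s)"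
    and h: "\<And>t. h t = (LINT s|lborel. w (s - t) *\<^sub>R u s)" and hc: "continuous_on UNIV h" and ab: "a < b"
  shows "integral {a..b} (\<lambda>t. norm (h t - cmean h a b)) \<le> 2 * B * (b - a)"
proof -
  have int': "integrable lborel (\<lambda>s. w s *\<^sub>R u (t + s))" and h': "h t = (LINT s|lborel. w s *\<^sub>R u (t + s))" for t
    using lborel_integrable_real_affine_iff[of 1 "\<lambda>s. w (s - t) *\<^sub>R u s" t] int[of t]
      lborel_integral_real_affine[of 1 "\<lambda>s. w (s - t) *\<^sub>R u s" t] h[of t] by simp_all
  have diff: "ennreal (norm (h t - h t')) \<le> (\<integral>\<^sup>+s. ennreal (w s) * ennreal (norm (u (t + s) - u (t' + s))) \<partial>lborel)" for t t'
  proof -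
    have "h t - h t' = (LINT s|lborel. w s *\<^sub>R (u (t + s) - u (t' + s)))"
      unfolding h' scaleR_diff_right by (rule Bochner_Integration.integral_diff[symmetric]) (rule int')+
    moreover have int2: "integrable lborel (\<lambda>s. w s *\<^sub>R (u (t + s) - u (t' + s)))"
      unfolding scaleR_diff_right by (intro Bochner_Integration.integrable_diff int')
    ultimately have "ennreal (norm (h t - h t')) \<le> (\<integral>\<^sup>+s. ennreal (norm (w s *\<^sub>R (u (t + s) - u (t' + s)))) \<partial>lborel)"
      using integral_norm_bound_ennreal[OF int2] by simp
    then show ?thesis using w0 by (simp add: ennreal_mult)
  qed
  have [measurable]: "h \<in> borel_measurable borel" by (rule borel_measurable_continuous_onI[OF hc])
  define I where "I = (\<lambda>t. indicator {a..b} t :: ennreal)"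
  have [measurable]: "I \<in> borel_measurable borel" by (simp add: I_def)
  have "(\<integral>\<^sup>+t. (\<integral>\<^sup>+t'. ennreal (norm (h t - h t')) * I t * I t' \<partial>lborel) \<partial>lborel)
      \<le> (\<integral>\<^sup>+t. (\<integral>\<^sup>+t'. (\<integral>\<^sup>+s. ennreal (w s) * (ennreal (norm (u (t + s) - u (t' + s))) * I t * I t') \<partial>lborel) \<partial>lborel) \<partial>lborel)"
  proof (intro nn_integral_mono)
    fix t t'
    have "ennreal (norm (h t - h t')) * I t * I t' \<le> (\<integral>\<^sup>+s. ennreal (w s) * ennreal (norm (u (t + s) - u (t' + s))) \<partial>lborel) * (I t * I t')"
      unfolding mult.assoc by (intro mult_right_mono diff) auto
    also have "\<dots> = (\<integral>\<^sup>+s. ennreal (w s) * (ennreal (norm (u (t + s) - u (t' + s))) * I t * I t') \<partial>lborel)"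
      by (subst nn_integral_multc[symmetric]) (auto simp: mult.assoc)
    finally show "ennreal (norm (h t - h t')) * I t * I t' \<le> (\<integral>\<^sup>+s. ennreal (w s) * (ennreal (norm (u (t + s) - u (t' + s))) * I t * I t') \<partial>lborel)" .
  qed
  also have "\<dots> = (\<integral>\<^sup>+t. (\<integral>\<^sup>+s. (\<integral>\<^sup>+t'. ennreal (w s) * (ennreal (norm (u (t + s) - u (t' + s))) * I t * I t') \<partial>lborel) \<partial>lborel) \<partial>lborel)"
    by (intro nn_integral_cong lborel_pair.Fubini') measurable
  also have "\<dots> = (\<integral>\<^sup>+s. (\<integral>\<^sup>+t. (\<integral>\<^sup>+t'. ennreal (w s) * (ennreal (norm (u (t + s) - u (t' + s))) * I t * I t') \<partial>lborel) \<partial>lborel) \<partial>lborel)"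
    by (rule lborel_pair.Fubini') measurable
  also have "\<dots> = (\<integral>\<^sup>+s. ennreal (w s) * (\<integral>\<^sup>+t. (\<integral>\<^sup>+t'. ennreal (norm (u (t + s) - u (t' + s))) * I t * I t' \<partial>lborel) \<partial>lborel) \<partial>lborel)"
    by (intro nn_integral_cong) (simp add: nn_integral_cmult)
  also have "\<dots> \<le> (\<integral>\<^sup>+s. ennreal (w s) * ennreal (2 * B * (b - a)\<^sup>2) \<partial>lborel)"
  proof (intro nn_integral_mono mult_left_mono)
    fix s
    \<comment> \<open>Translation by \<open>s\<close> moves the interval to
      \<open>[a + s, b + s]\<close>, where the same bound holds; the mean over that interval serves
      as the constant \<open>m\<close> of \<open>double_oscillation_le\<close>.\<close>
    have "(\<integral>\<^sup>+t\<in>{a..b}. ennreal (norm (u (t + s) - interval_mean u (a + s) (b + s))) \<partial>lborel)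
        = (\<integral>\<^sup>+t\<in>{a + s..b + s}. ennreal (norm (u t - interval_mean u (a + s) (b + s))) \<partial>lborel)"
      by (subst (2) nn_integral_real_affine[where c = 1 and t = s])
         (auto simp: indicator_def add.commute intro!: nn_integral_cong)
    also have "\<dots> \<le> ennreal (B * (b - a))" using osc[of "a + s" "b + s"] ab by simp
    finally show "(\<integral>\<^sup>+t. (\<integral>\<^sup>+t'. ennreal (norm (u (t + s) - u (t' + s))) * I t * I t' \<partial>lborel) \<partial>lborel) \<le> ennreal (2 * B * (b - a)\<^sup>2)"
      unfolding I_def by (intro double_oscillation_le[where u = "\<lambda>t. u (t + s)"] ab B) auto
  qed auto
  also have "\<dots> = ennreal (2 * B * (b - a)\<^sup>2)" by (simp add: nn_integral_multc w1)
  finally have A: "(\<integral>\<^sup>+t. (\<integral>\<^sup>+t'. ennreal (norm (h t - h t')) * I t * I t' \<partial>lborel) \<partial>lborel) \<le> ennreal (2 * B * (b - a)\<^sup>2)" .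
  define m where "m = cmean h a b"
  have "ennreal (integral {a..b} (\<lambda>t. norm (m - h t) * (b - a))) = (\<integral>\<^sup>+t. ennreal (norm (m - h t) * (b - a)) * indicator {a..b} t \<partial>lborel)"
    by (rule nn_integral_continuous_Icc[symmetric]) (use ab in \<open>auto intro!: continuous_intros hc\<close>)
  also have "\<dots> \<le> (\<integral>\<^sup>+t. (\<integral>\<^sup>+t'. ennreal (norm (h t - h t')) * I t * I t' \<partial>lborel) \<partial>lborel)"
  proof (rule nn_integral_mono)
    fix t
    have "ennreal (norm (m - h t) * (b - a)) \<le> ennreal (integral {a..b} (\<lambda>t'. norm (h t' - h t)))"
      unfolding m_def by (intro ennreal_leI norm_cmean_diff_le[OF hc ab])
    also have "\<dots> = (\<integral>\<^sup>+t'. ennreal (norm (h t' - h t)) * I t' \<partial>lborel)"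
      unfolding I_def by (rule nn_integral_continuous_Icc[symmetric]) (auto intro!: continuous_intros hc)
    finally have "ennreal (norm (m - h t) * (b - a)) * indicator {a..b} t \<le> (\<integral>\<^sup>+t'. ennreal (norm (h t' - h t)) * I t' \<partial>lborel) * I t"
      unfolding I_def by (rule mult_right_mono) simp
    also have "\<dots> = (\<integral>\<^sup>+t'. ennreal (norm (h t - h t')) * I t * I t' \<partial>lborel)"
      by (subst nn_integral_multc[symmetric]) (auto simp: norm_minus_commute mult_ac)
    finally show "ennreal (norm (m - h t) * (b - a)) * indicator {a..b} t \<le> (\<integral>\<^sup>+t'. ennreal (norm (h t - h t')) * I t * I t' \<partial>lborel)" .
  qed
  also note A
  finally have "integral {a..b} (\<lambda>t. norm (m - h t) * (b - a)) \<le> 2 * B * (b - a)\<^sup>2"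
    using B by (subst (asm) ennreal_le_iff) auto
  then have "integral {a..b} (\<lambda>t. norm (h t - m)) * (b - a) \<le> (2 * B * (b - a)) * (b - a)"
    by (simp add: norm_minus_commute power2_eq_square mult.assoc)
  then show ?thesis using ab by (simp add: m_def)
qed

section \<open>Block bounds from membership in BMOA\<close>

lemma BMO_enorm_le_imp_oscillation:
  assumes "BMO_enorm u \<le> ennreal B" "a < b" "B \<ge> 0"
  shows "oscillation u a b \<le> ennreal (B * (b - a))"
proof -
  define x where "x = oscillation u a b"
  have "x / ennreal (b - a) \<le> BMO_enorm u"
    unfolding BMO_enorm_def x_def by (rule SUP_upper2[of "(a, b)"]) (use assms in auto)
  then have "x / ennreal (b - a) \<le> ennreal B" using assms by (rule_tac order_trans)
  then have "ennreal (b - a) * (x / ennreal (b - a)) \<le> ennreal (b - a) * ennreal B" by (rule mult_left_mono) simp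
  moreover have "ennreal (b - a) * (x / ennreal (b - a)) = x"
    unfolding ennreal_times_divide mult.commute[of "ennreal (b - a)"] using assms
    by (intro mult_divide_eq_ennreal) auto
  ultimately show ?thesis using assms by (simp add: x_def ennreal_mult[symmetric] mult.commute)
qed

text \<open>Smoothing at width \<open>r\<close> makes the coefficients summable and the function
  continuous, at the price of \<open>2 * B\<close> in place of \<open>B\<close>; with the 4 of
  \<open>block_squares_le_energy\<close> this makes \<open>16 = 4 * 2\<^sup>2\<close>. The bound
  does not depend on \<open>r\<close>, so \<open>r\<close> can tend to 0.\<close>

lemma BMO_imp_block_squares_le:
  fixes \<alpha> :: "nat \<Rightarrow> real"
  assumes \<alpha>: "\<And>n. \<alpha> n \<ge> 0" and sq: "square_summable (\<lambda>n. of_real (\<alpha> n))"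
    and B: "B > 0" "BMO_enorm (boundary_value (dirichlet_sum (\<lambda>n. of_real (\<alpha> n)))) \<le> ennreal B"
    and T: "T > 0" and F: "finite F" "0 \<notin> F"
  shows "block_squares T F \<alpha> \<le> 16 * kernel_sum_const * B\<^sup>2"
proof -
  define c where "c = (\<lambda>n. complex_of_real (\<alpha> n))"
  define u where "u = boundary_value (dirichlet_sum c)"
  have sq': "square_summable c" using sq by (simp add: c_def)
  have um: "u \<in> borel_measurable borel"
    unfolding u_def by (intro boundary_value_measurable dirichlet_sum_holomorphic summable_norm_dirichlet[OF sq'])
  have osc: "oscillation u a b \<le> ennreal (B * (b - a))" if "a < b" for a b
    by (rule BMO_enorm_le_imp_oscillation) (use B that in \<open>auto simp: u_def c_def\<close>)
  define \<beta> where "\<beta> = (\<lambda>r n. \<alpha> n * (1 / (1 + r\<^sup>2 * (freq n)\<^sup>2)))"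
  have le: "block_squares T F (\<beta> r) \<le> 16 * kernel_sum_const * B\<^sup>2"
    if r: "0 < r" "r \<le> 1" for r
  proof -
    define w where "w = (\<lambda>s::real. exp (- \<bar>s\<bar> / r) / (2 * r))"
    define h where "h = (\<lambda>t. LINT s|lborel. w (s - t) *\<^sub>R u s)"
    have \<beta>0: "\<beta> r n \<ge> 0" for n using \<alpha> by (simp add: \<beta>_def add_nonneg_nonneg)
    have \<beta>s: "summable (\<beta> r)"
      using summable_smoothed_coefficients[OF sq' r] \<alpha> by (simp add: \<beta>_def c_def)
    have hs: "(\<lambda>n. of_real (\<beta> r n) * cis (- freq n * t)) sums h t" for t
      using smoothed_series(2)[OF sq' r, of t] by (simp add: h_def w_def u_def \<beta>_def c_def)
    have hc: "continuous_on UNIV h"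
      by (rule absolutely_summable_trig_continuous[OF _ hs]) (use \<beta>s \<beta>0 in auto)
    have w1: "(\<integral>\<^sup>+s. ennreal (w s) \<partial>lborel) = 1"
    proof -
      have "has_bochner_integral lborel (\<lambda>s. exp (- \<bar>s - 0\<bar> / r) / (2 * r)) (2 * r / (2 * r))"
        by (intro has_bochner_integral_divide_zero integrable_exp_kernel r)
      then have "has_bochner_integral lborel w 1" using r by (simp add: w_def)
      then show ?thesis using r by (subst nn_integral_eq_integral) (auto simp: has_bochner_integral_iff w_def)
    qed
    have hosc: "integral {a..b} (\<lambda>t. norm (h t - cmean h a b)) \<le> 2 * B * (b - a)" if "a < b" for a b
      by (rule smoothing_oscillation_le[OF um _ _ w1 _ osc _ _ hc that])
         (use r B smoothed_series(1)[OF sq' r] in \<open>auto simp: h_def w_def u_def\<close>)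
    have "(\<integral>\<^sup>+t. ennreal (exp (- \<bar>t\<bar> / T) * (norm (h t - cmean h (- T) T))\<^sup>2) \<partial>lborel) \<le> ennreal (kernel_sum_const * T * (2 * B)\<^sup>2)"
      by (rule weighted_L2_oscillation_le[OF hc _ hosc T]) (use B in auto)
    then have "block_squares T F (\<beta> r) \<le> 4 / T * (kernel_sum_const * T * (2 * B)\<^sup>2)"
      by (intro block_squares_le_energy[OF \<beta>0 \<beta>s hs T _ _ F]) (use kernel_sum_const_nonneg T in auto)
    then show ?thesis using T by (simp add: power2_eq_square mult_ac)
  qed
  show ?thesis
  proof (rule block_squares_le_limit[OF _ le])
    fix n
    have "(\<lambda>j. \<beta> (inverse (real (Suc j))) n) \<longlonglongrightarrow> \<alpha> n * (1 / (1 + 0\<^sup>2 * (freq n)\<^sup>2))"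
      unfolding \<beta>_def by (intro tendsto_intros LIMSEQ_inverse_real_of_nat) auto
    then show "(\<lambda>j. \<beta> (inverse (real (Suc j))) n) \<longlonglongrightarrow> \<alpha> n" by simp
  qed
qed

text \<open>On vertical lines inside the half-plane the series converges absolutely, so the lower
  energy bound applies before any boundary function is available. The result is used qualitatively,
  to obtain \<open>square_summable\<close>.\<close>

lemma square_integrable_imp_block_squares_le:
  fixes \<alpha> :: "nat \<Rightarrow> real"
  assumes \<alpha>: "\<And>n. \<alpha> n \<ge> 0" and abs: "\<And>\<sigma>. \<sigma> > 0 \<Longrightarrow> summable (\<lambda>n. \<alpha> n * exp (- freq n * \<sigma>))"
    and f: "\<And>s. Re s > 0 \<Longrightarrow> f s = dirichlet_sum (\<lambda>n. of_real (\<alpha> n)) s"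
    and M: "M \<ge> 0" "\<And>\<sigma>. \<sigma> > 0 \<Longrightarrow> (\<integral>\<^sup>+t. ennreal ((norm (f (Complex \<sigma> t)))\<^sup>2 / (1 + \<sigma>\<^sup>2 + t\<^sup>2)) \<partial>lborel) \<le> ennreal M"
    and F: "finite F" "0 \<notin> F"
  shows "block_squares 1 F \<alpha> \<le> 8 * M"
proof -
  define \<beta> where "\<beta> = (\<lambda>\<sigma> n. \<alpha> n * exp (- freq n * \<sigma>))"
  have le: "block_squares 1 F (\<beta> \<sigma>) \<le> 8 * M" if \<sigma>: "0 < \<sigma>" "\<sigma> \<le> 1" for \<sigma>
  proof -
    define h where "h = (\<lambda>t. f (Complex \<sigma> t))"
    have hs: "(\<lambda>n. of_real (\<beta> \<sigma> n) * cis (- freq n * t)) sums h t" for t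
      using dirichlet_sum_has_derivative(1)[of "\<lambda>n. of_real (\<alpha> n)" "Complex \<sigma> t"] abs \<alpha> \<sigma> f[of "Complex \<sigma> t"]
      unfolding exp_freq_Complex by (simp add: h_def \<beta>_def mult.assoc)
    have \<beta>0: "\<beta> \<sigma> n \<ge> 0" for n using \<alpha> by (simp add: \<beta>_def)
    have \<beta>s: "summable (\<beta> \<sigma>)" using abs[OF \<sigma>(1)] by (simp add: \<beta>_def)
    have [measurable]: "h \<in> borel_measurable borel"
      by (rule borel_measurable_continuous_onI[OF absolutely_summable_trig_continuous[OF _ hs]]) (use \<beta>s \<beta>0 in auto)
    have "(\<integral>\<^sup>+t. ennreal (exp (- \<bar>t\<bar> / 1) * (norm (h t - 0))\<^sup>2) \<partial>lborel)
        \<le> (\<integral>\<^sup>+t. ennreal 2 * ennreal ((norm (h t))\<^sup>2 / (1 + \<sigma>\<^sup>2 + t\<^sup>2)) \<partial>lborel)"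
    proof (rule nn_integral_mono)
      fix t :: real
      \<comment> \<open>For \<open>\<sigma> <= 1\<close> the kernel is at most twice the given
        weight; this 2 and the 4 of \<open>block_squares_le_energy\<close> make the 8.\<close>
      have "\<sigma>\<^sup>2 \<le> 1" using \<sigma> by (simp add: power_le_one)
      moreover have "1 + \<bar>t\<bar> + \<bar>t\<bar>\<^sup>2 / 2 \<le> exp \<bar>t\<bar>" by (rule exp_lower_Taylor_quadratic) simp
      ultimately have "1 + \<sigma>\<^sup>2 + t\<^sup>2 \<le> 2 * exp \<bar>t\<bar>" by simp
      moreover have "0 < 1 + \<sigma>\<^sup>2 + t\<^sup>2" by (auto intro!: add_pos_nonneg)
      ultimately have "exp (- \<bar>t\<bar>) \<le> 2 / (1 + \<sigma>\<^sup>2 + t\<^sup>2)" by (simp add: exp_minus field_simps)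
      then have "exp (- \<bar>t\<bar>) * (norm (h t))\<^sup>2 \<le> 2 / (1 + \<sigma>\<^sup>2 + t\<^sup>2) * (norm (h t))\<^sup>2" by (rule mult_right_mono) simp
      then have "ennreal (exp (- \<bar>t\<bar>) * (norm (h t))\<^sup>2) \<le> ennreal (2 * ((norm (h t))\<^sup>2 / (1 + \<sigma>\<^sup>2 + t\<^sup>2)))" by (intro ennreal_leI) simp
      also have "\<dots> = ennreal 2 * ennreal ((norm (h t))\<^sup>2 / (1 + \<sigma>\<^sup>2 + t\<^sup>2))" by (rule ennreal_mult') simp
      finally show "ennreal (exp (- \<bar>t\<bar> / 1) * (norm (h t - 0))\<^sup>2) \<le> ennreal 2 * ennreal ((norm (h t))\<^sup>2 / (1 + \<sigma>\<^sup>2 + t\<^sup>2))"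
        by (simp only: div_by_1 diff_zero)
    qed
    also have "\<dots> = ennreal 2 * (\<integral>\<^sup>+t. ennreal ((norm (h t))\<^sup>2 / (1 + \<sigma>\<^sup>2 + t\<^sup>2)) \<partial>lborel)"
      by (rule nn_integral_cmult) measurable
    also have "\<dots> \<le> ennreal 2 * ennreal M" unfolding h_def by (intro mult_left_mono M \<sigma>) auto
    also have "\<dots> = ennreal (2 * M)" using M by (simp add: ennreal_mult')
    finally have en: "(\<integral>\<^sup>+t. ennreal (exp (- \<bar>t\<bar> / 1) * (norm (h t - 0))\<^sup>2) \<partial>lborel) \<le> ennreal (2 * M)" .
    have "block_squares 1 F (\<beta> \<sigma>) \<le> 4 / 1 * (2 * M)"
      by (rule block_squares_le_energy[OF \<beta>0 \<beta>s hs zero_less_one _ en F]) (use M in auto)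
    then show ?thesis by simp
  qed
  show ?thesis
  proof (rule block_squares_le_limit[OF _ le])
    fix n
    have "(\<lambda>j. \<beta> (inverse (real (Suc j))) n) \<longlonglongrightarrow> \<alpha> n * exp (- freq n * 0)"
      unfolding \<beta>_def by (intro tendsto_intros LIMSEQ_inverse_real_of_nat)
    then show "(\<lambda>j. \<beta> (inverse (real (Suc j))) n) \<longlonglongrightarrow> \<alpha> n" by simp
  qed
qed

lemma block_squares_imp_summable:
  fixes \<alpha> :: "nat \<Rightarrow> real"
  assumes c: "\<And>n. norm (c n) = \<alpha> n" and T: "T > 0"
    and le: "\<And>F. finite F \<Longrightarrow> 0 \<notin> F \<Longrightarrow>
      block_squares T F \<alpha> \<le> X"
  shows "summable (\<lambda>k. (block_mass c (1 / T) (Suc k))\<^sup>2)" and "(\<Sum>k. (block_mass c (1 / T) (Suc k))\<^sup>2) \<le> X"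
proof -
  define fl where "fl = (\<lambda>n. nat \<lfloor>freq n * T\<rfloor>)"
  have fin: "finite {n. fl n = k}" for k
    using finite_freq_block[of "1 / T" k] T by (simp add: fl_def)
  have part: "(\<Sum>k<K. (block_mass c (1 / T) (Suc k))\<^sup>2) \<le> X" for K
  proof -
    define F where "F = {n. fl n \<in> {1..K}}"
    have "F = (\<Union>k\<in>{1..K}. {n. fl n = k})" by (auto simp: F_def)
    then have finF: "finite F" using fin by simp
    have "(\<Sum>k<K. (block_mass c (1 / T) (Suc k))\<^sup>2) = (\<Sum>k\<in>{1..K}. (block_mass c (1 / T) k)\<^sup>2)"
      by (rule sum.reindex_bij_witness[of _ "\<lambda>k. k - 1" Suc]) auto
    also have "\<dots> = (\<Sum>k\<in>{1..K}. (\<Sum>n\<in>{n\<in>F. fl n = k}. \<alpha> n)\<^sup>2)"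
      by (intro sum.cong refl) (auto simp: block_mass_def c F_def fl_def intro!: arg_cong[of _ _ "\<lambda>x. x\<^sup>2"] sum.cong)
    also have "\<dots> = (\<Sum>k\<in>fl ` F - {0}. (\<Sum>n\<in>{n\<in>F. fl n = k}. \<alpha> n)\<^sup>2)"
    proof (rule sum.mono_neutral_right)
      show "\<forall>k\<in>{1..K} - (fl ` F - {0}). (\<Sum>n\<in>{n\<in>F. fl n = k}. \<alpha> n)\<^sup>2 = 0"
      proof
        fix k assume "k \<in> {1..K} - (fl ` F - {0})"
        then have "{n\<in>F. fl n = k} = {}" by auto
        then show "(\<Sum>n\<in>{n\<in>F. fl n = k}. \<alpha> n)\<^sup>2 = 0" by (simp only: sum.empty) simp
      qed
    qed (auto simp: F_def)
    also have "\<dots> \<le> X" unfolding fl_def block_squares_def[symmetric] by (rule le) (use finF in \<open>auto simp: F_def fl_def\<close>)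
    finally show ?thesis .
  qed
  show s: "summable (\<lambda>k. (block_mass c (1 / T) (Suc k))\<^sup>2)"
    by (rule summableI_nonneg_bounded[OF _ part]) simp
  show "(\<Sum>k. (block_mass c (1 / T) (Suc k))\<^sup>2) \<le> X"
    by (rule suminf_le_const[OF s]) (rule part)
qed

section \<open>The main theorem\<close>

text \<open>With \<open>x = exp L\<close> the powers of \<open>x\<close> become multiples of
  \<open>L\<close>, and \<open>n = m + 1\<close> translates between the indexing of the theorem and
  that of \<open>freq\<close>.\<close>

lemma block_sum_eq:
  fixes a :: "nat \<Rightarrow> real"
  assumes L: "L > 0"
  shows "(\<Sum>n | exp L ^ Suc k \<le> real n \<and> real n < exp L ^ Suc (Suc k). a n) = (\<Sum>m | nat \<lfloor>freq m / L\<rfloor> = Suc k. a (Suc m))"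
proof -
  have iff: "nat \<lfloor>freq m / L\<rfloor> = Suc k \<longleftrightarrow> exp L ^ Suc k \<le> real (Suc m) \<and> real (Suc m) < exp L ^ Suc (Suc k)" for m
  proof -
    have "exp L ^ j \<le> real (Suc m) \<longleftrightarrow> real j * L \<le> freq m" for j
    proof -
      have "exp L ^ j = exp (real j * L)" by (simp add: exp_of_nat_mult)
      moreover have "real (Suc m) = exp (freq m)" by (simp add: freq_def)
      ultimately show ?thesis by (simp only: exp_le_cancel_iff)
    qed
    then have "exp L ^ Suc k \<le> real (Suc m) \<and> real (Suc m) < exp L ^ Suc (Suc k) \<longleftrightarrow> real (Suc k) \<le> freq m / L \<and> freq m / L < real (Suc (Suc k))"
      by (simp only: not_le[symmetric] pos_le_divide_eq[OF L])
    moreover have "nat \<lfloor>freq m / L\<rfloor> = Suc k \<longleftrightarrow> real (Suc k) \<le> freq m / L \<and> freq m / L < real (Suc (Suc k))"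
      by (simp add: nat_eq_iff) linarith
    ultimately show ?thesis by blast
  qed
  have pos: "n \<noteq> 0" if "exp L ^ Suc k \<le> real n" for n
    using that by (metis exp_gt_zero linorder_not_le of_nat_0 zero_less_power)
  show ?thesis
    by (rule sum.reindex_bij_witness[of _ Suc "\<lambda>n. n - 1"]) (use iff pos in \<open>auto simp del: power_Suc of_nat_Suc\<close>)
qed

lemma block_sup_eq:
  assumes c: "\<And>n. norm (c n) = a (Suc n)"
  shows "block_sup a = (SUP L\<in>{1..}. \<Sum>k. ennreal ((block_mass c L (Suc k))\<^sup>2))"
proof -
  have "{exp (1::real)..} = exp ` {1..}"
  proof (intro equalityI subsetI)
    fix x :: real assume "x \<in> {exp 1..}"
    then have x: "exp 1 \<le> x" by simp
    then have "0 < x" by (meson exp_gt_zero less_le_trans)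
    then have "x = exp (ln x)" "1 \<le> ln x" using x by (auto simp: ln_ge_iff)
    then show "x \<in> exp ` {1..}" by blast
  qed auto
  then have "block_sup a = (SUP L\<in>{1..}. \<Sum>k. ennreal ((\<Sum>n | exp L ^ Suc k \<le> real n \<and> real n < exp L ^ Suc (Suc k). a n)\<^sup>2))"
    unfolding block_sup_def by (simp only: image_image)
  also have "\<dots> = (SUP L\<in>{1..}. \<Sum>k. ennreal ((block_mass c L (Suc k))\<^sup>2))"
  proof (rule SUP_cong[OF refl])
    fix L :: real assume "L \<in> {1..}"
    then have "L > 0" by simp
    then show "(\<Sum>k. ennreal ((\<Sum>n | exp L ^ Suc k \<le> real n \<and> real n < exp L ^ Suc (Suc k). a n)\<^sup>2)) = (\<Sum>k. ennreal ((block_mass c L (Suc k))\<^sup>2))"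
      by (simp only: block_sum_eq block_mass_def c)
  qed
  finally show ?thesis .
qed

lemma block_bound_of_block_sup:
  assumes c: "\<And>n. norm (c n) = a (Suc n)" and M: "M > 0" "a 2 \<le> M" "block_sup a \<le> ennreal (M\<^sup>2)"
  shows "block_bound c M"
  unfolding block_bound_def
proof (intro conjI allI impI)
  show "norm (c 1) \<le> M" using M c[of 1] by (simp add: numeral_2_eq_2)
  fix L :: real assume "1 \<le> L"
  then have le: "(\<Sum>k. ennreal ((block_mass c L (Suc k))\<^sup>2)) \<le> ennreal (M\<^sup>2)"
    using M(3) unfolding block_sup_eq[of c a, OF c] by (auto simp: SUP_le_iff)
  then have "(\<Sum>k. ennreal ((block_mass c L (Suc k))\<^sup>2)) \<noteq> top" by (auto simp: top_unique)
  then show s: "summable (\<lambda>k. (block_mass c L (Suc k))\<^sup>2)" by (intro summable_suminf_not_top) auto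
  show "(\<Sum>k. (block_mass c L (Suc k))\<^sup>2) \<le> M\<^sup>2"
    using le by (subst (asm) suminf_ennreal2[OF _ s]) auto
qed (use M in auto)

lemma block_sup_le:
  assumes c: "\<And>n. norm (c n) = a (Suc n)"
    and "\<And>L. L \<ge> 1 \<Longrightarrow> summable (\<lambda>k. (block_mass c L (Suc k))\<^sup>2)" "\<And>L. L \<ge> 1 \<Longrightarrow> (\<Sum>k. (block_mass c L (Suc k))\<^sup>2) \<le> Y"
  shows "block_sup a \<le> ennreal Y"
  unfolding block_sup_eq[of c a, OF c]
proof (rule SUP_least)
  fix L :: real assume "L \<in> {1..}"
  then show "(\<Sum>k. ennreal ((block_mass c L (Suc k))\<^sup>2)) \<le> ennreal Y"
    using assms(2,3)[of L] by (subst suminf_ennreal2) (auto intro: ennreal_leI)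
qed

lemma dirichlet_extension_iff:
  "dirichlet_extension a f \<longleftrightarrow> f holomorphic_on right_half_plane \<and>
    (\<exists>\<sigma>\<^sub>0. \<forall>s. Re s > \<sigma>\<^sub>0 \<longrightarrow> (\<lambda>n. a (Suc n) * exp (- (of_real (freq n) * s))) sums f s)"
  unfolding dirichlet_extension_def powr_eq_exp_freq ..

lemma BMOA_imp_ennreal_norm: "f \<in> BMOA \<Longrightarrow> BMO_enorm (boundary_value f) = ennreal (BMOA_norm f)"
  by (auto simp: BMOA_def BMOA_norm_def less_top)

text \<open>Only the moduli of \<open>c\<close> are prescribed, so the lemma yields the sufficiency
  in (i) and also the step from moduli to complex coefficients in (ii).\<close>

lemma dirichlet_in_BMOA_of_block_sup:
  assumes c: "\<And>n. norm (c (Suc n)) = a (Suc n)" and fin: "block_sup a < \<infinity>"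
  shows "dirichlet_in_BMOA c"
proof -
  \<comment> \<open>The summand 1 makes \<open>M\<close> positive, as \<open>block_bound\<close>
    demands.\<close>
  define M where "M = block_S a + a 2 + 1"
  have a2: "a 2 \<ge> 0" using c[of 1] norm_ge_zero[of "c (Suc 1)"] by (simp add: numeral_2_eq_2)
  have S: "block_S a \<ge> 0" by (simp add: block_S_def)
  have M: "block_bound (\<lambda>n. c (Suc n)) M"
  proof (rule block_bound_of_block_sup[where a = a])
    have "block_sup a = ennreal ((block_S a)\<^sup>2)" using fin by (simp add: block_S_def)
    also have "\<dots> \<le> ennreal (M\<^sup>2)" using S a2 by (intro ennreal_leI power_mono) (auto simp: M_def)
    finally show "block_sup a \<le> ennreal (M\<^sup>2)" .
  qed (use c S a2 in \<open>auto simp: M_def\<close>)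
  have abs: "\<And>\<sigma>. \<sigma> > 0 \<Longrightarrow> summable (\<lambda>n. norm (c (Suc n)) * exp (- freq n * \<sigma>))"
    by (rule summable_norm_dirichlet[OF block_bound_summable[OF M]])
  have "dirichlet_extension c (dirichlet_sum (\<lambda>n. c (Suc n)))"
    unfolding dirichlet_extension_iff
    using dirichlet_sum_holomorphic[OF abs] dirichlet_sum_has_derivative(1)[OF abs] by (intro conjI exI[of _ 0]) auto
  moreover have "dirichlet_sum (\<lambda>n. c (Suc n)) \<in> BMOA" by (rule block_bound_imp_BMOA(1)[OF M]) simp
  ultimately show ?thesis by (auto simp: dirichlet_in_BMOA_def)
qed

text \<open>The bounds are stated for any positive \<open>B\<close> above the norm, since the
  estimates behind them work with a positive oscillation bound, while the norm itself may be
  zero.\<close>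

lemma nonneg_BMOA_imp_blocks:
  assumes a: "\<And>n. n \<ge> 1 \<Longrightarrow> a n \<ge> 0" and f: "dirichlet_extension (\<lambda>n. complex_of_real (a n)) f" "f \<in> BMOA"
  defines "c \<equiv> \<lambda>n. complex_of_real (a (Suc n))"
  shows "\<And>s. Re s > 0 \<Longrightarrow> f s = dirichlet_sum c s"
    and "B > 0 \<Longrightarrow> BMOA_norm f \<le> B \<Longrightarrow> block_sup a \<le> ennreal (16 * kernel_sum_const * B\<^sup>2)"
    and "B > 0 \<Longrightarrow> BMOA_norm f \<le> B \<Longrightarrow> (a 2)\<^sup>2 \<le> 16 * kernel_sum_const * B\<^sup>2"
proof -
  define \<alpha> where "\<alpha> = (\<lambda>n. a (Suc n))"
  have \<alpha>0: "\<alpha> n \<ge> 0" for n using a by (simp add: \<alpha>_def)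
  have c\<alpha>: "c = (\<lambda>n. of_real (\<alpha> n))" by (simp add: c_def \<alpha>_def)
  have nc: "norm (c n) = \<alpha> n" for n using \<alpha>0 by (simp add: c\<alpha>)
  have hol: "f holomorphic_on right_half_plane" using f(1) by (simp add: dirichlet_extension_iff)
  obtain \<sigma>\<^sub>0 where sums: "\<And>s. Re s > \<sigma>\<^sub>0 \<Longrightarrow> (\<lambda>n. c n * exp (- (of_real (freq n) * s))) sums f s"
    using f(1) by (auto simp: dirichlet_extension_iff c_def)
  have abs: "summable (\<lambda>n. \<alpha> n * exp (- freq n * \<sigma>))" if "\<sigma> > 0" for \<sigma>
    by (rule landau_summable[OF \<alpha>0 hol sums[unfolded c\<alpha>] that])
  have abs': "summable (\<lambda>n. norm (c n) * exp (- freq n * \<sigma>))" if "\<sigma> > 0" for \<sigma>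
    using abs[OF that] by (simp only: nc)
  show feq: "f s = dirichlet_sum c s" if "Re s > 0" for s
    by (rule extension_eq_dirichlet_sum[OF abs' hol sums that])
  \<comment> \<open>The square integral comes first: it gives \<open>square_summable\<close>, on
    which the expansion of the boundary function rests.\<close>
  define S where "S = (SUP \<sigma> \<in> {0<..}. \<integral>\<^sup>+ t. ennreal ((cmod (f (Complex \<sigma> t)))\<^sup>2 / (1 + \<sigma>\<^sup>2 + t\<^sup>2)) \<partial>lborel)"
  have Sfin: "S < \<infinity>" using f(2) by (simp add: BMOA_def S_def)
  have "(\<integral>\<^sup>+t. ennreal ((norm (f (Complex \<sigma> t)))\<^sup>2 / (1 + \<sigma>\<^sup>2 + t\<^sup>2)) \<partial>lborel) \<le> ennreal (enn2real S)" if "\<sigma> > 0" for \<sigma>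
  proof -
    have "(\<integral>\<^sup>+t. ennreal ((norm (f (Complex \<sigma> t)))\<^sup>2 / (1 + \<sigma>\<^sup>2 + t\<^sup>2)) \<partial>lborel) \<le> S"
      unfolding S_def by (rule SUP_upper) (use that in simp)
    then show ?thesis using Sfin by (simp add: less_top)
  qed
  then have "summable (\<lambda>k. (block_mass c (1 / 1) (Suc k))\<^sup>2)"
    using block_squares_imp_summable(1)[OF nc zero_less_one
        square_integrable_imp_block_squares_le[OF \<alpha>0 abs feq[unfolded c\<alpha>] enn2real_nonneg]] by blast
  then have sq: "square_summable c"
    using summable_Suc_iff[of "\<lambda>k. (block_mass c 1 k)\<^sup>2"] by simp
  assume B: "B > 0" "BMOA_norm f \<le> B"
  have "BMO_enorm (boundary_value (dirichlet_sum c)) = ennreal (BMOA_norm f)"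
    using BMOA_imp_ennreal_norm[OF f(2)] boundary_value_cong[OF feq] by simp
  also have "\<dots> \<le> ennreal B" using B by (intro ennreal_leI)
  finally have norm: "BMO_enorm (boundary_value (dirichlet_sum (\<lambda>n. of_real (\<alpha> n)))) \<le> ennreal B" by (simp add: c\<alpha>)
  note le = BMO_imp_block_squares_le[OF \<alpha>0 sq[unfolded c\<alpha>] B(1) norm]
  show "block_sup a \<le> ennreal (16 * kernel_sum_const * B\<^sup>2)"
  proof (rule block_sup_le[where c = c])
    show "norm (c n) = a (Suc n)" for n by (simp add: nc \<alpha>_def)
    fix L :: real assume "L \<ge> 1"
    then have L: "1 / L > 0" "1 / (1 / L) = L" by auto
    show "summable (\<lambda>k. (block_mass c L (Suc k))\<^sup>2)" "(\<Sum>k. (block_mass c L (Suc k))\<^sup>2) \<le> 16 * kernel_sum_const * B\<^sup>2"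
      using block_squares_imp_summable[OF nc L(1) le[OF L(1)]] unfolding L(2) by auto
  qed
  \<comment> \<open>At scale \<open>T = 2\<close> the frequency \<open>ln 2\<close> lies in the block of index 1, so \<open>a\<^sub>2\<close> is caught as well.\<close>
  have f1: "nat \<lfloor>freq 1 * 2\<rfloor> = 1"
  proof -
    have "freq 1 = ln 2" by (simp add: freq_def)
    moreover have "2 / 3 \<le> ln (2::real)" "ln (2::real) < 1" using ln2_ge_two_thirds ln_less_self[of 2] ln_2_less_1 by auto
    ultimately have "\<lfloor>freq 1 * 2\<rfloor> = 1" by linarith
    then show ?thesis by simp
  qed
  have "block_squares 2 {1} \<alpha> \<le> 16 * kernel_sum_const * B\<^sup>2"
    by (rule le) auto
  moreover have "(\<lambda>n. nat \<lfloor>freq n * 2\<rfloor>) ` {1} - {0} = {1}" using f1 by auto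
  moreover have "{n\<in>{1}. nat \<lfloor>freq n * 2\<rfloor> = 1} = {1}" using f1 by auto
  ultimately show "(a 2)\<^sup>2 \<le> 16 * kernel_sum_const * B\<^sup>2" by (simp add: block_squares_def \<alpha>_def numeral_2_eq_2)
qed

theorem theorem3p2:
  shows "(\<exists>C::real. C > 0 \<and> (\<forall>a :: nat \<Rightarrow> real. (\<forall>n\<ge>1. a n \<ge> 0) \<longrightarrow>
            (dirichlet_in_BMOA (\<lambda>n. complex_of_real (a n)) \<longleftrightarrow> block_sup a < \<infinity>) \<and>
            (\<forall>f. dirichlet_extension (\<lambda>n. complex_of_real (a n)) f \<and> f \<in> BMOA \<longrightarrow>
               block_S a + a 2 \<le> C * BMOA_norm f \<and>
               BMOA_norm f \<le> C * (block_S a + a 2)))) \<and>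
         (\<forall>a :: nat \<Rightarrow> complex.
            dirichlet_in_BMOA (\<lambda>n. complex_of_real (cmod (a n))) \<longrightarrow> dirichlet_in_BMOA a)"
proof -
  define K where "K = sqrt (16 * kernel_sum_const)"
  have K: "K \<ge> 0" "K\<^sup>2 = 16 * kernel_sum_const" using kernel_sum_const_nonneg by (auto simp: K_def)
  \<comment> \<open>Dominates both \<open>2 * K\<close> and \<open>bmo_const\<close>; the summand 1
    makes it positive.\<close>
  define C where "C = bmo_const + 2 * K + 1"
  have necessary: "block_sup a < \<infinity>" if a: "\<forall>n\<ge>1. a n \<ge> 0" and in_BMOA: "dirichlet_in_BMOA (\<lambda>n. complex_of_real (a n))" for a
  proof -
    obtain f where f: "dirichlet_extension (\<lambda>n. complex_of_real (a n)) f" "f \<in> BMOA"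
      using in_BMOA by (auto simp: dirichlet_in_BMOA_def)
    have "0 \<le> BMOA_norm f" by (simp add: BMOA_norm_def)
    then have "block_sup a \<le> ennreal (16 * kernel_sum_const * (BMOA_norm f + 1)\<^sup>2)"
      by (intro nonneg_BMOA_imp_blocks(2)[OF _ f]) (use a in auto)
    then show ?thesis by (simp add: le_less_trans)
  qed
  have sufficient: "dirichlet_in_BMOA (\<lambda>n. complex_of_real (a n))" if "\<forall>n\<ge>1. a n \<ge> 0" "block_sup a < \<infinity>" for a
    by (rule dirichlet_in_BMOA_of_block_sup[OF _ that(2)]) (use that(1) in auto)
  have lower: "block_S a + a 2 \<le> C * BMOA_norm f"
    if a: "\<forall>n\<ge>1. a n \<ge> 0" and f: "dirichlet_extension (\<lambda>n. complex_of_real (a n)) f" "f \<in> BMOA" for a f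
  proof -
    have N0: "0 \<le> BMOA_norm f" by (simp add: BMOA_norm_def)
    have a2: "0 \<le> a 2" using a by simp
    have a': "\<And>n. n \<ge> 1 \<Longrightarrow> a n \<ge> 0" using a by blast
    have le: "block_S a + a 2 \<le> 2 * K * B" if B: "BMOA_norm f < B" for B
    proof -
      have B0: "0 < B" "BMOA_norm f \<le> B" using B N0 by auto
      have "enn2real (block_sup a) \<le> (K * B)\<^sup>2"
        using nonneg_BMOA_imp_blocks(2)[OF a' f B0] by (intro enn2real_leI) (simp_all add: power_mult_distrib K(2) kernel_sum_const_nonneg)
      then have "block_S a \<le> sqrt ((K * B)\<^sup>2)" unfolding block_S_def by (rule real_sqrt_le_mono)
      then have "block_S a \<le> K * B" using K B0 by simp
      moreover have "a 2 \<le> K * B"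
        by (rule power2_le_imp_le) (use nonneg_BMOA_imp_blocks(3)[OF a' f B0] K B0 in \<open>auto simp: power_mult_distrib\<close>)
      ultimately show ?thesis by simp
    qed
    \<comment> \<open>Letting \<open>B\<close> decrease to the norm covers a vanishing norm.\<close>
    have "((\<lambda>B. 2 * K * B) \<longlongrightarrow> 2 * K * BMOA_norm f) (at_right (BMOA_norm f))" by (intro tendsto_intros)
    then have "block_S a + a 2 \<le> 2 * K * BMOA_norm f"
      by (rule tendsto_lowerbound[OF _ eventually_mono[OF eventually_at_right_less le]]) auto
    also have "\<dots> \<le> C * BMOA_norm f"
      using N0 bmo_const_nonneg by (intro mult_right_mono) (auto simp: C_def)
    finally show ?thesis .
  qed
  have upper: "BMOA_norm f \<le> C * (block_S a + a 2)"
    if a: "\<forall>n\<ge>1. a n \<ge> 0" and f: "dirichlet_extension (\<lambda>n. complex_of_real (a n)) f" "f \<in> BMOA" for a f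
  proof -
    have a2: "0 \<le> a 2" using a by simp
    have S0: "0 \<le> block_S a" by (simp add: block_S_def)
    have a': "\<And>n. n \<ge> 1 \<Longrightarrow> a n \<ge> 0" using a by blast
    have fin: "block_sup a < \<infinity>" using necessary[OF a] f by (auto simp: dirichlet_in_BMOA_def)
    have le: "BMOA_norm f \<le> bmo_const * M" if M: "block_S a + a 2 < M" for M
    proof -
      have M0: "0 < M" "a 2 \<le> M" using M S0 a2 by linarith+
      have bb: "block_bound (\<lambda>n. complex_of_real (a (Suc n))) M"
      proof (rule block_bound_of_block_sup[where a = a])
        have "block_sup a = ennreal ((block_S a)\<^sup>2)" using fin by (simp add: block_S_def)
        also have "\<dots> \<le> ennreal (M\<^sup>2)" using M S0 a2 by (intro ennreal_leI power_mono) auto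
        finally show "block_sup a \<le> ennreal (M\<^sup>2)" .
      qed (use a M0 in simp_all)
      have "ennreal (BMOA_norm f) \<le> ennreal (bmo_const * M)"
        unfolding BMOA_imp_ennreal_norm[OF f(2), symmetric]
        by (rule block_bound_imp_BMOA(2)[OF bb nonneg_BMOA_imp_blocks(1)[OF a' f]])
      then show ?thesis using bmo_const_nonneg M S0 a2 by (subst (asm) ennreal_le_iff) auto
    qed
    \<comment> \<open>Again a limit, because \<open>block_bound\<close> requires
      \<open>M > 0\<close> while \<open>block_S a + a 2\<close> may be 0.\<close>
    have "((\<lambda>M. bmo_const * M) \<longlongrightarrow> bmo_const * (block_S a + a 2)) (at_right (block_S a + a 2))" by (intro tendsto_intros)
    then have "BMOA_norm f \<le> bmo_const * (block_S a + a 2)"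
      by (rule tendsto_lowerbound[OF _ eventually_mono[OF eventually_at_right_less le]]) auto
    also have "\<dots> \<le> C * (block_S a + a 2)"
      using S0 a2 K(1) by (intro mult_right_mono) (auto simp: C_def)
    finally show ?thesis .
  qed
  \<comment> \<open>Necessity for the moduli gives a finite \<open>block_sup\<close>, which is all
    that sufficiency asks of \<open>a\<close> itself.\<close>
  have "dirichlet_in_BMOA a" if "dirichlet_in_BMOA (\<lambda>n. complex_of_real (cmod (a n)))" for a
    by (rule dirichlet_in_BMOA_of_block_sup[OF refl]) (rule necessary[OF _ that], simp)
  moreover have "C > 0" using bmo_const_nonneg K(1) by (simp add: C_def)
  ultimately show ?thesis using necessary sufficient lower upper by blast
qed

end
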